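(* Let $L=\lim_{n\to\infty}W_{-n}$ be the inductive limit of the Weyl modules for $\mathfrak{osp}(1,2)[t]$ along the embeddings $W_{-n}\to W_{-n-1}$, $w_{-n}\mapsto g_n^+w_{-n-1}$, and let $\mathrm{ch}\,L(x,q)=\lim_{n\to\infty}q^{n(n-1)/2}\,\mathrm{ch}\,W_{-n}(x,q^{-1})$. Then $$\mathrm{ch}\,L(x,q)=\prod_{i=0}^\infty(1+q^ix)\prod_{i=0}^\infty(1+q^ix^{-1}).$$
   Context: Everything is over $\mathbb{C}$. $\mathfrak{osp}(1,2)$ is the Lie superalgebra with even part $\mathfrak{sl}_2$ (standard basis $e,h,f$) and odd part with basis $g^+,g^-$; the nontrivial brackets are $[e,f]=h$, $[h,e]=2e$, $[h,f]=-2f$, $[h,g^\pm]=\pm g^\pm$, $[g^+,g^-]_+=h$, $[g^+,g^+]_+=2e$, $[g^-,g^-]_+=-2f$, $[f,g^+]=-g^-$, $[e,g^-]=-g^+$. Put $\mathfrak n^-=\mathrm{span}(f,g^-)$, $\mathfrak h=\mathbb{C}h$, $\mathfrak{osp}(1,2)[t]=\mathfrak{osp}(1,2)\otimes\mathbb{C}[t]$ and $y_i=y\otimes t^i$. The Weyl module $W_{-n}$ is the cyclic $\mathfrak{osp}(1,2)[t]$-module with generator $w_{-n}$ and defining relations $(\mathfrak n^-\oplus\mathfrak h)\otimes t\mathbb{C}[t].w_{-n}=0$, $(\mathfrak n^-\otimes 1).w_{-n}=0$, $h_0w_{-n}=-nw_{-n}$, $e_0^{n+1}w_{-n}=0$;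 it is graded by $t$-degree with $\deg w_{-n}=0$, and $\mathrm{ch}\,M(x,q)=\sum_sq^s\,\mathrm{tr}(x^h|_{M_s})$. The limit of characters is taken coefficientwise (coefficients of $x^aq^b$). The maps $W_{-n}\to W_{-n-1}$ above are embeddings of $\mathfrak{osp}(1,2)[t]$-modules. *)

theory Defs
  imports
    "HOL-Analysis.Analysis"
    "HOL-Library.Poly_Mapping"
    "HOL-Computational_Algebra.Formal_Power_Series"
begin

section \<open>The Lie superalgebra osp(1,2) and its current algebra\<close>

datatype osp = E | H | F | Gp | Gm

instance osp :: finite
proof
  have "(UNIV :: osp set) = {E, H, F, Gp, Gm}"
    using osp.exhaust by auto
  then show "finite (UNIV :: osp set)"
    by (metis finite.simps)
qed

text \<open>Coordinates of the superbracket of two basis vectors. Besides the brackets listed in the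
  usual presentation, the table spells out their images under super-antisymmetry
  \<open>[a, b] = - (-1)^(|a||b|) [b, a]\<close>.\<close>

fun osp_bracket :: "osp \<Rightarrow> osp \<Rightarrow> osp \<Rightarrow> complex" where
  "osp_bracket E F = (\<lambda>_. 0)(H := 1)"
| "osp_bracket F E = (\<lambda>_. 0)(H := -1)"
| "osp_bracket H E = (\<lambda>_. 0)(E := 2)"
| "osp_bracket E H = (\<lambda>_. 0)(E := -2)"
| "osp_bracket H F = (\<lambda>_. 0)(F := -2)"
| "osp_bracket F H = (\<lambda>_. 0)(F := 2)"
| "osp_bracket H Gp = (\<lambda>_. 0)(Gp := 1)"
| "osp_bracket Gp H = (\<lambda>_. 0)(Gp := -1)"
| "osp_bracket H Gm = (\<lambda>_. 0)(Gm := -1)"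
| "osp_bracket Gm H = (\<lambda>_. 0)(Gm := 1)"
| "osp_bracket Gp Gm = (\<lambda>_. 0)(H := 1)"
| "osp_bracket Gm Gp = (\<lambda>_. 0)(H := 1)"
| "osp_bracket Gp Gp = (\<lambda>_. 0)(E := 2)"
| "osp_bracket Gm Gm = (\<lambda>_. 0)(F := -2)"
| "osp_bracket F Gp = (\<lambda>_. 0)(Gm := -1)"
| "osp_bracket Gp F = (\<lambda>_. 0)(Gm := 1)"
| "osp_bracket E Gm = (\<lambda>_. 0)(Gp := -1)"
| "osp_bracket Gm E = (\<lambda>_. 0)(Gp := 1)"
| "osp_bracket _ _ = (\<lambda>_. 0)"

definition osp_sign :: "osp \<Rightarrow> osp \<Rightarrow> complex" where
  "osp_sign a b = (if a \<in> {Gp, Gm} \<and> b \<in> {Gp, Gm} then -1 else 1)"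

text \<open>The pair \<open>(y, i)\<close> stands for the basis vector \<open>y\<^sub>i = y \<otimes> t^i\<close> of osp(1,2)[t]. A module is a
  complex vector space on which these basis vectors act linearly, compatibly with
  \<open>[y\<^sub>i, z\<^sub>j] = [y, z]\<^sub>i\<^sub>+\<^sub>j\<close>.\<close>

locale osp_current_module = vector_space scl
  for scl :: "complex \<Rightarrow> 'v::ab_group_add \<Rightarrow> 'v" +
  fixes act :: "osp \<times> nat \<Rightarrow> 'v \<Rightarrow> 'v"
  assumes act_linear: "Vector_Spaces.linear scl scl (act x)"
    and act_bracket:
      "act (y, i) (act (z, j) v) - scl (osp_sign y z) (act (z, j) (act (y, i) v))
        = (\<Sum>c\<in>UNIV. scl (osp_bracket y z c) (act (c, i + j) v))"

text \<open>The defining relations of the generator of the Weyl module \<open>W\<^sub>-\<^sub>n\<close>.\<close>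

definition weyl_relations ::
  "(complex \<Rightarrow> 'v::ab_group_add \<Rightarrow> 'v) \<Rightarrow> (osp \<times> nat \<Rightarrow> 'v \<Rightarrow> 'v) \<Rightarrow> nat \<Rightarrow> 'v \<Rightarrow> bool" where
  "weyl_relations scl act n w \<longleftrightarrow>
     (\<forall>y\<in>{F, Gm, H}. \<forall>i\<ge>1. act (y, i) w = 0) \<and>
     (\<forall>y\<in>{F, Gm}. act (y, 0) w = 0) \<and>
     act (H, 0) w = scl (- of_nat n) w \<and>
     (act (E, 0) ^^ (n + 1)) w = 0"


section \<open>The Weyl modules\<close>

text \<open>Since a type cannot depend on \<open>n\<close>, all Weyl modules are constructed inside one type
  \<open>weyl_sum\<close>, the module generated by vectors \<open>w\<^sub>-\<^sub>n\<close> for all natural \<open>n\<close>, where each \<open>w\<^sub>-\<^sub>n\<close> satisfies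
  the defining relations of \<open>W\<^sub>-\<^sub>n\<close>. No relation involves two different generators, so this is the
  direct sum of the \<open>W\<^sub>-\<^sub>n\<close>, and \<open>W\<^sub>-\<^sub>n\<close> is the submodule generated by \<open>w\<^sub>-\<^sub>n\<close>. It is the quotient of
  the space with basis the formal expressions \<open>y\<^sub>1 \<dots> y\<^sub>k w\<^sub>-\<^sub>n\<close>, written \<open>(n, [y\<^sub>1, \<dots>, y\<^sub>k])\<close>.
  That it has the required universal property is lemma \<open>weyl_universal\<close> below.\<close>

type_synonym weyl_word = "nat \<times> (osp \<times> nat) list"

definition word_scale :: "complex \<Rightarrow> (weyl_word \<Rightarrow>\<^sub>0 complex) \<Rightarrow> (weyl_word \<Rightarrow>\<^sub>0 complex)" where
  "word_scale c = Poly_Mapping.map ((*) c)"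

lemma lookup_word_scale [simp]:
  "Poly_Mapping.lookup (word_scale c p) k = c * Poly_Mapping.lookup p k"
  by (simp add: word_scale_def Poly_Mapping.map.rep_eq when_def)

interpretation word: vector_space word_scale
  by unfold_locales (auto intro!: poly_mapping_eqI simp: lookup_add algebra_simps)

inductive_set weyl_relators :: "(weyl_word \<Rightarrow>\<^sub>0 complex) set" where
  bracket:
    "Poly_Mapping.single (n, u @ [(y, i), (z, j)] @ v) 1
       - Poly_Mapping.single (n, u @ [(z, j), (y, i)] @ v) (osp_sign y z)
       - (\<Sum>c\<in>UNIV. Poly_Mapping.single (n, u @ [(c, i + j)] @ v) (osp_bracket y z c))
     \<in> weyl_relators"
| positive: "y \<in> {F, Gm, H} \<Longrightarrow> i \<ge> 1 \<Longrightarrow> Poly_Mapping.single (n, u @ [(y, i)]) 1 \<in> weyl_relators"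
| lowering: "y \<in> {F, Gm} \<Longrightarrow> Poly_Mapping.single (n, u @ [(y, 0)]) 1 \<in> weyl_relators"
| weight:
    "Poly_Mapping.single (n, u @ [(H, 0)]) 1 - Poly_Mapping.single (n, u) (- of_nat n)
     \<in> weyl_relators"
| integrable:
    "Poly_Mapping.single (n, u @ replicate (n + 1) (E, 0)) 1 \<in> weyl_relators"

definition weyl_eq :: "(weyl_word \<Rightarrow>\<^sub>0 complex) \<Rightarrow> (weyl_word \<Rightarrow>\<^sub>0 complex) \<Rightarrow> bool" where
  "weyl_eq p q \<longleftrightarrow> p - q \<in> word.span weyl_relators"

lemma weyl_eq_diff: "weyl_eq p q \<Longrightarrow> weyl_eq r s \<Longrightarrow> weyl_eq (p - r) (q - s)"
  unfolding weyl_eq_def using word.span_diff[of "p - q" weyl_relators "r - s"]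
  by (simp add: algebra_simps)

lemma weyl_eq_add: "weyl_eq p q \<Longrightarrow> weyl_eq r s \<Longrightarrow> weyl_eq (p + r) (q + s)"
  unfolding weyl_eq_def using word.span_add[of "p - q" weyl_relators "r - s"]
  by (simp add: algebra_simps)

lemma weyl_eq_scale: "weyl_eq p q \<Longrightarrow> weyl_eq (word_scale c p) (word_scale c q)"
  unfolding weyl_eq_def using word.span_scale[of "p - q" weyl_relators c]
  by (simp add: word.scale_right_diff_distrib)

lemma weyl_eq_refl: "weyl_eq p p"
  by (simp add: weyl_eq_def word.span_zero)

quotient_type weyl_sum = "weyl_word \<Rightarrow>\<^sub>0 complex" / weyl_eq
proof (rule equivpI)
  show "reflp weyl_eq" by (simp add: reflp_def weyl_eq_refl)
  show "symp weyl_eq"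
    using word.span_neg by (fastforce simp: symp_def weyl_eq_def)
  show "transp weyl_eq"
  proof (rule transpI)
    fix p q r assume "weyl_eq p q" "weyl_eq q r"
    then have "(p - q) + (q - r) \<in> word.span weyl_relators"
      unfolding weyl_eq_def by (rule word.span_add)
    then show "weyl_eq p r" by (simp add: weyl_eq_def)
  qed
qed

instantiation weyl_sum :: ab_group_add
begin
lift_definition zero_weyl_sum :: weyl_sum is 0 .
lift_definition plus_weyl_sum :: "weyl_sum \<Rightarrow> weyl_sum \<Rightarrow> weyl_sum" is "(+)"
  by (rule weyl_eq_add)
lift_definition minus_weyl_sum :: "weyl_sum \<Rightarrow> weyl_sum \<Rightarrow> weyl_sum" is "(-)"
  by (rule weyl_eq_diff)
lift_definition uminus_weyl_sum :: "weyl_sum \<Rightarrow> weyl_sum" is uminus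
  using weyl_eq_diff[OF weyl_eq_refl[of 0]] by simp
instance
  by standard (transfer; simp add: algebra_simps weyl_eq_refl)+
end

lift_definition weyl_scale :: "complex \<Rightarrow> weyl_sum \<Rightarrow> weyl_sum" is word_scale
  by (rule weyl_eq_scale)

lift_definition word_act ::
  "osp \<times> nat \<Rightarrow> (weyl_word \<Rightarrow>\<^sub>0 complex) \<Rightarrow> (weyl_word \<Rightarrow>\<^sub>0 complex)" is
  "\<lambda>x p k. case k of (n, []) \<Rightarrow> 0 | (n, y # u) \<Rightarrow> if y = x then p (n, u) else 0"
proof -
  fix x :: "osp \<times> nat" and p :: "weyl_word \<Rightarrow> complex"
  assume "finite {k. p k \<noteq> 0}"
  then have "finite ((\<lambda>k. (fst k, x # snd k)) ` {k. p k \<noteq> 0})" by simp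
  moreover have "{k. (case k of (n, []) \<Rightarrow> 0 | (n, y # u) \<Rightarrow> if y = x then p (n, u) else 0) \<noteq> 0}
      \<subseteq> (\<lambda>k. (fst k, x # snd k)) ` {k. p k \<noteq> 0}"
    by (auto split: list.splits if_splits simp: image_iff)
  ultimately show "finite {k. (case k of (n, []) \<Rightarrow> 0
      | (n, y # u) \<Rightarrow> if y = x then p (n, u) else 0) \<noteq> 0}"
    by (rule rev_finite_subset)
qed

lemma word_act_single:
  "word_act x (Poly_Mapping.single (n, u) c) = Poly_Mapping.single (n, x # u) c"
  by (rule poly_mapping_eqI)
     (auto simp: word_act.rep_eq lookup_single when_def split: list.splits prod.splits)

lemma word_act_linear: "Vector_Spaces.linear word_scale word_scale (word_act x)"
  by unfold_locales
     (auto intro!: poly_mapping_eqI simp: word_act.rep_eq lookup_add split: list.splits)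

lemma word_act_relators: "p \<in> weyl_relators \<Longrightarrow> word_act x p \<in> weyl_relators"
proof (induction rule: weyl_relators.induct)
  interpret l: Vector_Spaces.linear word_scale word_scale "word_act x" by (rule word_act_linear)
  case (bracket n u y i z j v)
  show ?case
    using weyl_relators.bracket[of n "x # u" y i z j v]
    by (simp add: l.diff l.sum word_act_single)
next
  interpret l: Vector_Spaces.linear word_scale word_scale "word_act x" by (rule word_act_linear)
  case (weight n u)
  show ?case
    using weyl_relators.weight[of n "x # u"] by (simp add: l.diff word_act_single)
qed (use weyl_relators.positive[of _ _ _ "x # _"] weyl_relators.lowering[of _ _ "x # _"]
      weyl_relators.integrable[of _ "x # _"] in \<open>simp_all add: word_act_single\<close>)

lift_definition weyl_act :: "osp \<times> nat \<Rightarrow> weyl_sum \<Rightarrow> weyl_sum" is word_act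
proof -
  fix x :: "osp \<times> nat" and p q
  interpret l: Vector_Spaces.linear word_scale word_scale "word_act x" by (rule word_act_linear)
  assume "weyl_eq p q"
  then have "word_act x (p - q) \<in> word_act x ` word.span weyl_relators"
    by (simp add: weyl_eq_def)
  also have "\<dots> = word.span (word_act x ` weyl_relators)"
    by (rule l.span_image[symmetric])
  also have "\<dots> \<subseteq> word.span weyl_relators"
    by (rule word.span_mono) (auto intro: word_act_relators)
  finally show "weyl_eq (word_act x p) (word_act x q)"
    by (simp add: weyl_eq_def l.diff)
qed

lift_definition weyl_gen :: "nat \<Rightarrow> weyl_sum" is "\<lambda>n. Poly_Mapping.single (n, []) 1" .

interpretation weyl: vector_space weyl_scale
  by unfold_locales
     (transfer, simp add: word.scale_right_distrib word.scale_left_distrib weyl_eq_refl)+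

lemma weyl_abs_linear: "Vector_Spaces.linear word_scale weyl_scale abs_weyl_sum"
  by unfold_locales (simp_all only: plus_weyl_sum.abs_eq weyl_scale.abs_eq)

lemma weyl_act_linear: "Vector_Spaces.linear weyl_scale weyl_scale (weyl_act x)"
proof -
  have add: "word_act x (p + q) = word_act x p + word_act x q"
    and scale: "word_act x (word_scale c p) = word_scale c (word_act x p)" for x p q c
  proof -
    interpret l: Vector_Spaces.linear word_scale word_scale "word_act x" by (rule word_act_linear)
    show "word_act x (p + q) = word_act x p + word_act x q"
      and "word_act x (word_scale c p) = word_scale c (word_act x p)"
      by (rule l.add, rule l.scale)
  qed
  show ?thesis
  proof unfold_locales
    show "weyl_act x (v + w) = weyl_act x v + weyl_act x w" for v w
      by transfer (simp only: add weyl_eq_refl)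
    show "weyl_act x (weyl_scale c v) = weyl_scale c (weyl_act x v)" for c v
      by transfer (simp only: scale weyl_eq_refl)
  qed
qed

lemma weyl_abs_single:
  "abs_weyl_sum (Poly_Mapping.single (n, u) c) = weyl_scale c (foldr weyl_act u (weyl_gen n))"
proof (induction u)
  case Nil
  have "word_scale c (Poly_Mapping.single (n, []) 1) = Poly_Mapping.single (n, []) c"
    by (rule poly_mapping_eqI) (simp add: lookup_single when_def)
  then show ?case
    by (simp only: weyl_gen.abs_eq weyl_scale.abs_eq foldr.simps id_apply)
next
  case (Cons x u)
  interpret l: Vector_Spaces.linear weyl_scale weyl_scale "weyl_act x" by (rule weyl_act_linear)
  have "abs_weyl_sum (Poly_Mapping.single (n, x # u) c)
      = weyl_act x (abs_weyl_sum (Poly_Mapping.single (n, u) c))"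
    by (simp only: weyl_act.abs_eq word_act_single)
  also have "\<dots> = weyl_scale c (foldr weyl_act (x # u) (weyl_gen n))"
    by (simp only: Cons.IH l.scale foldr.simps comp_apply)
  finally show ?case .
qed

lemma weyl_abs_relator: "p \<in> weyl_relators \<Longrightarrow> abs_weyl_sum p = 0"
  by (simp add: zero_weyl_sum.abs_eq weyl_sum.abs_eq_iff weyl_eq_def word.span_base)

lemma word_induct [case_names single add]:
  fixes P :: "(weyl_word \<Rightarrow>\<^sub>0 complex) \<Rightarrow> bool"
  assumes single: "\<And>n u c. P (Poly_Mapping.single (n, u) c)"
    and add: "\<And>p q. P p \<Longrightarrow> P q \<Longrightarrow> P (p + q)"
  shows "P p"
proof (induction p rule: update_induct)
  case const
  then show ?case using single[of 0 "[]" 0] by simp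
next
  case (update p k c)
  have "Poly_Mapping.update k c p = p + Poly_Mapping.single k c"
    using update by (auto intro!: poly_mapping_eqI
        simp: lookup_add lookup_single when_def lookup_update in_keys_iff)
  then show ?case using update add single by (metis prod.exhaust)
qed

lemma weyl_induct [case_names monomial add]:
  assumes "\<And>n u c. P (weyl_scale c (foldr weyl_act u (weyl_gen n)))"
    and "\<And>v w. P v \<Longrightarrow> P w \<Longrightarrow> P (v + w)"
  shows "P v"
proof -
  obtain p where p: "v = abs_weyl_sum p" by (metis Quotient3_abs_rep Quotient3_weyl_sum)
  show ?thesis unfolding p
    by (induction p rule: word_induct)
       (simp_all add: weyl_abs_single plus_weyl_sum.abs_eq[symmetric] assms)
qed

lemma weyl_sum_module: "osp_current_module weyl_scale weyl_act"
proof unfold_locales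
  fix y z :: osp and i j :: nat and v :: weyl_sum
  interpret l: Vector_Spaces.linear weyl_scale weyl_scale "weyl_act x" for x
    by (rule weyl_act_linear)
  interpret abs: Vector_Spaces.linear word_scale weyl_scale abs_weyl_sum
    by (rule weyl_abs_linear)
  show "weyl_act (y, i) (weyl_act (z, j) v)
        - weyl_scale (osp_sign y z) (weyl_act (z, j) (weyl_act (y, i) v))
      = (\<Sum>c\<in>UNIV. weyl_scale (osp_bracket y z c) (weyl_act (c, i + j) v))"
  proof (induction v rule: weyl_induct)
    case (monomial n u d)
    let ?m = "foldr weyl_act u (weyl_gen n)"
    have "weyl_act (y, i) (weyl_act (z, j) ?m)
        - weyl_scale (osp_sign y z) (weyl_act (z, j) (weyl_act (y, i) ?m))
      = (\<Sum>c\<in>UNIV. weyl_scale (osp_bracket y z c) (weyl_act (c, i + j) ?m))"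
      using weyl_abs_relator[OF weyl_relators.bracket[of n "[]" y i z j u]]
      by (simp add: abs.diff abs.sum weyl_abs_single)
    from arg_cong[OF this, of "weyl_scale d"] show ?case
      by (simp add: l.scale weyl.scale_right_diff_distrib weyl.scale_sum_right
          mult.commute[of d])
  next
    case (add v w)
    have "(weyl_act (y, i) (weyl_act (z, j) v)
        - weyl_scale (osp_sign y z) (weyl_act (z, j) (weyl_act (y, i) v)))
        + (weyl_act (y, i) (weyl_act (z, j) w)
        - weyl_scale (osp_sign y z) (weyl_act (z, j) (weyl_act (y, i) w)))
      = (\<Sum>c\<in>UNIV. weyl_scale (osp_bracket y z c) (weyl_act (c, i + j) v))
        + (\<Sum>c\<in>UNIV. weyl_scale (osp_bracket y z c) (weyl_act (c, i + j) w))"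
      by (simp only: add)
    then show ?case
      by (simp add: l.add weyl.scale_right_distrib sum.distrib algebra_simps)
  qed
next
  fix x :: "osp \<times> nat"
  interpret l: Vector_Spaces.linear weyl_scale weyl_scale "weyl_act x"
    by (rule weyl_act_linear)
  show "weyl_act x (v + w) = weyl_act x v + weyl_act x w"
    and "weyl_act x (weyl_scale c v) = weyl_scale c (weyl_act x v)" for v w c
    by (rule l.add, rule l.scale)
qed

lemma weyl_gen_relations: "weyl_relations weyl_scale weyl_act n (weyl_gen n)"
proof -
  interpret abs: Vector_Spaces.linear word_scale weyl_scale abs_weyl_sum
    by (rule weyl_abs_linear)
  have "foldr f (replicate k x) w = (f x ^^ k) w" for f :: "osp \<times> nat \<Rightarrow> weyl_sum \<Rightarrow> weyl_sum" and k x w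
    by (induction k) simp_all
  then show ?thesis
    using weyl_abs_relator[OF weyl_relators.positive[of _ _ n "[]"]]
      weyl_abs_relator[OF weyl_relators.lowering[of _ n "[]"]]
      weyl_abs_relator[OF weyl_relators.weight[of n "[]"]]
      weyl_abs_relator[OF weyl_relators.integrable[of n "[]"]]
    by (auto simp: weyl_relations_def abs.diff weyl_abs_single eq_neg_iff_add_eq_0)
qed

lemma weyl_universal:
  assumes "osp_current_module scl act" and rel: "\<And>n. weyl_relations scl act n (w n)"
  shows "\<exists>f. Vector_Spaces.linear weyl_scale scl f \<and>
    (\<forall>x v. f (weyl_act x v) = act x (f v)) \<and> (\<forall>n. f (weyl_gen n) = w n)"
proof -
  interpret M: osp_current_module scl act by fact
  interpret a: Vector_Spaces.linear scl scl "act x" for x by (rule M.act_linear)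
  define mono where "mono = (\<lambda>k. foldr act (snd k) (w (fst k)))"
  define ev where "ev = (\<lambda>p. \<Sum>k\<in>Poly_Mapping.keys p. scl (Poly_Mapping.lookup p k) (mono k))"
  have ev_sum: "ev p = (\<Sum>k\<in>K. scl (Poly_Mapping.lookup p k) (mono k))"
    if "finite K" "Poly_Mapping.keys p \<subseteq> K" for p K
    unfolding ev_def by (rule sum.mono_neutral_left) (use that in \<open>auto simp: in_keys_iff\<close>)
  have ev_add: "ev (p + q) = ev p + ev q" for p q
  proof -
    let ?K = "Poly_Mapping.keys p \<union> Poly_Mapping.keys q"
    have "ev (p + q) = (\<Sum>k\<in>?K. scl (Poly_Mapping.lookup (p + q) k) (mono k))"
      using keys_add[of p q] by (intro ev_sum) auto
    moreover have "ev p = (\<Sum>k\<in>?K. scl (Poly_Mapping.lookup p k) (mono k))"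
      "ev q = (\<Sum>k\<in>?K. scl (Poly_Mapping.lookup q k) (mono k))"
      by (auto intro: ev_sum)
    ultimately show ?thesis
      by (simp add: lookup_add M.scale_left_distrib sum.distrib)
  qed
  have ev_scale: "ev (word_scale c p) = scl c (ev p)" for c p
  proof -
    have "ev (word_scale c p)
        = (\<Sum>k\<in>Poly_Mapping.keys p. scl (Poly_Mapping.lookup (word_scale c p) k) (mono k))"
      by (rule ev_sum) (auto simp: in_keys_iff)
    then show ?thesis by (simp add: ev_def M.scale_sum_right)
  qed
  interpret ev: Vector_Spaces.linear word_scale scl ev
    by unfold_locales (simp_all add: ev_add ev_scale)
  have ev_single: "ev (Poly_Mapping.single k c) = scl c (mono k)" for k c
    by (simp add: ev_sum[of "{k}"])
  have foldr_0: "foldr act u 0 = 0" for u by (induction u) simp_all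
  have foldr_scl: "foldr act u (scl c v) = scl c (foldr act u v)" for u c v
    by (induction u) (simp_all add: a.scale)
  have foldr_diff: "foldr act u (v - v') = foldr act u v - foldr act u v'" for u v v'
    by (induction u) (simp_all add: a.diff)
  have foldr_neg: "foldr act u (- v) = - foldr act u v" for u v
    by (induction u) (simp_all add: a.neg)
  have foldr_sum: "foldr act u (\<Sum>c\<in>A. g c) = (\<Sum>c\<in>A. foldr act u (g c))"
    for u and g :: "osp \<Rightarrow> 'a" and A
    by (induction u) (simp_all add: a.sum)
  have foldr_replicate: "foldr act (replicate k x) v = (act x ^^ k) v" for k x v
    by (induction k) simp_all
  have relator: "ev p = 0" if "p \<in> weyl_relators" for p
    using that
  proof (induction rule: weyl_relators.induct)
    case (bracket n u y i z j v)
    let ?m = "foldr act v (w n)"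
    have "act (y, i) (act (z, j) ?m) - scl (osp_sign y z) (act (z, j) (act (y, i) ?m))
        - (\<Sum>c\<in>UNIV. scl (osp_bracket y z c) (act (c, i + j) ?m)) = 0"
      by (simp add: M.act_bracket)
    from arg_cong[OF this, of "foldr act u"] show ?case
      by (simp add: ev.diff ev.sum ev_single mono_def foldr_0 foldr_diff foldr_sum foldr_scl)
  next
    case (integrable n u)
    then show ?case
      using rel[of n] unfolding weyl_relations_def
      by (simp del: replicate_Suc funpow.simps add: ev_single mono_def foldr_replicate foldr_0)
  qed (use rel in \<open>auto simp: ev.diff ev_single mono_def weyl_relations_def foldr_0 foldr_scl foldr_neg\<close>)
  have ev_cong: "ev p = ev q" if "weyl_eq p q" for p q
    using ev.eq_0_on_span[of weyl_relators "p - q"] that relator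
    by (simp add: weyl_eq_def ev.diff)
  have ev_act: "ev (word_act x p) = act x (ev p)" for x p
  proof (induction p rule: word_induct)
    case (single n u c)
    then show ?case by (simp add: word_act_single ev_single mono_def a.scale)
  next
    interpret l: Vector_Spaces.linear word_scale word_scale "word_act x" by (rule word_act_linear)
    case (add p q)
    then show ?case by (simp add: l.add ev_add a.add)
  qed
  define f where "f = (\<lambda>v. ev (rep_weyl_sum v))"
  have f_abs: "f (abs_weyl_sum p) = ev p" for p
    unfolding f_def by (rule ev_cong) (metis Quotient3_weyl_sum rep_abs_rsp_left weyl_eq_refl)
  have surj: "\<exists>p. v = abs_weyl_sum p" for v by (metis Quotient3_abs_rep Quotient3_weyl_sum)
  have "Vector_Spaces.linear weyl_scale scl f"
  proof unfold_locales
    fix v v' c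
    show "f (v + v') = f v + f v'" "f (weyl_scale c v) = scl c (f v)"
      using surj[of v] surj[of v']
      by (auto simp: f_abs ev_add ev_scale plus_weyl_sum.abs_eq weyl_scale.abs_eq)
  qed
  moreover have "f (weyl_act x v) = act x (f v)" for x v
    using surj[of v] by (auto simp: f_abs ev_act weyl_act.abs_eq)
  moreover have "f (weyl_gen n) = w n" for n
    by (simp add: weyl_gen.abs_eq f_abs ev_single mono_def)
  ultimately show ?thesis by blast
qed


definition weyl_module :: "nat \<Rightarrow> weyl_sum set" where
  "weyl_module n = weyl.span {foldr weyl_act u (weyl_gen n) | u. True}"


section \<open>Characters\<close>

text \<open>The component of t-degree \<open>s\<close> of \<open>W\<^sub>-\<^sub>n\<close>: a word \<open>y\<^sub>1 \<dots> y\<^sub>k\<close> with \<open>y\<^sub>j\<close> of t-degree \<open>i\<^sub>j\<close> raises the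
  degree by \<open>i\<^sub>1 + \<dots> + i\<^sub>k\<close>.\<close>

definition weyl_degree :: "nat \<Rightarrow> nat \<Rightarrow> weyl_sum set" where
  "weyl_degree n s =
     weyl.span {foldr weyl_act u (weyl_gen n) | u. sum_list (map snd u) = s}"

text \<open>The coefficient of \<open>x^a q^s\<close> in \<open>ch W\<^sub>-\<^sub>n(x, q)\<close>. On the degree \<open>s\<close> component \<open>h\<^sub>0\<close> acts
  diagonalizably with integer eigenvalues, so the coefficient of \<open>x^a\<close> in the trace of \<open>x^h\<close> is
  the dimension of the \<open>a\<close>-eigenspace.\<close>

definition weyl_ch :: "nat \<Rightarrow> int \<Rightarrow> nat \<Rightarrow> int" where
  "weyl_ch n a s =
     int (weyl.dim {v \<in> weyl_degree n s. weyl_act (H, 0) v = weyl_scale (of_int a) v})"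

text \<open>The coefficient of \<open>x^a q^b\<close> in \<open>q^(n(n-1)/2) ch W\<^sub>-\<^sub>n(x, q^(-1))\<close>.\<close>

definition weyl_ch_normalized :: "nat \<Rightarrow> int \<Rightarrow> int \<Rightarrow> int" where
  "weyl_ch_normalized n a b =
     (let s = int (n * (n - 1) div 2) - b in if s < 0 then 0 else weyl_ch n a (nat s))"

text \<open>The coefficient of \<open>x^a q^b\<close> in \<open>ch L\<close>, which is by definition the coefficientwise limit of
  the normalized characters. As the integers are discrete, convergence means being eventually
  constant.\<close>

definition ch_L :: "int \<Rightarrow> int \<Rightarrow> int" where
  "ch_L a b = lim (\<lambda>n. weyl_ch_normalized n a b)"

text \<open>The product side lives in \<open>\<int>[x, x^(-1)][[q]]\<close>. Laurent polynomials in \<open>x\<close> are finitely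
  supported functions on the exponents, with the convolution product; infinite products are
  limits for the q-adic topology on \<open>fps\<close>.\<close>

type_synonym laurent_fps = "(int \<Rightarrow>\<^sub>0 int) fps"

definition x_pow :: "int \<Rightarrow> laurent_fps" where
  "x_pow k = fps_const (Poly_Mapping.single k 1)"

abbreviation q_var :: laurent_fps where
  "q_var \<equiv> fps_X"

definition coeff_xq :: "laurent_fps \<Rightarrow> int \<Rightarrow> int \<Rightarrow> int" where
  "coeff_xq P a b = (if b < 0 then 0 else Poly_Mapping.lookup (fps_nth P (nat b)) a)"


section \<open>The inductive limit\<close>

definition current_hom ::
  "(complex \<Rightarrow> 'v::ab_group_add \<Rightarrow> 'v) \<Rightarrow> (osp \<times> nat \<Rightarrow> 'v \<Rightarrow> 'v) \<Rightarrow> 'v set \<Rightarrow>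
   (complex \<Rightarrow> 'w::ab_group_add \<Rightarrow> 'w) \<Rightarrow> (osp \<times> nat \<Rightarrow> 'w \<Rightarrow> 'w) \<Rightarrow> 'w set \<Rightarrow>
   ('v \<Rightarrow> 'w) \<Rightarrow> bool" where
  "current_hom scl act V scl' act' W f \<longleftrightarrow>
     f ` V \<subseteq> W \<and>
     (\<forall>u\<in>V. \<forall>v\<in>V. f (u + v) = f u + f v) \<and>
     (\<forall>c. \<forall>v\<in>V. f (scl c v) = scl' c (f v)) \<and>
     (\<forall>x. \<forall>v\<in>V. f (act x v) = act' x (f v))"

text \<open>The embeddings \<open>W\<^sub>-\<^sub>n \<rightarrow> W\<^sub>-\<^sub>n\<^sub>-\<^sub>1\<close> with \<open>w\<^sub>-\<^sub>n \<mapsto> g\<^sup>+\<^sub>n w\<^sub>-\<^sub>n\<^sub>-\<^sub>1\<close>. The system starts at \<open>n = 1\<close>: for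
  \<open>n = 0\<close> there is no such homomorphism, since \<open>g\<^sup>-\<^sub>0\<close> kills \<open>w\<^sub>0\<close> but
  \<open>g\<^sup>-\<^sub>0 g\<^sup>+\<^sub>0 w\<^sub>-\<^sub>1 = - w\<^sub>-\<^sub>1\<close>. Initial terms do not affect the limit.\<close>

definition weyl_embeddings :: "(nat \<Rightarrow> weyl_sum \<Rightarrow> weyl_sum) \<Rightarrow> bool" where
  "weyl_embeddings \<phi> \<longleftrightarrow> (\<forall>n\<ge>1.
     current_hom weyl_scale weyl_act (weyl_module n)
       weyl_scale weyl_act (weyl_module (n + 1)) (\<phi> n) \<and>
     inj_on (\<phi> n) (weyl_module n) \<and>
     \<phi> n (weyl_gen n) = weyl_act (Gp, n) (weyl_gen (n + 1)))"

text \<open>\<open>transition \<phi> n d\<close> is the composite \<open>W\<^sub>-\<^sub>n \<rightarrow> W\<^sub>-\<^sub>n\<^sub>-\<^sub>d\<close>.\<close>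

fun transition :: "(nat \<Rightarrow> 'v \<Rightarrow> 'v) \<Rightarrow> nat \<Rightarrow> nat \<Rightarrow> 'v \<Rightarrow> 'v" where
  "transition \<phi> n 0 = id"
| "transition \<phi> n (Suc d) = \<phi> (n + d) \<circ> transition \<phi> n d"

text \<open>A module is the inductive limit of the \<open>W\<^sub>-\<^sub>n\<close> along \<open>\<phi>\<close>, with structure maps \<open>\<iota> n\<close>, if these
  are homomorphisms that identify it with the disjoint union of the \<open>W\<^sub>-\<^sub>n\<close> modulo becoming equal
  at a later stage.\<close>

definition weyl_inductive_limit ::
  "(nat \<Rightarrow> weyl_sum \<Rightarrow> weyl_sum) \<Rightarrow>
   (complex \<Rightarrow> 'l::ab_group_add \<Rightarrow> 'l) \<Rightarrow> (osp \<times> nat \<Rightarrow> 'l \<Rightarrow> 'l) \<Rightarrow>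
   (nat \<Rightarrow> weyl_sum \<Rightarrow> 'l) \<Rightarrow> bool" where
  "weyl_inductive_limit \<phi> scl act \<iota> \<longleftrightarrow>
     osp_current_module scl act \<and>
     (\<forall>n\<ge>1. current_hom weyl_scale weyl_act (weyl_module n) scl act UNIV (\<iota> n)) \<and>
     (\<forall>l. \<exists>n\<ge>1. l \<in> \<iota> n ` weyl_module n) \<and>
     (\<forall>n\<ge>1. \<forall>m\<ge>1. \<forall>u\<in>weyl_module n. \<forall>v\<in>weyl_module m.
        \<iota> n u = \<iota> m v \<longleftrightarrow>
        (\<exists>d e. n + d = m + e \<and> transition \<phi> n d u = transition \<phi> m e v))"

end

theory Submission
  imports Defs "HOL-Library.Function_Algebras"
begin

text \<open>The character of \<open>W\<^sub>-\<^sub>n\<close> is computed exactly, by matching an upper and a lower bound.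

  Upper bound. Filter \<open>W\<^sub>-\<^sub>n\<close> by the number of \<open>g\<^sup>+\<close>'s and then by their t-degree. In the quotients the
  vector \<open>g\<^sup>+\<^sub>S w\<close>, for a subset \<open>S\<close> of \<open>{0, \<dots>, n - 1}\<close> of size \<open>k\<close>, satisfies the relations of the Weyl
  module of \<open>sl\<^sub>2[t]\<close> of lowest weight \<open>- m\<close>, \<open>m = n - k\<close>. There the span of the words in \<open>r\<close> letters \<open>e\<^sub>i\<close>
  is a quotient of the ring of symmetric polynomials in \<open>r\<close> variables, on which \<open>h\<^sub>i / 2\<close> acts as
  multiplication by a power sum, and integrability kills the complete symmetric polynomials of degree
  larger than \<open>m - r\<close>. So it is spanned by products of complete symmetric polynomials indexed by
  partitions in an \<open>r \<times> (m - r)\<close> box. Altogether this leaves \<open>3^n\<close> vectors.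

  Lower bound. The tensor product of \<open>n\<close> copies of the 3-dimensional module of osp(1,2), evaluated at
  distinct points, is cyclic of dimension \<open>3^n\<close>, and its associated graded module for the filtration by
  t-degree is a quotient of \<open>W\<^sub>-\<^sub>n\<close>.

  Replacing \<open>S\<close> by its complement, the limit counts pairs of a finite set \<open>J\<close> of natural numbers and a
  partition in a box of semiperimeter \<open>|J|\<close>. By the \<open>q\<close>-Pascal recursion there are as many of them as
  pairs of finite sets of natural numbers, which are counted by the product.\<close>

section \<open>Symmetric functions of commuting operators\<close>

lemma (in vector_space) linear_on_span:
  assumes "Vector_Spaces.linear scale scale T" "subspace Y" "\<And>x. x \<in> X \<Longrightarrow> T x \<in> Y" "v \<in> span X"
  shows "T v \<in> Y"
proof -
  interpret T: Vector_Spaces.linear scale scale T by fact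
  have "subspace {v. T v \<in> Y}"
    using assms(2) by (auto simp: subspace_def T.add T.scale)
  then show ?thesis using span_induct[OF assms(4), of "\<lambda>v. T v \<in> Y"] assms(3) by auto
qed

lemma (in vector_space) subspace_scale_cancel:
  assumes "subspace N" "c \<noteq> 0" "scale c x \<in> N"
  shows "x \<in> N"
  using subspace_scale[OF assms(1,3), of "inverse c"] assms(2) by simp

text \<open>Partitions in an \<open>r\<close> by \<open>c\<close> box, as weakly decreasing lists of
  positive parts. The recursion asks whether the largest part is \<open>Suc c\<close>; the reduction
  of symmetric polynomials and the q-Pascal rule split in the same way.\<close>

fun box_partitions :: "nat \<Rightarrow> nat \<Rightarrow> nat list set" where
  "box_partitions 0 c = {[]}"
| "box_partitions (Suc r) 0 = {[]}"
| "box_partitions (Suc r) (Suc c) = box_partitions (Suc r) c \<union> (#) (Suc c) ` box_partitions r (Suc c)"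

locale commuting_operators = vector_space scl
  for scl :: "complex \<Rightarrow> 'v::ab_group_add \<Rightarrow> 'v" +
  fixes p :: "nat \<Rightarrow> 'v \<Rightarrow> 'v"
  assumes p_linear: "Vector_Spaces.linear scl scl (p i)"
    and p_commute: "p i (p j x) = p j (p i x)"
begin

sublocale p: Vector_Spaces.linear scl scl "p i" for i by (rule p_linear)

text \<open>Newton's identities: \<open>newton c k\<close> is the coefficient of z^k in exp(c (p_1 z
  + p_2 z^2 / 2 + ...)). For \<open>c = 1\<close> it is the complete symmetric polynomial h_k in
  terms of power sums, for \<open>c = -1\<close> it is (-1)^k e_k. The operator \<open>p 0\<close>
  never enters.\<close>

fun newton :: "complex \<Rightarrow> nat \<Rightarrow> 'v \<Rightarrow> 'v" where
  "newton c 0 x = x"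
| "newton c (Suc k) x = scl (c / of_nat (Suc k)) (\<Sum>i\<le>k. p (Suc i) (newton c (k - i) x))"

declare newton.simps(2) [simp del]

lemma newton_rec: "scl (of_nat k) (newton c k x) = scl c (\<Sum>i<k. p (Suc i) (newton c (k - Suc i) x))"
  by (cases k) (simp_all add: newton.simps(2) lessThan_Suc_atMost del: of_nat_Suc)

lemma newton_linear: "Vector_Spaces.linear scl scl (newton c k)"
proof -
  have "newton c k (x + y) = newton c k x + newton c k y \<and> newton c k (scl a x) = scl a (newton c k x)" for x y a
  proof (induction k rule: less_induct)
    case (less k)
    show ?case
    proof (cases k)
      case (Suc l)
      have "newton c (l - i) (x + y) = newton c (l - i) x + newton c (l - i) y"
        "newton c (l - i) (scl a x) = scl a (newton c (l - i) x)" for i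
        using less[of "l - i"] Suc by auto
      then show ?thesis unfolding Suc
        by (simp only: newton.simps p.add p.scale sum.distrib scale_right_distrib scale_sum_right[symmetric])
          (simp add: mult.commute del: of_nat_Suc)
    qed simp
  qed
  then show ?thesis by unfold_locales auto
qed

sublocale newton: Vector_Spaces.linear scl scl "newton c k" for c k by (rule newton_linear)

lemma newton_commute_intertwine:
  assumes T: "Vector_Spaces.linear scl scl T" and "\<And>i x. T (p i x) = p i (T x)"
  shows "T (newton c k x) = newton c k (T x)"
proof (induction k rule: less_induct)
  interpret T: Vector_Spaces.linear scl scl T by fact
  case (less k)
  show ?case
  proof (cases k)
    case (Suc l)
    have "T (newton c (l - i) x) = newton c (l - i) (T x)" for i
      using less[of "l - i"] Suc by auto
    then show ?thesis unfolding Suc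
      by (simp add: newton.simps(2) T.scale T.sum assms(2) del: of_nat_Suc)
  qed simp
qed

lemma p_newton: "p j (newton c k x) = newton c k (p j x)"
  by (rule newton_commute_intertwine) (auto simp: p_linear p_commute)

lemma newton_commute: "newton d j (newton c k x) = newton c k (newton d j x)"
  by (rule newton_commute_intertwine) (auto simp: newton_linear p_newton)

lemma newton_invariant:
  assumes "subspace N" "\<And>i x. x \<in> N \<Longrightarrow> p (Suc i) x \<in> N" "x \<in> N"
  shows "newton c k x \<in> N"
proof (induction k rule: less_induct)
  case (less k)
  show ?case
  proof (cases k)
    case (Suc l)
    have "(\<Sum>i\<le>l. p (Suc i) (newton c (l - i) x)) \<in> N"
      by (intro subspace_sum assms(1,2) less) (simp add: Suc)
    then show ?thesis unfolding Suc newton.simps(2) by (intro subspace_scale assms(1))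
  qed (simp add: assms)
qed

text \<open>The exponential series for \<open>c = 1\<close> and \<open>c = -1\<close> are inverse to
  each other. The Euler operator z d/dz is applied to their product: writing \<open>n\<close> as
  \<open>k + (n - k)\<close>, Newton's identity turns the two halves into opposite sums.\<close>

lemma newton_inverse:
  assumes "n > 0"
  shows "(\<Sum>k\<le>n. newton (-1) k (newton 1 (n - k) x)) = 0"
proof -
  define T where "T = (\<lambda>n. \<Sum>k\<le>n. newton (-1) k (newton 1 (n - k) x))"
  let ?R = "\<Sum>i<n. p (Suc i) (T (n - Suc i))"
  have A: "(\<Sum>k\<le>n. scl (of_nat k) (newton (-1) k (newton 1 (n - k) x))) = - ?R"
  proof -
    have "(\<Sum>k\<le>n. scl (of_nat k) (newton (-1) k (newton 1 (n - k) x)))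
      = - (\<Sum>k\<le>n. \<Sum>i<k. p (Suc i) (newton (-1) (k - Suc i) (newton 1 (n - k) x)))"
      by (simp add: newton_rec sum_negf)
    also have "(\<Sum>k\<le>n. \<Sum>i<k. p (Suc i) (newton (-1) (k - Suc i) (newton 1 (n - k) x)))
      = (\<Sum>i<n. \<Sum>k\<le>n - Suc i. p (Suc i) (newton (-1) k (newton 1 (n - Suc i - k) x)))"
      unfolding sum.Sigma[OF finite_atMost ballI[OF finite_lessThan]]
        sum.Sigma[OF finite_lessThan ballI[OF finite_atMost]]
      by (rule sum.reindex_bij_witness[where i="\<lambda>(i, k). (k + Suc i, i)" and j="\<lambda>(k, i). (i, k - Suc i)"])
        auto
    finally show ?thesis by (simp add: T_def p.sum)
  qed
  have B: "(\<Sum>k\<le>n. scl (of_nat (n - k)) (newton (-1) k (newton 1 (n - k) x))) = ?R"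
  proof -
    have "scl (of_nat (n - k)) (newton (-1) k (newton 1 (n - k) x)) =
      (\<Sum>i<n - k. p (Suc i) (newton (-1) k (newton 1 (n - k - Suc i) x)))" for k
      using newton_rec[of "n - k" 1 x]
      by (metis (no_types, lifting) newton.scale newton.sum p_newton scale_one sum.cong)
    then have "(\<Sum>k\<le>n. scl (of_nat (n - k)) (newton (-1) k (newton 1 (n - k) x))) =
      (\<Sum>k\<le>n. \<Sum>i<n - k. p (Suc i) (newton (-1) k (newton 1 (n - k - Suc i) x)))"
      by (rule sum.cong[OF refl])
    also have "\<dots> = (\<Sum>i<n. \<Sum>k\<le>n - Suc i. p (Suc i) (newton (-1) k (newton 1 (n - Suc i - k) x)))"
      unfolding sum.Sigma[OF finite_atMost ballI[OF finite_lessThan]]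
        sum.Sigma[OF finite_lessThan ballI[OF finite_atMost]]
      by (rule sum.reindex_bij_witness[where i="\<lambda>(i, k). (k, i)" and j="\<lambda>(k, i). (i, k)"])
        (auto simp: add.commute)
    finally show ?thesis by (simp add: T_def p.sum)
  qed
  have "scl (of_nat n) (T n) = (\<Sum>k\<le>n. scl (of_nat k) (newton (-1) k (newton 1 (n - k) x)))
     + (\<Sum>k\<le>n. scl (of_nat (n - k)) (newton (-1) k (newton 1 (n - k) x)))"
    unfolding T_def scale_sum_right sum.distrib[symmetric]
    by (rule sum.cong) (auto simp: scale_left_distrib[symmetric] of_nat_diff)
  then show ?thesis using A B assms by (simp add: T_def)
qed

text \<open>The complete symmetric polynomials generate all others: here
  \<open>newton_inverse\<close> is solved for its top term, in the next lemma Newton's identity is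
  solved for the power sum.\<close>

lemma complete_invariant_imp_elementary_invariant:
  assumes "subspace N" "\<And>k x. x \<in> N \<Longrightarrow> newton 1 k x \<in> N" "x \<in> N"
  shows "newton (-1) n x \<in> N"
  using assms(3)
proof (induction n arbitrary: x rule: less_induct)
  case (less n)
  show ?case
  proof (cases "n = 0")
    case False
    have "(\<Sum>k<n. newton (-1) k (newton 1 (n - k) x)) + newton (-1) n x = 0"
      using newton_inverse[of n x] False by (simp add: lessThan_Suc_atMost[symmetric])
    then have "newton (-1) n x = - (\<Sum>k<n. newton (-1) k (newton 1 (n - k) x))"
      by (simp add: eq_neg_iff_add_eq_0 add.commute)
    moreover have "(\<Sum>k<n. newton (-1) k (newton 1 (n - k) x)) \<in> N"
      by (intro subspace_sum assms(1)) (use less assms(2) in auto)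
    ultimately show ?thesis using assms(1) subspace_neg by auto
  qed (use less in simp)
qed

lemma complete_invariant_imp_power_sum_invariant:
  assumes "subspace N" "\<And>k x. x \<in> N \<Longrightarrow> newton 1 k x \<in> N" "x \<in> N"
  shows "p (Suc n) x \<in> N"
  using assms(3)
proof (induction n arbitrary: x rule: less_induct)
  case (less n)
  have "scl (of_nat (Suc n)) (newton 1 (Suc n) x) = (\<Sum>i<n. p (Suc i) (newton 1 (n - i) x)) + p (Suc n) x"
    using newton_rec[of "Suc n" 1 x] by (simp del: of_nat_Suc)
  then have "p (Suc n) x = scl (of_nat (Suc n)) (newton 1 (Suc n) x) - (\<Sum>i<n. p (Suc i) (newton 1 (n - i) x))"
    by simp
  moreover have "(\<Sum>i<n. p (Suc i) (newton 1 (n - i) x)) \<in> N"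
    by (intro subspace_sum assms(1)) (use less assms(2) in auto)
  ultimately show ?case
    by (simp add: subspace_diff[OF assms(1)] subspace_scale[OF assms(1)] assms(2) less.prems del: of_nat_Suc)
qed

lemma foldr_newton_commute: "newton d j (foldr (newton c) \<kappa> x) = foldr (newton c) \<kappa> (newton d j x)"
  by (induction \<kappa>) (simp_all add: newton_commute[of d j c])

text \<open>If the complete symmetric polynomials of degree larger than \<open>c\<close> and the elementary ones of degree
  larger than \<open>r\<close> kill \<open>u\<close>, then \<open>e\<^sub>r h\<^sub>c u = 0\<close>: so \<open>(r, c)\<close> becomes \<open>(r - 1, c)\<close> for \<open>h\<^sub>c u\<close>, and
  \<open>(r, c - 1)\<close> for \<open>u\<close> modulo the submodule generated by \<open>h\<^sub>c u\<close>.\<close>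

lemma foldr_newton_in_span_box_partitions:
  assumes "subspace N" "\<And>k x. x \<in> N \<Longrightarrow> newton 1 k x \<in> N"
    and "\<And>k. k > r \<Longrightarrow> newton (-1) k u \<in> N" "\<And>k. k > c \<Longrightarrow> newton 1 k u \<in> N"
  shows "foldr (newton 1) \<kappa> u \<in> span (N \<union> (\<lambda>\<mu>. foldr (newton 1) \<mu> u) ` box_partitions r c)"
  using assms
proof (induction r c arbitrary: N u \<kappa> rule: box_partitions.induct)
  \<comment> \<open>The case of an empty box: operators of positive degree send \<open>u\<close>
    into \<open>N\<close>, so modulo \<open>N\<close> only multiples of \<open>u\<close>
    survive.\<close>
  have triv: "foldr (newton 1) \<kappa> u \<in> span (N \<union> {u})"
    if "subspace N" "\<And>k x. x \<in> N \<Longrightarrow> newton 1 k x \<in> N" "\<And>k. k > 0 \<Longrightarrow> newton 1 k u \<in> N" for N u \<kappa>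
  proof (induction \<kappa>)
    case (Cons k \<kappa>)
    have "newton 1 k (foldr (newton 1) \<kappa> u) \<in> span (N \<union> {u})"
    proof (rule linear_on_span[OF newton_linear subspace_span _ Cons.IH])
      fix x assume "x \<in> N \<union> {u}"
      then show "newton 1 k x \<in> span (N \<union> {u})"
        using that by (cases "k = 0") (auto intro: span_base)
    qed
    then show ?case by simp
  qed (auto intro: span_base)
  {
    case (1 c)
    \<comment> \<open>With no rows, all elementary polynomials of positive degree kill
      \<open>u\<close> modulo \<open>N\<close>, and by inversion so do the complete ones.\<close>
    have "newton 1 k u \<in> N" if "k > 0" for k
    proof -
      have "{..k} = insert 0 {1..k}" using that by auto
      then have "newton 1 k u + (\<Sum>i=1..k. newton (-1) i (newton 1 (k - i) u)) = 0"
        using newton_inverse[OF that, of u] by simp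
      moreover have "(\<Sum>i=1..k. newton (-1) i (newton 1 (k - i) u)) \<in> N"
        by (intro subspace_sum 1) (auto simp: newton_commute[of "-1"] intro!: 1)
      ultimately show ?thesis using 1(1) by (metis add_eq_0_iff2 subspace_neg)
    qed
    then show ?case using triv[of N u] 1 by simp
  next
    case (2 r)
    then show ?case using triv[of N u] by simp
  next
    case (3 r c)
    note sub = 3(3) and H = 3(4) and G0 = 3(5) and H0 = 3(6)
    let ?h = "foldr (newton 1)"
    let ?u = "newton 1 (Suc c) u"
    let ?C = "{?h \<kappa> ?u | \<kappa>. True}"
    let ?N = "span (N \<union> ?C)"
    let ?X = "span (N \<union> (\<lambda>\<mu>. ?h \<mu> u) ` box_partitions (Suc r) (Suc c))"
    have inv: "newton 1 k x \<in> ?N" if "x \<in> ?N" for k x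
    proof (rule linear_on_span[OF newton_linear subspace_span _ that])
      fix x assume "x \<in> N \<union> ?C"
      then show "newton 1 k x \<in> ?N"
      proof
        assume "x \<in> ?C"
        then obtain \<kappa> where "x = ?h \<kappa> ?u" by blast
        then have "newton 1 k x = ?h (k # \<kappa>) ?u" by simp
        then show ?thesis by (intro span_base) blast
      qed (auto intro: span_base H)
    qed
    have "?h \<kappa> u \<in> span (?N \<union> (\<lambda>\<mu>. ?h \<mu> u) ` box_partitions (Suc r) c)"
    proof (rule 3(1))
      fix k assume "c < k"
      then show "newton 1 k u \<in> ?N"
      proof (cases "k = Suc c")
        case True
        have "?h [] ?u \<in> ?C" by blast
        then show ?thesis using True by (auto intro: span_base)
      next
        case False
        then show ?thesis using \<open>c < k\<close> H0[of k] by (auto intro: span_base)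
      qed
    qed (use inv G0 in \<open>auto intro: span_base\<close>)
    also have "\<dots> \<subseteq> ?X"
    proof (rule span_minimal[OF _ subspace_span])
      \<comment> \<open>In \<open>newton_inverse\<close> of degree \<open>Suc c + Suc r\<close>
        every other summand has an elementary index above \<open>Suc r\<close> or a complete index
        above \<open>Suc c\<close>, hence lies in \<open>N\<close>.\<close>
      have top: "newton (-1) (Suc r) ?u \<in> N"
      proof -
        let ?s = "\<lambda>k. newton (-1) k (newton 1 (Suc c + Suc r - k) u)"
        have "(\<Sum>k\<in>{..Suc c + Suc r} - {Suc r}. ?s k) + ?s (Suc r) = 0"
          using newton_inverse[of "Suc c + Suc r" u] sum.remove[of "{..Suc c + Suc r}" "Suc r" ?s]
          by (simp add: add.commute)
        moreover have "(\<Sum>k\<in>{..Suc c + Suc r} - {Suc r}. ?s k) \<in> N"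
        proof (intro subspace_sum sub)
          fix k assume k: "k \<in> {..Suc c + Suc r} - {Suc r}"
          show "?s k \<in> N"
          proof (cases "k < Suc r")
            case True
            then show ?thesis
              by (intro complete_invariant_imp_elementary_invariant sub H H0) auto
          next
            case False
            then show ?thesis using k unfolding newton_commute[of "-1"]
              by (intro H G0) auto
          qed
        qed
        moreover have "Suc c + Suc r - Suc r = Suc c" by simp
        ultimately show ?thesis using sub by (metis add_eq_0_iff subspace_neg)
      qed
      have "?h \<kappa> ?u \<in> ?X" for \<kappa>
      proof -
        have "?h \<kappa> ?u \<in> span (N \<union> (\<lambda>\<mu>. ?h \<mu> ?u) ` box_partitions r (Suc c))"
        proof (rule 3(2))
          fix k assume "r < k"
          then consider "k = Suc r" | "k > Suc r" by linarith
          then show "newton (-1) k ?u \<in> N"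
          proof cases
            case 2
            then show ?thesis unfolding newton_commute[of "-1" k 1] by (intro H G0)
          qed (simp add: top)
        next
          fix k assume "k > Suc c" then show "newton 1 k ?u \<in> N"
            unfolding newton_commute[of 1 k] by (intro H H0)
        qed (use sub H in auto)
        also have "\<dots> \<subseteq> ?X"
        proof (rule span_mono)
          have "?h \<mu> ?u = ?h (Suc c # \<mu>) u" for \<mu> by (simp add: foldr_newton_commute)
          then show "N \<union> (\<lambda>\<mu>. ?h \<mu> ?u) ` box_partitions r (Suc c)
              \<subseteq> N \<union> (\<lambda>\<mu>. ?h \<mu> u) ` box_partitions (Suc r) (Suc c)"
            unfolding box_partitions.simps by blast
        qed
        finally show ?thesis .
      qed
      then have "N \<union> ?C \<subseteq> ?X" by (auto intro: span_base)
      then have "?N \<subseteq> ?X" by (rule span_minimal[OF _ subspace_span])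
      moreover have "(\<lambda>\<mu>. ?h \<mu> u) ` box_partitions (Suc r) c \<subseteq> ?X" by (auto intro: span_base)
      ultimately show "?N \<union> (\<lambda>\<mu>. ?h \<mu> u) ` box_partitions (Suc r) c \<subseteq> ?X" by blast
    qed
    finally show ?case .
  }
qed

end


section \<open>Lowest weight vectors for the even part\<close>

lemma UNIV_osp: "(UNIV :: osp set) = {E, H, F, Gp, Gm}"
  using osp.exhaust by auto

context osp_current_module
begin

sublocale act: Vector_Spaces.linear scl scl "act x" for x by (rule act_linear)

lemma act_commutations:
  "act (E, i) (act (E, j) v) = act (E, j) (act (E, i) v)"
  "act (H, i) (act (H, j) v) = act (H, j) (act (H, i) v)"
  "act (H, i) (act (E, j) v) = act (E, j) (act (H, i) v) + scl 2 (act (E, i + j) v)"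
  "act (F, i) (act (E, j) v) = act (E, j) (act (F, i) v) - act (H, i + j) v"
  "act (F, i) (act (H, j) v) = act (H, j) (act (F, i) v) + scl 2 (act (F, i + j) v)"
  "act (Gp, i) (act (Gp, j) v) = scl 2 (act (E, i + j) v) - act (Gp, j) (act (Gp, i) v)"
  "act (Gp, i) (act (E, j) v) = act (E, j) (act (Gp, i) v)"
  "act (H, i) (act (Gp, j) v) = act (Gp, j) (act (H, i) v) + act (Gp, i + j) v"
  "act (Gm, i) (act (Gp, j) v) = act (H, i + j) v - act (Gp, j) (act (Gm, i) v)"
  "act (F, i) (act (Gp, j) v) = act (Gp, j) (act (F, i) v) - act (Gm, i + j) v"
  "act (Gm, i) (act (E, j) v) = act (E, j) (act (Gm, i) v) + act (Gp, i + j) v"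
  using act_bracket[of E i E j v] act_bracket[of H i H j v] act_bracket[of H i E j v]
    act_bracket[of F i E j v] act_bracket[of F i H j v] act_bracket[of Gp i Gp j v]
    act_bracket[of Gp i E j v] act_bracket[of H i Gp j v] act_bracket[of Gm i Gp j v]
    act_bracket[of F i Gp j v] act_bracket[of Gm i E j v]
  by (simp_all add: UNIV_osp osp_sign_def algebra_simps)

lemmas act_E_E = act_commutations(1)
  and act_H_H = act_commutations(2)
  and act_H_E = act_commutations(3)
  and act_F_E = act_commutations(4)
  and act_F_H = act_commutations(5)
  and act_Gp_Gp = act_commutations(6)
  and act_Gp_E = act_commutations(7)
  and act_H_Gp = act_commutations(8)
  and act_Gm_Gp = act_commutations(9)
  and act_F_Gp = act_commutations(10)
  and act_Gm_E = act_commutations(11)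

text \<open>Modulo lowering terms, \<open>h\<^sub>i / 2\<close> acts on \<open>e\<^sub>a \<dots> e\<^sub>b v\<close> as the power sum \<open>p\<^sub>i\<close> acts on
  symmetrized monomials; \<open>newton 1 k\<close> and \<open>newton (-1) k\<close> are then the complete and the signed
  elementary symmetric polynomials.\<close>

sublocale half_h: commuting_operators scl "\<lambda>i x. scl (1 / 2) (act (H, i) x)"
  by unfold_locales
    (simp_all add: act.add act.scale scale_right_distrib act_H_H mult.commute)

abbreviation complete_sym :: "nat \<Rightarrow> 'v \<Rightarrow> 'v" where "complete_sym \<equiv> half_h.newton 1"
abbreviation elementary_sym :: "nat \<Rightarrow> 'v \<Rightarrow> 'v" where "elementary_sym \<equiv> half_h.newton (-1)"

abbreviation es :: "nat list \<Rightarrow> 'v \<Rightarrow> 'v" where "es R \<equiv> foldr (\<lambda>i. act (E, i)) R"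
abbreviation gs :: "nat list \<Rightarrow> 'v \<Rightarrow> 'v" where "gs I \<equiv> foldr (\<lambda>i. act (Gp, i)) I"
abbreviation e0s :: "nat \<Rightarrow> 'v \<Rightarrow> 'v" where "e0s r \<equiv> act (E, 0) ^^ r"

text \<open>The commutator of f with h_i / 2 is f t^i, so moving f past the generating series of
  \<open>complete_sym\<close> multiplies it by exp(t z + (t z)^2 / 2 + ...) = 1 / (1 - t z). In the
  induction along Newton's identity, the terms without and with a commutator get weights that add up
  to \<open>s\<close>.\<close>

lemma act_F_complete: "act (F, j) (complete_sym s x) = (\<Sum>i\<le>s. complete_sym (s - i) (act (F, i + j) x))"
proof (induction s arbitrary: j rule: less_induct)
  case (less s)
  show ?case
  proof (cases "s = 0")
    case False
    let ?p = "\<lambda>i x. scl (1 / 2) (act (H, i) x)"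
    have fp: "act (F, j) (?p (Suc i) y) = ?p (Suc i) (act (F, j) y) + act (F, Suc i + j) y" for i y
      by (simp add: act.scale act_F_H scale_right_distrib add.commute)
    have A: "(\<Sum>i<s. ?p (Suc i) (act (F, j) (complete_sym (s - Suc i) x)))
      = (\<Sum>l\<le>s. scl (of_nat (s - l)) (complete_sym (s - l) (act (F, l + j) x)))"
    proof -
      have "(\<Sum>i<s. ?p (Suc i) (act (F, j) (complete_sym (s - Suc i) x)))
        = (\<Sum>i<s. \<Sum>l\<le>s - Suc i. ?p (Suc i) (complete_sym (s - Suc i - l) (act (F, l + j) x)))"
        by (rule sum.cong) (use less in \<open>auto simp: half_h.p.sum\<close>)
      also have "\<dots> = (\<Sum>l\<le>s. \<Sum>i<s - l. ?p (Suc i) (complete_sym (s - l - Suc i) (act (F, l + j) x)))"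
        unfolding sum.Sigma[OF finite_atMost ballI[OF finite_lessThan]]
          sum.Sigma[OF finite_lessThan ballI[OF finite_atMost]]
        by (rule sum.reindex_bij_witness[where i="\<lambda>(i, k). (k, i)" and j="\<lambda>(k, i). (i, k)"])
          (auto simp: add.commute)
      also have "\<dots> = (\<Sum>l\<le>s. scl (of_nat (s - l)) (complete_sym (s - l) (act (F, l + j) x)))"
        by (rule sum.cong[OF refl], subst half_h.newton_rec) simp
      finally show ?thesis .
    qed
    have B: "(\<Sum>i<s. act (F, Suc i + j) (complete_sym (s - Suc i) x))
      = (\<Sum>k\<le>s. scl (of_nat k) (complete_sym (s - k) (act (F, k + j) x)))"
    proof -
      have "(\<Sum>i<s. act (F, Suc i + j) (complete_sym (s - Suc i) x))
        = (\<Sum>i<s. \<Sum>l\<le>s - Suc i. complete_sym (s - Suc i - l) (act (F, l + (Suc i + j)) x))"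
        by (rule sum.cong) (use less in auto)
      also have "\<dots> = (\<Sum>k\<le>s. \<Sum>i<k. complete_sym (s - k) (act (F, k + j) x))"
        unfolding sum.Sigma[OF finite_atMost ballI[OF finite_lessThan]]
          sum.Sigma[OF finite_lessThan ballI[OF finite_atMost]]
        by (rule sum.reindex_bij_witness[where i="\<lambda>(k, i). (i, k - Suc i)" and j="\<lambda>(i, l). (l + Suc i, i)"])
          (auto simp: algebra_simps)
      finally show ?thesis by (simp only: sum_constant_scale card_lessThan)
    qed
    have "scl (of_nat s) (act (F, j) (complete_sym s x))
        = (\<Sum>i<s. act (F, j) (?p (Suc i) (complete_sym (s - Suc i) x)))"
      by (subst act.scale[symmetric], subst half_h.newton_rec) (simp only: scale_one act.sum)
    also have "\<dots> = (\<Sum>l\<le>s. scl (of_nat (s - l)) (complete_sym (s - l) (act (F, l + j) x)))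
      + (\<Sum>k\<le>s. scl (of_nat k) (complete_sym (s - k) (act (F, k + j) x)))"
      unfolding fp sum.distrib A B ..
    also have "\<dots> = (\<Sum>l\<le>s. scl (of_nat s) (complete_sym (s - l) (act (F, l + j) x)))"
      unfolding sum.distrib[symmetric]
      by (rule sum.cong) (auto simp: scale_left_distrib[symmetric] of_nat_diff)
    finally show ?thesis using False by (simp add: scale_sum_right[symmetric])
  qed simp
qed

text \<open>A further letter \<open>E\<close> is a further variable t, which multiplies the
  generating series of the signed elementary polynomials by 1 - t z.\<close>

lemma elementary_act_E:
  "elementary_sym k (act (E, j) x) = act (E, j) (elementary_sym k x)
    - (if k = 0 then 0 else act (E, Suc j) (elementary_sym (k - 1) x))"
proof (induction k rule: less_induct)
  case (less k)
  show ?case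
  proof (cases k)
    case (Suc l)
    let ?p = "\<lambda>i x. scl (1 / 2) (act (H, i) x)"
    have pe: "?p i (act (E, j) y) = act (E, j) (?p i y) + act (E, i + j) y" for i j y
      by (simp add: act.scale act_H_E scale_right_distrib)
    have rec: "scl (of_nat k) (elementary_sym k y) = - (\<Sum>i<k. ?p (Suc i) (elementary_sym (l - i) y))" for y
      unfolding half_h.newton_rec Suc by simp
    have "scl (of_nat k) (elementary_sym k (act (E, j) x))
      = - (\<Sum>i<k. ?p (Suc i) (elementary_sym (l - i) (act (E, j) x)))"
      by (rule rec)
    also have "(\<Sum>i<k. ?p (Suc i) (elementary_sym (l - i) (act (E, j) x)))
      = (\<Sum>i<k. ?p (Suc i) (act (E, j) (elementary_sym (l - i) x)))
        - (\<Sum>i<k. if l - i = 0 then 0 else ?p (Suc i) (act (E, Suc j) (elementary_sym (l - i - 1) x)))"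
      unfolding sum_subtractf[symmetric]
    proof (rule sum.cong[OF refl])
      fix i assume "i \<in> {..<k}"
      then show "?p (Suc i) (elementary_sym (l - i) (act (E, j) x)) = ?p (Suc i) (act (E, j) (elementary_sym (l - i) x))
        - (if l - i = 0 then 0 else ?p (Suc i) (act (E, Suc j) (elementary_sym (l - i - 1) x)))"
        using less[of "l - i"] Suc by (auto simp: half_h.p.diff act.diff scale_right_diff_distrib)
    qed
    also have "(\<Sum>i<k. if l - i = 0 then 0 else ?p (Suc i) (act (E, Suc j) (elementary_sym (l - i - 1) x)))
      = (\<Sum>i<l. ?p (Suc i) (act (E, Suc j) (elementary_sym (l - Suc i) x)))"
      unfolding Suc by (auto intro!: sum.cong simp: not_le)
    also have "\<dots> = act (E, Suc j) (\<Sum>i<l. ?p (Suc i) (elementary_sym (l - Suc i) x))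
        + (\<Sum>i<l. act (E, Suc i + Suc j) (elementary_sym (l - Suc i) x))"
      unfolding pe sum.distrib act.sum ..
    also have "(\<Sum>i<l. ?p (Suc i) (elementary_sym (l - Suc i) x)) = - scl (of_nat l) (elementary_sym l x)"
      unfolding half_h.newton_rec by simp
    also have "(\<Sum>i<k. ?p (Suc i) (act (E, j) (elementary_sym (l - i) x)))
      = act (E, j) (\<Sum>i<k. ?p (Suc i) (elementary_sym (l - i) x))
        + (\<Sum>i<k. act (E, Suc i + j) (elementary_sym (l - i) x))"
      unfolding pe sum.distrib act.sum ..
    also have "(\<Sum>i<k. ?p (Suc i) (elementary_sym (l - i) x)) = - scl (of_nat k) (elementary_sym k x)"
      unfolding rec by simp
    \<comment> \<open>After the term \<open>i = 0\<close> is split off, the rest cancels against the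
      commutator terms of the other sum.\<close>
    also have "(\<Sum>i<k. act (E, Suc i + j) (elementary_sym (l - i) x))
      = act (E, Suc j) (elementary_sym l x) + (\<Sum>i<l. act (E, Suc i + Suc j) (elementary_sym (l - Suc i) x))"
      unfolding Suc by (subst sum.lessThan_Suc_shift) simp
    finally have "scl (of_nat k) (elementary_sym k (act (E, j) x)) = scl (of_nat k) (act (E, j) (elementary_sym k x))
      - scl (of_nat k) (act (E, Suc j) (elementary_sym l x))"
      by (simp add: act.scale act.neg act.diff Suc scale_left_distrib)
    then have "scl (of_nat k) (elementary_sym k (act (E, j) x)) = scl (of_nat k) (act (E, j) (elementary_sym k x)
      - act (E, Suc j) (elementary_sym l x))"
      by (simp only: scale_right_diff_distrib)
    then show ?thesis using Suc by (simp del: of_nat_Suc)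
  qed simp
qed

lemma act_H0_e0s:
  assumes "act (H, 0) v = scl c v"
  shows "act (H, 0) (e0s r v) = scl (2 * of_nat r + c) (e0s r v)"
proof (induction r)
  case (Suc r)
  have "act (H, 0) (e0s (Suc r) v) = scl (2 * of_nat r + c) (e0s (Suc r) v) + scl 2 (e0s (Suc r) v)"
    by (simp add: act_H_E act.scale Suc)
  then show ?case by (simp only: scale_left_distrib[symmetric]) (simp add: algebra_simps)
qed (simp add: assms)

lemma es_commute_E: "es R (act (E, j) x) = act (E, j) (es R x)"
  by (induction R) (simp_all add: act_E_E[of _ j])

lemma es_add: "es R (x + y) = es R x + es R y"
  and es_scale: "es R (scl c x) = scl c (es R x)"
  and es_diff: "es R (x - y) = es R x - es R y"
  by (induction R) (simp_all add: act.add act.scale act.diff)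

lemma act_H_es:
  "act (H, i) (es R x) - es R (act (H, i) x) \<in> span {es R' x | R'. length R' = length R}"
proof (induction R)
  case (Cons j R)
  let ?S = "\<lambda>R. span {es R' x | R'. length R' = length R}"
  have eq: "act (H, i) (es (j # R) x) - es (j # R) (act (H, i) x)
    = act (E, j) (act (H, i) (es R x) - es R (act (H, i) x)) + scl 2 (es ((i + j) # R) x)"
    by (simp add: act_H_E act.diff)
  have "act (E, j) (act (H, i) (es R x) - es R (act (H, i) x)) \<in> ?S (j # R)"
  proof (rule linear_on_span[OF act_linear subspace_span _ Cons.IH])
    fix y assume "y \<in> {es R' x | R'. length R' = length R}"
    then obtain R' where "y = es R' x" "length R' = length R" by blast
    then have "act (E, j) y = es (j # R') x" "length (j # R') = length (j # R)" by auto
    then show "act (E, j) y \<in> ?S (j # R)" by (intro span_base) blast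
  qed
  moreover have "length ((i + j) # R) = length (j # R)" by simp
  then have "es ((i + j) # R) x \<in> ?S (j # R)"
    by (intro span_base) blast
  ultimately show ?case unfolding eq by (intro span_add span_scale)
qed (simp add: span_zero)

section \<open>Lowest weight vectors of sl2[t] modulo a submodule \<open>N\<close>\<close>

context
  fixes N :: "'v set" and v :: 'v and m :: nat
  assumes sub: "subspace N"
    and N_E: "\<And>i x. x \<in> N \<Longrightarrow> act (E, i) x \<in> N"
    and N_H: "\<And>i x. x \<in> N \<Longrightarrow> act (H, i) x \<in> N"
    and N_F: "\<And>i x. x \<in> N \<Longrightarrow> act (F, i) x \<in> N"
    and F_v: "\<And>i. act (F, i) v \<in> N"
    and H_v: "\<And>i. i \<ge> 1 \<Longrightarrow> act (H, i) v \<in> N"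
    and H0_v: "act (H, 0) v = scl (- of_nat m) v"
begin

lemma newton_N: "x \<in> N \<Longrightarrow> half_h.newton c k x \<in> N"
  by (rule half_h.newton_invariant[OF sub]) (auto intro: subspace_scale[OF sub] N_H)

lemma es_N: "x \<in> N \<Longrightarrow> es R x \<in> N"
  by (induction R) (auto intro: N_E)

text \<open>The factor \<open>of_nat r\<close> covers \<open>r = 0\<close>, where
  \<open>r - 1\<close> is truncated.\<close>

lemma E0_E_e0s:
  "scl (c * of_nat r) (act (E, 0) (act (E, i) (e0s (r - 1) v))) = scl (c * of_nat r) (act (E, i) (e0s r v))"
  by (cases r) (simp_all add: act_E_E[of i 0])

lemma H_e0s_cong:
  assumes "i \<ge> 1"
  shows "act (H, i) (e0s r v) - scl (2 * of_nat r) (act (E, i) (e0s (r - 1) v)) \<in> N"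
proof (induction r)
  case (Suc r)
  have "act (H, i) (e0s (Suc r) v) - scl (2 * of_nat (Suc r)) (act (E, i) (e0s r v))
    = act (E, 0) (act (H, i) (e0s r v) - scl (2 * of_nat r) (act (E, i) (e0s (r - 1) v)))"
    unfolding act.diff act.scale E0_E_e0s by (simp add: act_H_E scale_left_distrib distrib_left)
  then show ?case using N_E[OF Suc.IH] by simp
qed (use H_v assms in simp)

text \<open>Each e_0 that \<open>F\<close> passes leaves an \<open>H\<close> term, evaluated by the
  preceding congruence; the contributions 2 + 4 + ... + 2r add up to r (r + 1).\<close>

lemma F_e0s_cong:
  assumes "i \<ge> 1"
  shows "act (F, i) (e0s (Suc r) v) + scl (of_nat (Suc r) * of_nat r) (act (E, i) (e0s (r - 1) v)) \<in> N"
proof (induction r)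
  case 0
  then show ?case using N_E[OF F_v] H_v assms by (simp add: act_F_E subspace_diff[OF sub])
next
  case (Suc r)
  let ?Y = "act (E, i) (e0s r v)"
  have "of_nat (Suc (Suc r)) * of_nat (Suc r) = of_nat (Suc r) * of_nat r + (2 * of_nat (Suc r) :: complex)"
    by (simp add: algebra_simps)
  then have Y: "scl (of_nat (Suc (Suc r)) * of_nat (Suc r)) ?Y
    = scl (of_nat (Suc r) * of_nat r) ?Y + scl (2 * of_nat (Suc r)) ?Y"
    by (simp only: scale_left_distrib)
  have "act (F, i) (e0s (Suc (Suc r)) v) + scl (of_nat (Suc (Suc r)) * of_nat (Suc r)) (act (E, i) (e0s r v))
    = act (E, 0) (act (F, i) (e0s (Suc r) v) + scl (of_nat (Suc r) * of_nat r) (act (E, i) (e0s (r - 1) v)))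
     - (act (H, i) (e0s (Suc r) v) - scl (2 * of_nat (Suc r)) (act (E, i) (e0s (Suc r - 1) v)))"
    unfolding Y act.add act.scale E0_E_e0s by (simp add: act_F_E del: of_nat_Suc)
  then show ?case using N_E[OF Suc.IH] H_e0s_cong[OF assms, of "Suc r"] subspace_diff[OF sub]
    by (simp only: diff_Suc_1)
qed

lemma F0_e0s_cong:
  "act (F, 0) (e0s (Suc r) v) - scl (of_nat (Suc r) * (of_nat m - of_nat r)) (e0s r v) \<in> N"
proof (induction r)
  case 0
  then show ?case using N_E[OF F_v] by (simp add: act_F_E H0_v)
next
  case (Suc r)
  let ?e = "e0s (Suc r) v"
  let ?b = "of_nat (Suc r) * (of_nat m - of_nat r) :: complex"
    and ?a = "of_nat (Suc (Suc r)) * (of_nat m - of_nat (Suc r)) :: complex"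
  have "?b = ?a + (2 * of_nat (Suc r) + - of_nat m)" by (simp add: algebra_simps)
  then have "scl ?b ?e = scl ?a ?e + act (H, 0) ?e"
    unfolding act_H0_e0s[OF H0_v] by (simp only: scale_left_distrib)
  then have "act (F, 0) (e0s (Suc (Suc r)) v) - scl ?a ?e
    = act (E, 0) (act (F, 0) ?e - scl ?b (e0s r v))"
    by (simp add: act_F_E act.diff act.scale)
  then show ?case using N_E[OF Suc.IH] by simp
qed

text \<open>Downward induction from the power \<open>K\<close>: \<open>F0_e0s_cong\<close> recovers
  e_0^r v from e_0^(r+1) v up to the factor (r + 1)(m - r), which is nonzero for
  \<open>r > m\<close>.\<close>

lemma e0s_nilpotent:
  assumes "e0s K v \<in> N" "r > m"
  shows "e0s r v \<in> N"
  using assms(2)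
proof (induction r rule: measure_induct_rule[of "\<lambda>r. K - r"])
  case (less r)
  show ?case
  proof (cases "r \<ge> K")
    case True
    have "e0s j x \<in> N" if "x \<in> N" for j x
      using that by (induction j) (auto intro: N_E)
    from this[OF assms(1), of "r - K"] True show ?thesis
      by (simp add: funpow_add[symmetric, THEN fun_cong, unfolded comp_def])
  next
    case False
    then have "e0s (Suc r) v \<in> N" using less.IH[of "Suc r"] less.prems by (simp del: funpow.simps)
    from subspace_diff[OF sub N_F[OF this, of 0] F0_e0s_cong[of r]]
    have "scl (of_nat (Suc r) * (of_nat m - of_nat r)) (e0s r v) \<in> N"
      by (simp only: diff_diff_eq2 add_diff_cancel_left')
    moreover have "of_nat (Suc r) * (of_nat m - of_nat r) \<noteq> (0 :: complex)"
      using less.prems by (simp del: of_nat_Suc)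
    ultimately show ?thesis using subspace_scale_cancel[OF sub] by blast
  qed
qed

text \<open>By \<open>act_F_complete\<close> the first term is a sum of
  \<open>complete_sym (s - i)\<close> applied to f_(i+1) e_0^(r+1) v. Comparing
  \<open>F_e0s_cong\<close> with \<open>H_e0s_cong\<close>, this vector is -(r + 1) p_(i+1) e_0^r v
  modulo \<open>N\<close>, where p_i is h_i / 2; Newton's identity adds the terms up.\<close>

lemma complete_e0s_cong:
  "act (F, 1) (complete_sym s (e0s (Suc r) v)) + scl (of_nat (Suc r) * of_nat (Suc s)) (complete_sym (Suc s) (e0s r v)) \<in> N"
proof -
  have "act (F, Suc i) (e0s (Suc r) v) + scl (of_nat (Suc r)) (scl (1 / 2) (act (H, Suc i) (e0s r v))) \<in> N" for i
  proof -
    have "scl (of_nat (Suc r) / 2)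
      (act (H, Suc i) (e0s r v) - scl (2 * of_nat r) (act (E, Suc i) (e0s (r - 1) v))) \<in> N"
      by (intro subspace_scale[OF sub] H_e0s_cong) simp
    from subspace_add[OF sub F_e0s_cong[of "Suc i" r] this]
    show ?thesis by (simp add: scale_right_diff_distrib algebra_simps del: of_nat_Suc)
  qed
  then have "(\<Sum>i\<le>s. complete_sym (s - i) (act (F, Suc i) (e0s (Suc r) v)
    + scl (of_nat (Suc r)) (scl (1 / 2) (act (H, Suc i) (e0s r v))))) \<in> N"
    by (intro subspace_sum[OF sub] newton_N)
  also have "(\<Sum>i\<le>s. complete_sym (s - i) (act (F, Suc i) (e0s (Suc r) v)
    + scl (of_nat (Suc r)) (scl (1 / 2) (act (H, Suc i) (e0s r v)))))
    = act (F, 1) (complete_sym s (e0s (Suc r) v))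
     + scl (of_nat (Suc r)) (\<Sum>i\<le>s. complete_sym (s - i) (scl (1 / 2) (act (H, Suc i) (e0s r v))))"
    by (simp add: act_F_complete half_h.newton.add half_h.newton.scale sum.distrib scale_sum_right del: of_nat_Suc funpow.simps)
  also have "(\<Sum>i\<le>s. complete_sym (s - i) (scl (1 / 2) (act (H, Suc i) (e0s r v))))
    = scl (of_nat (Suc s)) (complete_sym (Suc s) (e0s r v))"
    by (simp add: half_h.newton_rec half_h.p_newton lessThan_Suc_atMost del: of_nat_Suc)
  finally show ?thesis by (simp del: of_nat_Suc funpow.simps)
qed

text \<open>Each application of f_1 trades one e_0 for one degree of the complete polynomial, so the
  claim goes back to e_0^(r+s) v, which lies in \<open>N\<close>.\<close>

lemma complete_e0s_N:
  assumes "e0s K v \<in> N" "r + s > m"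
  shows "complete_sym s (e0s r v) \<in> N"
  using assms(2)
proof (induction s arbitrary: r)
  case 0
  then show ?case using e0s_nilpotent[OF assms(1)] by simp
next
  case (Suc s)
  have "act (F, 1) (complete_sym s (e0s (Suc r) v)) \<in> N"
    by (intro N_F Suc.IH) (use Suc.prems in simp)
  from subspace_diff[OF sub complete_e0s_cong[of s r] this]
  have "scl (of_nat (Suc r) * of_nat (Suc s)) (complete_sym (Suc s) (e0s r v)) \<in> N"
    by simp
  then show ?case by (rule subspace_scale_cancel[OF sub, rotated]) (simp del: of_nat_Suc)
qed

text \<open>Elementary polynomials vanish above the number of variables: each e_0 contributes one
  variable, and \<open>v\<close> itself none.\<close>

lemma elementary_e0s_N: "k > r \<Longrightarrow> elementary_sym k (e0s r v) \<in> N"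
proof (induction r arbitrary: k)
  case 0
  then obtain l where l: "k = Suc l" by (cases k) auto
  have "(\<Sum>i\<le>l. elementary_sym (l - i) (scl (1 / 2) (act (H, Suc i) v))) \<in> N"
    by (intro subspace_sum[OF sub] newton_N subspace_scale[OF sub] H_v) simp
  then show ?case unfolding l half_h.newton.simps(2) half_h.p_newton
    by (simp only: funpow_0 subspace_scale[OF sub])
next
  case (Suc r)
  then show ?case
    by (simp add: elementary_act_E subspace_diff[OF sub] N_E)
qed

text \<open>Every word in \<open>r\<close> letters arises from e_0^r v by the operators h_i. Applied
  to a word with a spare e_0, h_i turns it into e_i; all other terms have one letter fewer outside
  the block of e_0, so induction on the number of these letters applies.\<close>

lemma es_in_invariant:
  assumes Z: "subspace Z" "N \<subseteq> Z" "\<And>i x. i \<ge> 1 \<Longrightarrow> x \<in> Z \<Longrightarrow> act (H, i) x \<in> Z"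
    and "e0s r v \<in> Z" "length R + k = r"
  shows "es R (e0s k v) \<in> Z"
  using assms(5)
proof (induction "length R" arbitrary: R k)
  case 0
  then show ?case using assms by simp
next
  case (Suc q)
  then obtain i R' where R: "R = i # R'" by (cases R) auto
  note IH = Suc.hyps(1)
  show ?case
  proof (cases "i = 0")
    case True
    then have "es R (e0s k v) = es R' (e0s (Suc k) v)" by (simp add: R es_commute_E)
    then show ?thesis using IH[of R' "Suc k"] Suc R by auto
  next
    case False
    let ?X = "e0s (Suc k) v"
    have "act (H, i) (es R' ?X) \<in> Z"
      using IH[of R' "Suc k"] Suc R False Z(3)[of i] by auto
    moreover have "act (H, i) (es R' ?X) - es R' (act (H, i) ?X) \<in> Z"
    proof -
      have "{es R'' ?X | R''. length R'' = length R'} \<subseteq> Z"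
        using IH[of _ "Suc k"] Suc R by auto
      then show ?thesis using act_H_es span_minimal[OF _ Z(1)] by blast
    qed
    ultimately have "es R' (act (H, i) ?X) \<in> Z"
      using subspace_diff[OF Z(1)] by fastforce
    moreover have "es R' (act (H, i) ?X - scl (2 * of_nat (Suc k)) (act (E, i) (e0s k v))) \<in> Z"
      using H_e0s_cong[of i "Suc k"] False Z(2) es_N by auto
    ultimately have "scl (2 * of_nat (Suc k)) (es R (e0s k v)) \<in> Z"
      unfolding es_diff es_scale es_commute_E R
      using subspace_diff[OF Z(1)] by fastforce
    then show ?thesis by (rule subspace_scale_cancel[OF Z(1), rotated]) (simp del: of_nat_Suc)
  qed
qed

lemma es_in_span_complete:
  assumes "e0s K v \<in> N"
  shows "es R v \<in> span (N \<union> {foldr complete_sym \<mu> (e0s r v) | r \<mu>.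
    r = length R \<and> r \<le> m \<and> \<mu> \<in> box_partitions r (m - r)})"
proof (cases "length R \<le> m")
  case True
  let ?r = "length R"
  let ?u = "e0s ?r v"
  \<comment> \<open>Modulo \<open>N\<close>, the module over the symmetric polynomials generated by
    e_0^r v. It is stable under h_i because power sums are polynomials in complete symmetric
    ones.\<close>
  define Z where "Z = span (N \<union> {foldr complete_sym \<kappa> ?u | \<kappa>. True})"
  have ZH: "complete_sym k x \<in> Z" if "x \<in> Z" for k x
    unfolding Z_def
  proof (rule linear_on_span[OF half_h.newton_linear subspace_span _ that[unfolded Z_def]])
    fix x assume "x \<in> N \<union> {foldr complete_sym \<kappa> ?u | \<kappa>. True}"
    then show "complete_sym k x \<in> span (N \<union> {foldr complete_sym \<kappa> ?u | \<kappa>. True})"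
    proof
      assume "x \<in> {foldr complete_sym \<kappa> ?u | \<kappa>. True}"
      then obtain \<kappa> where "complete_sym k x = foldr complete_sym (k # \<kappa>) ?u" by auto
      then show ?thesis by (intro span_base) blast
    qed (auto intro: span_base newton_N)
  qed
  have "act (H, i) x \<in> Z" if "i \<ge> 1" "x \<in> Z" for i x
  proof -
    have "scl (1 / 2) (act (H, Suc (i - 1)) x) \<in> Z"
      by (rule half_h.complete_invariant_imp_power_sum_invariant)
        (use ZH that in \<open>auto simp: Z_def\<close>)
    then show ?thesis
      using that subspace_scale_cancel[of Z "1 / 2" "act (H, i) x"] by (simp add: Z_def)
  qed
  moreover have "?u \<in> Z"
  proof -
    have "?u = foldr complete_sym [] ?u" by simp
    then show ?thesis unfolding Z_def by (intro span_base) blast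
  qed
  ultimately have "es R (e0s 0 v) \<in> Z"
    by (intro es_in_invariant[where r = ?r]) (auto simp: Z_def span_base)
  moreover have "Z \<subseteq> span (N \<union> (\<lambda>\<mu>. foldr complete_sym \<mu> ?u) ` box_partitions ?r (m - ?r))"
    unfolding Z_def
  proof (rule span_minimal[OF _ subspace_span])
    have "foldr complete_sym \<kappa> ?u \<in> span (N \<union> (\<lambda>\<mu>. foldr complete_sym \<mu> ?u) ` box_partitions ?r (m - ?r))" for \<kappa>
      by (rule half_h.foldr_newton_in_span_box_partitions)
        (use sub elementary_e0s_N complete_e0s_N[OF assms] in \<open>auto intro: newton_N\<close>)
    then show "N \<union> {foldr complete_sym \<kappa> ?u | \<kappa>. True}
      \<subseteq> span (N \<union> (\<lambda>\<mu>. foldr complete_sym \<mu> ?u) ` box_partitions ?r (m - ?r))"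
      by (auto intro: span_base)
  qed
  ultimately have "es R v \<in> span (N \<union> (\<lambda>\<mu>. foldr complete_sym \<mu> ?u) ` box_partitions ?r (m - ?r))"
    by auto
  also have "\<dots> \<subseteq> span (N \<union> {foldr complete_sym \<mu> (e0s r v) | r \<mu>.
    r = length R \<and> r \<le> m \<and> \<mu> \<in> box_partitions r (m - r)})"
    using True by (intro span_mono) auto
  finally show ?thesis .
next
  case False
  \<comment> \<open>With more than \<open>m\<close> letters, e_0^r v already lies in
    \<open>N\<close>, so \<open>N\<close> itself serves as the invariant subspace.\<close>
  then have "es R (e0s 0 v) \<in> N"
    using e0s_nilpotent[OF assms] sub N_H by (intro es_in_invariant[where r = "length R"]) auto
  then show ?thesis by (auto intro: span_base)
qed

end

end


section \<open>A spanning set of the Weyl module\<close>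

text \<open>\<open>(S, r, \<mu>)\<close> stands for \<open>c\<^sub>\<mu> e\<^sub>0^r g\<^sup>+\<^sub>S w\<close>, where \<open>c\<^sub>\<mu>\<close> is a product of complete symmetric
  polynomials in the \<open>h\<^sub>i / 2\<close>.\<close>

definition weyl_index :: "nat \<Rightarrow> (nat set \<times> nat \<times> nat list) set" where
  "weyl_index n = {(S, r, \<mu>). S \<subseteq> {..<n} \<and> r \<le> n - card S \<and> \<mu> \<in> box_partitions r (n - card S - r)}"

context osp_current_module
begin

section \<open>The filtration by odd letters\<close>

lemma es_linear: "Vector_Spaces.linear scl scl (es R)"
  by unfold_locales (simp_all add: es_add es_scale)

lemma act_Gp_es: "act (Gp, i) (es R x) = es R (act (Gp, i) x)"
  by (induction R) (simp_all add: act_Gp_E)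

text \<open>The predicate constrains only the number and the total t-degree of the odd letters; its
  various choices give the layers of the filtration.\<close>

definition EG :: "'v \<Rightarrow> (nat \<Rightarrow> nat \<Rightarrow> bool) \<Rightarrow> 'v set" where
  "EG w P = span {es R (gs I w) | R I. P (length I) (sum_list I)}"

lemma subspace_EG [simp]: "subspace (EG w P)"
  by (simp add: EG_def)

lemma EG_base: "P (length I) (sum_list I) \<Longrightarrow> es R (gs I w) \<in> EG w P"
  unfolding EG_def by (intro span_base) blast

lemma EG_gs: "P (length I) (sum_list I) \<Longrightarrow> gs I w \<in> EG w P"
  using EG_base[of P I "[]"] by simp

lemma EG_mono: "(\<And>k d. P k d \<Longrightarrow> Q k d) \<Longrightarrow> x \<in> EG w P \<Longrightarrow> x \<in> EG w Q"
  using span_mono[of "{es R (gs I w) | R I. P (length I) (sum_list I)}"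
      "{es R (gs I w) | R I. Q (length I) (sum_list I)}"] unfolding EG_def by blast

lemma linear_on_EG:
  assumes "x \<in> EG w P" "Vector_Spaces.linear scl scl T" "subspace Y"
    "\<And>R I. P (length I) (sum_list I) \<Longrightarrow> T (es R (gs I w)) \<in> Y"
  shows "T x \<in> Y"
  by (rule linear_on_span[OF assms(2,3) _ assms(1)[unfolded EG_def]]) (use assms(4) in auto)

lemma EG_E: "x \<in> EG w P \<Longrightarrow> act (E, i) x \<in> EG w P"
proof (erule linear_on_EG)
  fix R I assume "P (length I) (sum_list I)"
  then show "act (E, i) (es R (gs I w)) \<in> EG w P"
    using EG_base[of P I "i # R"] by simp
qed (simp_all add: act_linear)

lemma EG_es: "x \<in> EG w P \<Longrightarrow> es R x \<in> EG w P"
  by (induction R) (simp_all add: EG_E)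

lemma EG_Gp:
  assumes "x \<in> EG w P" "\<And>k d. P k d \<Longrightarrow> Q (Suc k) (i + d)"
  shows "act (Gp, i) x \<in> EG w Q"
  using assms(1)
proof (rule linear_on_EG)
  fix R I assume "P (length I) (sum_list I)"
  then show "act (Gp, i) (es R (gs I w)) \<in> EG w Q"
    using EG_base[of Q "i # I" R] assms(2) by (simp add: act_Gp_es)
qed (simp_all add: act_linear)

fun basis_vector :: "'v \<Rightarrow> nat set \<times> nat \<times> nat list \<Rightarrow> 'v" where
  "basis_vector w (S, r, \<mu>) = foldr complete_sym \<mu> (e0s r (gs (sorted_list_of_set S) w))"

context
  fixes n :: nat and w :: 'v
  assumes rel: "weyl_relations scl act n w"
begin

lemma w_relations:
  "act (F, i) w = 0" "act (Gm, i) w = 0" "i \<ge> 1 \<Longrightarrow> act (H, i) w = 0"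
  "act (H, 0) w = scl (- of_nat n) w" "e0s (Suc n) w = 0"
proof -
  show "act (F, i) w = 0" "act (Gm, i) w = 0"
    using rel by (cases "i = 0"; simp add: weyl_relations_def)+
  show "i \<ge> 1 \<Longrightarrow> act (H, i) w = 0" "act (H, 0) w = scl (- of_nat n) w" "e0s (Suc n) w = 0"
    using rel unfolding weyl_relations_def Suc_eq_plus1 by blast+
qed

lemma H_gs: "act (H, i) (gs I w) \<in> EG w (\<lambda>k d. k = length I \<and> d = sum_list I + i)"
proof (induction I)
  case Nil
  show ?case
  proof (cases "i = 0")
    case True
    have "gs [] w \<in> EG w (\<lambda>k d. k = length [] \<and> d = sum_list [] + i)"
      by (rule EG_gs) (simp add: True)
    then show ?thesis
      unfolding True by (simp add: w_relations(4) subspace_scale subspace_neg)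
  qed (simp add: w_relations subspace_0)
next
  case (Cons j I)
  have "gs ((i + j) # I) w \<in> EG w (\<lambda>k d. k = length (j # I) \<and> d = sum_list (j # I) + i)"
    by (rule EG_gs) simp
  moreover have "act (Gp, j) (act (H, i) (gs I w)) \<in> EG w (\<lambda>k d. k = length (j # I) \<and> d = sum_list (j # I) + i)"
    by (rule EG_Gp[OF Cons.IH]) simp
  ultimately show ?case by (simp add: act_H_Gp subspace_add del: sum_list.Cons)
qed

text \<open>The bracket of \<open>Gm\<close> with \<open>Gp\<close> is \<open>H\<close>, which keeps
  the number of odd letters, so one of them is lost. In the next lemma \<open>F\<close> turns a
  \<open>Gp\<close> into a \<open>Gm\<close> and loses odd letters as well.\<close>

lemma Gm_gs: "act (Gm, i) (gs I w) \<in> EG w (\<lambda>k d. k < length I)"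
proof (induction I)
  case (Cons j I)
  have "act (Gp, j) (act (Gm, i) (gs I w)) \<in> EG w (\<lambda>k d. k < length (j # I))"
    by (rule EG_Gp[OF Cons.IH]) simp
  moreover have "act (H, i + j) (gs I w) \<in> EG w (\<lambda>k d. k < length (j # I))"
    by (rule EG_mono[OF _ H_gs]) simp
  ultimately show ?case by (simp add: act_Gm_Gp subspace_diff)
qed (simp add: w_relations subspace_0)

lemma F_gs: "act (F, i) (gs I w) \<in> EG w (\<lambda>k d. k < length I)"
proof (induction I)
  case (Cons j I)
  have "act (Gp, j) (act (F, i) (gs I w)) \<in> EG w (\<lambda>k d. k < length (j # I))"
    by (rule EG_Gp[OF Cons.IH]) simp
  moreover have "act (Gm, i + j) (gs I w) \<in> EG w (\<lambda>k d. k < length (j # I))"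
    by (rule EG_mono[OF _ Gm_gs]) simp
  ultimately show ?case by (simp add: act_F_Gp subspace_diff)
qed (simp add: w_relations subspace_0)

lemma EG_H:
  assumes "x \<in> EG w P" and P: "\<And>k d. P k d \<Longrightarrow> P k (d + i)"
  shows "act (H, i) x \<in> EG w P"
  using assms(1)
proof (rule linear_on_EG)
  fix R I assume I: "P (length I) (sum_list I)"
  have "act (H, i) (es R (gs I w)) - es R (act (H, i) (gs I w)) \<in> EG w P"
    using act_H_es span_minimal[OF _ subspace_EG, of "{es R' (gs I w) | R'. length R' = length R}" w P]
      EG_base[of P I, OF I] by blast
  moreover have "es R (act (H, i) (gs I w)) \<in> EG w P"
    by (rule EG_es, rule EG_mono[OF _ H_gs]) (use I P in auto)
  ultimately show "act (H, i) (es R (gs I w)) \<in> EG w P"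
    using subspace_add[OF subspace_EG] by fastforce
qed (simp_all add: act_linear)

text \<open>Passing a letter \<open>E\<close>, \<open>F\<close> leaves an \<open>H\<close>, which
  raises the degree; reaching the letters \<open>Gp\<close>, it leaves fewer of them. The two
  closure conditions on \<open>P\<close> absorb these terms.\<close>

lemma EG_F:
  assumes "x \<in> EG w P" and P: "\<And>k d i. P k d \<Longrightarrow> P k (d + i)" "\<And>k d k' d'. P k d \<Longrightarrow> k' < k \<Longrightarrow> P k' d'"
  shows "act (F, i) x \<in> EG w P"
  using assms(1)
proof (rule linear_on_EG)
  fix R I assume I: "P (length I) (sum_list I)"
  show "act (F, i) (es R (gs I w)) \<in> EG w P"
  proof (induction R arbitrary: i)
    case Nil
    have "act (F, i) (gs I w) \<in> EG w P"
      by (rule EG_mono[OF _ F_gs]) (use I P in blast)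
    then show ?case by simp
  next
    case (Cons j R)
    then show ?case
      by (simp add: act_F_E subspace_diff EG_E EG_H EG_base I P)
  qed
qed (simp_all add: act_linear)

lemma EG_Gm_all:
  assumes "x \<in> EG w (\<lambda>_ _. True)"
  shows "act (Gm, i) x \<in> EG w (\<lambda>_ _. True)"
  using assms
proof (rule linear_on_EG)
  fix R I
  show "act (Gm, i) (es R (gs I w)) \<in> EG w (\<lambda>_ _. True)"
  proof (induction R arbitrary: i)
    case Nil
    have "act (Gm, i) (gs I w) \<in> EG w (\<lambda>_ _. True)"
      by (rule EG_mono[OF _ Gm_gs]) auto
    then show ?case by simp
  next
    case (Cons j R)
    have "act (Gp, i + j) (es R (gs I w)) \<in> EG w (\<lambda>_ _. True)"
      by (rule EG_Gp[OF EG_base]) auto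
    with Cons show ?case
      by (simp add: act_Gm_E subspace_add EG_E)
  qed
qed (simp_all add: act_linear)

text \<open>A PBW argument: the span of the words with every \<open>E\<close> before every
  \<open>Gp\<close> contains \<open>w\<close> and is stable under all five kinds of letters.\<close>

lemma word_in_EG: "foldr act u w \<in> EG w (\<lambda>_ _. True)"
proof (induction u)
  case Nil
  show ?case using EG_gs[of _ "[]"] by simp
next
  case (Cons x u)
  obtain y i where x: "x = (y, i)" by fastforce
  show ?case unfolding x using Cons
    by (cases y) (auto intro: EG_E EG_H EG_F EG_Gm_all EG_Gp)
qed

text \<open>In one variable h_k is the k-th power, so \<open>complete_sym k\<close> sends e_0 w to
  e_k w. For \<open>k\<close> at least \<open>n\<close> this vanishes by
  \<open>complete_e0s_N\<close> with \<open>r = 1\<close> and the zero submodule.\<close>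

lemma E_high:
  assumes "i \<ge> n"
  shows "act (E, i) w = 0"
proof -
  have c: "complete_sym k w = (if k = 0 then w else 0)" for k
    by (cases k) (simp_all add: half_h.newton.simps(2) half_h.p_newton w_relations)
  have "complete_sym k (act (E, 0) w) = act (E, k) w" for k
  proof (induction k rule: less_induct)
    case (less k)
    show ?case
    proof (cases k)
      case (Suc l)
      have "scl (1 / 2) (act (H, Suc i) (complete_sym (l - i) (act (E, 0) w))) = act (E, k) w" if "i \<le> l" for i
        using less[of "l - i"] that Suc by (simp add: act_H_E w_relations)
      then have "(\<Sum>i\<le>l. scl (1 / 2) (act (H, Suc i) (complete_sym (l - i) (act (E, 0) w)))) = (\<Sum>i\<le>l. act (E, k) w)"
        by (intro sum.cong) simp_all
      then have "complete_sym k (act (E, 0) w) = scl (1 / of_nat (Suc l)) (\<Sum>i\<le>l. act (E, k) w)"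
        unfolding Suc half_h.newton.simps(2) by (simp only:)
      then show ?thesis by (simp add: sum_constant_scale del: of_nat_Suc sum_constant)
    qed simp
  qed
  moreover have "complete_sym i (e0s 1 w) \<in> {0}"
    by (rule complete_e0s_N[where m = n and K = "Suc n"])
      (use assms w_relations in \<open>auto simp: subspace_def\<close>)
  ultimately show ?thesis by simp
qed

text \<open>The letter in question is the bracket of \<open>Gm\<close> in degree 0 with e_i, and
  both of these kill \<open>w\<close>.\<close>

lemma Gp_high:
  assumes "i \<ge> n"
  shows "act (Gp, i) w = 0"
  using act_Gm_E[of 0 i w] E_high[OF assms] by (simp add: w_relations)

section \<open>Sorting the odd letters\<close>

definition normal :: "nat list \<Rightarrow> bool" where
  "normal J \<longleftrightarrow> sorted_wrt (<) J \<and> set J \<subseteq> {..<n}"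

text \<open>One step of insertion sort. Odd letters anticommute up to 2 e_(x+y), which costs two of
  them; a repeated letter squares to e_(2x); an index from \<open>n\<close> on kills
  \<open>w\<close>.\<close>

lemma normal_insert:
  assumes "normal J"
  shows "act (Gp, x) (gs J w) \<in> span ({gs J' w | J'. normal J' \<and> set J' \<subseteq> insert x (set J)
      \<and> length J' = Suc (length J) \<and> sum_list J' = x + sum_list J} \<union> EG w (\<lambda>k d. k < Suc (length J)))"
    (is "_ \<in> span (?S J \<union> ?L J)")
  using assms
proof (induction J)
  case Nil
  show ?case
  proof (cases "x < n")
    case True
    then have "act (Gp, x) w \<in> ?S []"
      by (auto simp: normal_def intro!: exI[of _ "[x]"])
    then show ?thesis by (auto intro: span_base)
  qed (simp add: Gp_high span_zero)
next
  case (Cons y J)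
  have J: "normal J" using Cons.prems by (simp add: normal_def)
  consider "x < y" | "x = y" | "y < x" by linarith
  then show ?case
  proof cases
    case 1
    then have "gs (x # y # J) w \<in> ?S (y # J)"
      using Cons.prems by (intro CollectI exI[of _ "x # y # J"]) (auto simp: normal_def)
    then show ?thesis by (auto intro: span_base)
  next
    case 2
    let ?y = "act (Gp, x) (gs (y # J) w)"
    have "scl 2 ?y = ?y + ?y"
      using scale_left_distrib[of 1 1 ?y] by simp
    also have "\<dots> = scl 2 (act (E, x + x) (gs J w))"
      using act_Gp_Gp[of x x "gs J w"] by (simp add: 2 eq_diff_eq)
    finally have "?y = act (E, x + x) (gs J w)"
      by simp
    also have "\<dots> \<in> ?L (y # J)" by (intro EG_E EG_gs) simp
    finally show ?thesis by (auto intro: span_base)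
  next
    case 3
    have "act (Gp, y) (act (Gp, x) (gs J w)) \<in> span (?S (y # J) \<union> ?L (y # J))"
    proof (rule linear_on_span[OF act_linear subspace_span _ Cons.IH[OF J]])
      fix v assume "v \<in> ?S J \<union> ?L J"
      then show "act (Gp, y) v \<in> span (?S (y # J) \<union> ?L (y # J))"
      proof
        assume "v \<in> ?S J"
        then obtain J' where J': "v = gs J' w" "normal J'" "set J' \<subseteq> insert x (set J)"
          "length J' = Suc (length J)" "sum_list J' = x + sum_list J" by blast
        have "gs (y # J') w \<in> ?S (y # J)"
          using J' Cons.prems 3 by (intro CollectI exI[of _ "y # J'"]) (auto simp: normal_def)
        then show ?thesis using J' by (auto intro: span_base)
      next
        assume "v \<in> ?L J"
        then have "act (Gp, y) v \<in> ?L (y # J)" by (rule EG_Gp) simp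
        then show ?thesis by (auto intro: span_base)
      qed
    qed
    moreover have "act (E, x + y) (gs J w) \<in> ?L (y # J)" by (intro EG_E EG_gs) simp
    then have "act (E, x + y) (gs J w) \<in> span (?S (y # J) \<union> ?L (y # J))" by (auto intro: span_base)
    ultimately show ?thesis by (simp add: act_Gp_Gp[of x y] span_diff span_scale)
  qed
qed

lemma es_gs_in_span_normal:
  "es R (gs I w) \<in> span ({es R (gs J w) | J. normal J \<and> length J = length I \<and> sum_list J = sum_list I}
    \<union> EG w (\<lambda>k d. k < length I))"
proof -
  let ?S = "\<lambda>I. {gs J w | J. normal J \<and> length J = length I \<and> sum_list J = sum_list I}"
  let ?L = "\<lambda>I. EG w (\<lambda>k d. k < length I)"
  have "gs I w \<in> span (?S I \<union> ?L I)"
  proof (induction I)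
    case Nil
    have "gs [] w \<in> ?S []" by (intro CollectI exI[of _ "[]"]) (auto simp: normal_def)
    then show ?case by (auto intro: span_base)
  next
    case (Cons x I)
    have "act (Gp, x) (gs I w) \<in> span (?S (x # I) \<union> ?L (x # I))"
    proof (rule linear_on_span[OF act_linear subspace_span _ Cons.IH])
      fix v assume "v \<in> ?S I \<union> ?L I"
      then show "act (Gp, x) v \<in> span (?S (x # I) \<union> ?L (x # I))"
      proof
        assume "v \<in> ?S I"
        then obtain J where J: "v = gs J w" "normal J" "length J = length I" "sum_list J = sum_list I" by blast
        have "span ({gs J' w | J'. normal J' \<and> set J' \<subseteq> insert x (set J)
          \<and> length J' = Suc (length J) \<and> sum_list J' = x + sum_list J} \<union> EG w (\<lambda>k d. k < Suc (length J)))
          \<subseteq> span (?S (x # I) \<union> ?L (x # I))"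
          by (rule span_mono) (use J in auto)
        then show ?thesis using normal_insert[OF J(2), of x] J(1) by blast
      next
        assume "v \<in> ?L I"
        then have "act (Gp, x) v \<in> ?L (x # I)" by (rule EG_Gp) simp
        then show ?thesis by (auto intro: span_base)
      qed
    qed
    then show ?case by simp
  qed
  then show ?thesis
  proof (rule linear_on_span[OF es_linear subspace_span, rotated])
    fix v assume "v \<in> ?S I \<union> ?L I"
    then show "es R v \<in> span ({es R (gs J w) | J. normal J \<and> length J = length I \<and> sum_list J = sum_list I}
      \<union> EG w (\<lambda>k d. k < length I))"
      by (auto intro!: span_base EG_es)
  qed
qed


text \<open>\<open>es_in_span_complete\<close> is applied with \<open>N\<close> the layer of fewer
  odd letters, or equally many of larger total degree: modulo it, \<open>F\<close> and all h_i with
  i > 0 kill \<open>gs J w\<close>, which has weight -(n - |J|). Integrability passes from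
  \<open>w\<close> to this vector because \<open>Gp\<close> commutes with \<open>E\<close>.\<close>

lemma es_gs_normal_in_span:
  assumes J: "normal J"
  shows "es R (gs J w) \<in> span (basis_vector w ` weyl_index n \<union> EG w (\<lambda>k d. k < length J \<or> k = length J \<and> d > sum_list J))"
    (is "_ \<in> span (?B \<union> EG w ?P)")
proof -
  let ?v = "gs J w"
  let ?m = "n - length J"
  have dist: "sorted_list_of_set (set J) = J" "card (set J) = length J"
    using J by (auto simp: normal_def strict_sorted_iff sorted_list_of_set.idem_if_sorted_distinct distinct_card)
  have "length J \<le> n"
    using card_mono[of "{..<n}" "set J"] J dist by (simp add: normal_def)
  have H0: "act (H, 0) (gs I w) = scl (of_nat (length I) - of_nat n) (gs I w)" for I
  proof (induction I)
    case (Cons j I)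
    let ?c = "of_nat (length I) - of_nat n :: complex"
    have "act (H, 0) (gs (j # I) w) = scl (?c + 1) (gs (j # I) w)"
      unfolding scale_left_distrib by (simp add: act_H_Gp act.scale Cons)
    then show ?case by (simp add: algebra_simps)
  qed (simp add: w_relations)
  have gE: "gs I (act (E, 0) x) = act (E, 0) (gs I x)" for I x
    by (induction I) (simp_all add: act_Gp_E)
  have "e0s (Suc n) ?v = gs J (e0s (Suc n) w)"
  proof -
    have "e0s k (gs I w) = gs I (e0s k w)" for k I
      by (induction k) (simp_all add: gE)
    then show ?thesis .
  qed
  also have "\<dots> = 0" unfolding w_relations by (induction J) simp_all
  finally have "e0s (Suc n) ?v \<in> EG w ?P" by (simp add: subspace_0)
  then have "es R ?v \<in> span (EG w ?P \<union> {foldr complete_sym \<mu> (e0s r ?v) | r \<mu>.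
    r = length R \<and> r \<le> ?m \<and> \<mu> \<in> box_partitions r (?m - r)})"
  proof (rule es_in_span_complete[rotated -1])
    show "act (F, i) ?v \<in> EG w ?P" for i
      by (rule EG_mono[OF _ F_gs]) simp
    show "act (H, i) ?v \<in> EG w ?P" if "i \<ge> 1" for i
      by (rule EG_mono[OF _ H_gs]) (use that in simp)
    show "act (H, 0) ?v = scl (- of_nat ?m) ?v"
      using \<open>length J \<le> n\<close> by (simp add: H0 of_nat_diff)
    show "act (F, i) x \<in> EG w ?P" if "x \<in> EG w ?P" for i x
      by (rule EG_F[OF that]) auto
    show "act (H, i) x \<in> EG w ?P" if "x \<in> EG w ?P" for i x
      by (rule EG_H[OF that]) auto
  qed (auto intro: EG_E)
  moreover have "{foldr complete_sym \<mu> (e0s r ?v) | r \<mu>.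
    r = length R \<and> r \<le> ?m \<and> \<mu> \<in> box_partitions r (?m - r)} \<subseteq> ?B"
  proof safe
    fix \<mu> assume "length R \<le> ?m" "\<mu> \<in> box_partitions (length R) (?m - length R)"
    then have "(set J, length R, \<mu>) \<in> weyl_index n"
      using J dist by (auto simp: weyl_index_def normal_def)
    then show "foldr complete_sym \<mu> (e0s (length R) ?v) \<in> ?B"
      using dist by (intro image_eqI) auto
  qed
  ultimately show ?thesis
    using span_mono[of "EG w ?P \<union> {foldr complete_sym \<mu> (e0s r ?v) | r \<mu>.
      r = length R \<and> r \<le> ?m \<and> \<mu> \<in> box_partitions r (?m - r)}" "?B \<union> EG w ?P"] by blast
qed

text \<open>Induction on the number of odd letters and, inside a layer, towards higher total degree.
  For normal words the degree is bounded by \<open>n * K\<close>, which gives the decreasing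
  measure.\<close>

lemma EG_subset_span_basis: "EG w (\<lambda>k d. k < K) \<subseteq> span (basis_vector w ` weyl_index n)"
  (is "_ \<subseteq> span ?B")
proof (induction K)
  case 0
  then show ?case by (simp add: EG_def span_zero)
next
  case (Suc K)
  have normal: "es R (gs J w) \<in> span ?B" if "normal J" "length J = K" for R J
    using that
  proof (induction "n * K - sum_list J" arbitrary: J R rule: less_induct)
    case less
    let ?P = "\<lambda>k d. k < length J \<or> k = length J \<and> d > sum_list J"
    have "EG w ?P \<subseteq> span ?B"
      unfolding EG_def
    proof (rule span_minimal[OF _ subspace_span], safe)
      fix R' I' :: "nat list" assume "length I' < length J"
      then have "es R' (gs I' w) \<in> EG w (\<lambda>k d. k < K)" using less by (intro EG_base) simp
      then show "es R' (gs I' w) \<in> span ?B" using Suc by blast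
    next
      fix R' I' :: "nat list" assume I': "length I' = length J" "sum_list J < sum_list I'"
      have "{es R' (gs J' w) | J'. normal J' \<and> length J' = length I' \<and> sum_list J' = sum_list I'}
        \<union> EG w (\<lambda>k d. k < length I') \<subseteq> span ?B"
      proof (safe)
        fix J' assume J': "normal J'" "length J' = length I'" "sum_list J' = sum_list I'"
        have "sum_list J' \<le> n * length J'"
          using J'(1) unfolding normal_def by (induction J') auto
        then show "es R' (gs J' w) \<in> span ?B"
          using less.prems I' J' by (intro less.hyps) auto
      qed (use Suc I' less.prems in auto)
      then show "es R' (gs I' w) \<in> span ?B"
        using es_gs_in_span_normal span_minimal[OF _ subspace_span] by blast
    qed
    then have "?B \<union> EG w ?P \<subseteq> span ?B" by (auto intro: span_base)
    then show ?case using es_gs_normal_in_span[OF less.prems(1)] span_minimal[OF _ subspace_span] by blast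
  qed
  have "es R (gs I w) \<in> span ?B" if "length I \<le> K" for R I
  proof (cases "length I = K")
    case True
    have "{es R (gs J w) | J. normal J \<and> length J = length I \<and> sum_list J = sum_list I}
      \<union> EG w (\<lambda>k d. k < length I) \<subseteq> span ?B"
      using normal Suc True by auto
    then show ?thesis
      using es_gs_in_span_normal span_minimal[OF _ subspace_span] by blast
  next
    case False
    then have "es R (gs I w) \<in> EG w (\<lambda>k d. k < K)" using that by (intro EG_base) simp
    then show ?thesis using Suc by blast
  qed
  then show ?case unfolding EG_def by (intro span_minimal) auto
qed

lemma word_in_span_basis: "foldr act u w \<in> span (basis_vector w ` weyl_index n)"
  (is "_ \<in> span ?B")
proof -
  have "EG w (\<lambda>_ _. True) \<subseteq> span ?B"
    unfolding EG_def
  proof (rule span_minimal[OF _ subspace_span], safe)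
    fix R I
    have "es R (gs I w) \<in> EG w (\<lambda>k d. k < Suc (length I))" by (intro EG_base) simp
    then show "es R (gs I w) \<in> span ?B" using EG_subset_span_basis by blast
  qed
  then show ?thesis using word_in_EG by blast
qed

end

end


section \<open>Tensor products of evaluation modules\<close>

datatype site = Lo | Mid | Hi

lemma UNIV_site: "(UNIV :: site set) = {Lo, Mid, Hi}"
  using site.exhaust by auto

instance site :: finite
  by standard (simp add: UNIV_site)

text \<open>\<open>site_matrix y p q\<close> is the coefficient of \<open>p\<close> in
  \<open>y q\<close>, for the 3-dimensional module with weights -1, 0, 1, in which
  \<open>Mid\<close> is the odd vector.\<close>

fun site_matrix :: "osp \<Rightarrow> site \<Rightarrow> site \<Rightarrow> complex" where
  "site_matrix E Hi Lo = 1"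
| "site_matrix F Lo Hi = 1"
| "site_matrix H Lo Lo = -1"
| "site_matrix H Hi Hi = 1"
| "site_matrix Gp Mid Lo = 1"
| "site_matrix Gp Hi Mid = 1"
| "site_matrix Gm Lo Mid = -1"
| "site_matrix Gm Mid Hi = 1"
| "site_matrix _ _ _ = 0"

lemma site_matrix_Lo: "site_matrix F p Lo = 0" "site_matrix Gm p Lo = 0"
  by (cases p; simp)+

definition parity :: "site \<Rightarrow> complex" where
  "parity s = (if s = Mid then -1 else 1)"

text \<open>The sign that an odd element picks up on passing the first \<open>a\<close> tensor
  factors.\<close>

definition koszul :: "osp \<Rightarrow> nat \<Rightarrow> (nat \<Rightarrow> site) \<Rightarrow> complex" where
  "koszul y a \<sigma> = (if y \<in> {Gp, Gm} then \<Prod>b<a. parity (\<sigma> b) else 1)"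

type_synonym tensor = "(nat \<Rightarrow> site) \<Rightarrow> complex"

definition tensor_scale :: "complex \<Rightarrow> tensor \<Rightarrow> tensor" where
  "tensor_scale c f = (\<lambda>\<sigma>. c * f \<sigma>)"

interpretation tensor: vector_space tensor_scale
  by unfold_locales (auto simp: tensor_scale_def algebra_simps)

lemma sum_apply_fun: "(\<Sum>i\<in>A. f i) \<sigma> = (\<Sum>i\<in>A. (f i :: tensor) \<sigma>)"
  by (induction A rule: infinite_finite_induct) auto

definition site_act :: "osp \<Rightarrow> nat \<Rightarrow> tensor \<Rightarrow> tensor" where
  "site_act y a f = (\<lambda>\<sigma>. koszul y a \<sigma> * (\<Sum>q\<in>UNIV. site_matrix y (\<sigma> a) q * f (\<sigma>(a := q))))"

text \<open>The factor at site \<open>a\<close> is evaluated at t = a, so the evaluation points are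
  distinct. Sites from \<open>n\<close> on are never touched, which lets all \<open>n\<close> share
  one type.\<close>

definition tensor_act :: "nat \<Rightarrow> osp \<times> nat \<Rightarrow> tensor \<Rightarrow> tensor" where
  "tensor_act n x f = (\<lambda>\<sigma>. \<Sum>a<n. of_nat a ^ snd x * site_act (fst x) a f \<sigma>)"

lemma parity_square [simp]: "parity s * parity s = 1"
  by (simp add: parity_def)

lemma koszul_square: "(\<Prod>b<a. parity (\<sigma> b)) * (\<Prod>b<a. parity (\<sigma> b)) = 1"
  by (simp add: prod.distrib[symmetric])

lemma koszul_update_ge: "a \<le> b \<Longrightarrow> koszul y a (\<sigma>(b := q)) = koszul y a \<sigma>"
  by (auto simp: koszul_def intro!: prod.cong)

text \<open>An odd \<open>y\<close> flips the parity of site \<open>a\<close>, an even one keeps it.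
  The common factor \<open>site_matrix y (\<sigma> a) q\<close> restricts this to the states that
  \<open>y\<close> connects.\<close>

lemma koszul_update_less:
  assumes "a < b"
  shows "site_matrix y (\<sigma> a) q * koszul z b (\<sigma>(a := q)) = site_matrix y (\<sigma> a) q * (osp_sign y z * koszul z b \<sigma>)"
proof (cases "z \<in> {Gp, Gm}")
  case True
  let ?P = "\<Prod>c\<in>{..<b} - {a}. parity (\<sigma> c)"
  have "(\<Prod>c<b. parity ((\<sigma>(a := q)) c)) = parity q * ?P"
    using assms by (subst prod.remove[of _ a]) (auto intro!: prod.cong)
  moreover have "(\<Prod>c<b. parity (\<sigma> c)) = parity (\<sigma> a) * ?P"
    using assms by (subst prod.remove[of _ a]) auto
  moreover have "site_matrix y (\<sigma> a) q * parity q = site_matrix y (\<sigma> a) q * (osp_sign y z * parity (\<sigma> a))"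
    using True by (cases y; cases "\<sigma> a"; cases q) (auto simp: parity_def osp_sign_def)
  ultimately show ?thesis
    using True by (simp add: koszul_def mult.assoc[symmetric])
qed (simp add: koszul_def osp_sign_def)

lemma site_act_commute_less:
  assumes "a < b"
  shows "site_act y a (site_act z b f) \<sigma> = osp_sign y z * site_act z b (site_act y a f) \<sigma>"
proof -
  have ab: "(\<sigma>(a := p, b := q)) = \<sigma>(b := q, a := p)" for p q
    using assms by (auto simp: fun_upd_twist)
  have "site_act y a (site_act z b f) \<sigma> = (\<Sum>p\<in>UNIV. \<Sum>q\<in>UNIV. koszul y a \<sigma> *
     (site_matrix y (\<sigma> a) p * koszul z b (\<sigma>(a := p)) * (site_matrix z (\<sigma> b) q * f (\<sigma>(a := p, b := q)))))"
    using assms by (simp add: site_act_def sum_distrib_left mult.assoc)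
  also have "\<dots> = (\<Sum>q\<in>UNIV. \<Sum>p\<in>UNIV. osp_sign y z * (koszul z b \<sigma> * (site_matrix z (\<sigma> b) q *
      (koszul y a \<sigma> * (site_matrix y (\<sigma> a) p * f (\<sigma>(b := q, a := p)))))))"
    unfolding koszul_update_less[OF assms] ab by (subst sum.swap) (simp add: mult_ac)
  also have "\<dots> = osp_sign y z * site_act z b (site_act y a f) \<sigma>"
    using assms by (simp add: site_act_def sum_distrib_left koszul_update_ge)
  finally show ?thesis .
qed

lemma site_act_commute:
  assumes "a \<noteq> b"
  shows "site_act y a (site_act z b f) \<sigma> = osp_sign y z * site_act z b (site_act y a f) \<sigma>"
proof (cases "a < b")
  case False
  then have "site_act z b (site_act y a f) \<sigma> = osp_sign z y * site_act y a (site_act z b f) \<sigma>"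
    using assms by (intro site_act_commute_less) simp
  moreover have "osp_sign y z * osp_sign z y = 1" by (simp add: osp_sign_def)
  ultimately show ?thesis by (metis mult.assoc mult_1)
qed (rule site_act_commute_less)

lemma site_act_bracket:
  "site_act y a (site_act z a f) \<sigma> - osp_sign y z * site_act z a (site_act y a f) \<sigma>
    = (\<Sum>c\<in>UNIV. osp_bracket y z c * site_act c a f \<sigma>)"
proof -
  define k where "k = (\<Prod>b<a. parity (\<sigma> b))"
  have k: "k * k = 1" "k * (k * x) = x" for x
    unfolding k_def mult.assoc[symmetric] by (simp_all add: koszul_square)
  have s0: "site_act x a g \<sigma> = (if x \<in> {Gp, Gm} then k else 1) * (\<Sum>q\<in>UNIV. site_matrix x (\<sigma> a) q * g (\<sigma>(a := q)))" for x g
    by (simp add: site_act_def koszul_def k_def)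
  have sa: "site_act x a g (\<sigma>(a := q)) = (if x \<in> {Gp, Gm} then k else 1) * (\<Sum>q'\<in>UNIV. site_matrix x q q' * g (\<sigma>(a := q')))" for x g q
    unfolding site_act_def koszul_update_ge[OF order.refl] by (simp add: koszul_def k_def)
  show ?thesis
    by (cases y; cases z; cases "\<sigma> a")
      (simp_all add: s0 sa UNIV_site UNIV_osp osp_sign_def k algebra_simps)
qed

lemma tensor_act_module: "osp_current_module tensor_scale (tensor_act n)"
proof unfold_locales
  fix x f g c
  show "tensor_act n x (f + g) = tensor_act n x f + tensor_act n x g"
    "tensor_act n x (tensor_scale c f) = tensor_scale c (tensor_act n x f)"
    by (simp_all add: tensor_act_def site_act_def tensor_scale_def fun_eq_iff sum.distrib algebra_simps sum_distrib_left)
next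
  fix y i z j f
  show "tensor_act n (y, i) (tensor_act n (z, j) f)
      - tensor_scale (osp_sign y z) (tensor_act n (z, j) (tensor_act n (y, i) f))
    = (\<Sum>c\<in>UNIV. tensor_scale (osp_bracket y z c) (tensor_act n (c, i + j) f))"
  proof
    fix \<sigma>
    let ?z = "\<lambda>a. of_nat a :: complex"
    have lin: "site_act x a (tensor_act n x' f) \<sigma> = (\<Sum>b<n. ?z b ^ snd x' * site_act x a (site_act (fst x') b f) \<sigma>)" for x x' a
      unfolding site_act_def[of x a] tensor_act_def
      by (simp add: sum_distrib_left sum_distrib_right mult_ac) (subst sum.swap, simp)
    have A: "tensor_act n (y, i) (tensor_act n (z, j) f) \<sigma>
      = (\<Sum>a<n. \<Sum>b<n. ?z a ^ i * ?z b ^ j * site_act y a (site_act z b f) \<sigma>)"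
      unfolding tensor_act_def[of n "(y, i)"] by (simp add: lin sum_distrib_left mult.assoc)
    have B: "tensor_act n (z, j) (tensor_act n (y, i) f) \<sigma>
      = (\<Sum>a<n. \<Sum>b<n. ?z a ^ i * ?z b ^ j * site_act z b (site_act y a f) \<sigma>)"
      unfolding tensor_act_def[of n "(z, j)"] by (subst sum.swap) (simp add: lin sum_distrib_left mult_ac)
    have "tensor_act n (y, i) (tensor_act n (z, j) f) \<sigma>
      - osp_sign y z * tensor_act n (z, j) (tensor_act n (y, i) f) \<sigma>
      = (\<Sum>a<n. \<Sum>b<n. ?z a ^ i * ?z b ^ j *
         (site_act y a (site_act z b f) \<sigma> - osp_sign y z * site_act z b (site_act y a f) \<sigma>))"
      unfolding A B by (simp add: sum_distrib_left sum_subtractf right_diff_distrib mult_ac)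
    \<comment> \<open>Operators on different sites supercommute, so only the diagonal is
      left.\<close>
    also have "\<dots> = (\<Sum>a<n. \<Sum>b<n. if b = a then ?z a ^ (i + j) *
         (\<Sum>c\<in>UNIV. osp_bracket y z c * site_act c a f \<sigma>) else 0)"
    proof (intro sum.cong refl)
      fix a b
      show "?z a ^ i * ?z b ^ j * (site_act y a (site_act z b f) \<sigma> - osp_sign y z * site_act z b (site_act y a f) \<sigma>)
        = (if b = a then ?z a ^ (i + j) * (\<Sum>c\<in>UNIV. osp_bracket y z c * site_act c a f \<sigma>) else 0)"
        using site_act_commute[of a b y z f \<sigma>]
        by (cases "b = a") (simp_all add: site_act_bracket power_add)
    qed
    also have "\<dots> = (\<Sum>c\<in>UNIV. osp_bracket y z c * tensor_act n (c, i + j) f \<sigma>)"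
      by (simp add: tensor_act_def sum_distrib_left mult_ac) (subst sum.swap, simp)
    finally show "(tensor_act n (y, i) (tensor_act n (z, j) f)
      - tensor_scale (osp_sign y z) (tensor_act n (z, j) (tensor_act n (y, i) f))) \<sigma>
    = (\<Sum>c\<in>UNIV. tensor_scale (osp_bracket y z c) (tensor_act n (c, i + j) f)) \<sigma>"
      by (simp add: tensor_scale_def sum_apply_fun)
  qed
qed

section \<open>Cyclicity and dimension of the tensor product\<close>

definition pure_tensor :: "(nat \<Rightarrow> site) \<Rightarrow> tensor" where
  "pure_tensor \<sigma> = (\<lambda>\<tau>. if \<tau> = \<sigma> then 1 else 0)"

abbreviation lowest_tensor :: tensor where
  "lowest_tensor \<equiv> pure_tensor (\<lambda>_. Lo)"

lemma lowest_tensor_update: "q \<noteq> Lo \<Longrightarrow> lowest_tensor (\<sigma>(a := q)) = 0"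
  by (auto simp: pure_tensor_def fun_eq_iff)

lemma site_act_lowest:
  "site_act F a lowest_tensor = 0" "site_act Gm a lowest_tensor = 0"
  "site_act H a lowest_tensor = - lowest_tensor"
proof -
  show "site_act F a lowest_tensor = 0" "site_act Gm a lowest_tensor = 0"
    by (simp_all add: fun_eq_iff site_act_def UNIV_site lowest_tensor_update site_matrix_Lo)
  show "site_act H a lowest_tensor = - lowest_tensor"
  proof
    fix \<sigma>
    have "\<sigma> a \<noteq> Lo \<Longrightarrow> lowest_tensor \<sigma> = 0" by (auto simp: pure_tensor_def)
    moreover have "\<sigma> a = Lo \<Longrightarrow> \<sigma>(a := Lo) = \<sigma>" by auto
    ultimately show "site_act H a lowest_tensor \<sigma> = (- lowest_tensor) \<sigma>"
      by (cases "\<sigma> a") (simp_all add: site_act_def UNIV_site lowest_tensor_update koszul_def)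
  qed
qed

text \<open>\<open>E\<close> sends \<open>Lo\<close> to \<open>Hi\<close> and kills the other
  states, so each application uses up a new site. With \<open>n\<close> sites this makes e_0^(n+1)
  vanish on the lowest tensor.\<close>

lemma tensor_E0_power_support:
  "(tensor_act n (E, 0) ^^ k) lowest_tensor \<sigma> \<noteq> 0 \<Longrightarrow> k \<le> card {a. a < n \<and> \<sigma> a = Hi}"
proof (induction k arbitrary: \<sigma>)
  case (Suc k)
  let ?f = "(tensor_act n (E, 0) ^^ k) lowest_tensor"
  have "tensor_act n (E, 0) g \<sigma> = (\<Sum>a<n. site_act E a g \<sigma>)" for g
    by (simp add: tensor_act_def)
  then have "(\<Sum>a<n. site_act E a ?f \<sigma>) \<noteq> 0" using Suc.prems by simp
  then obtain a where a: "a \<in> {..<n}" "site_act E a ?f \<sigma> \<noteq> 0"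
    by (rule sum.not_neutral_contains_not_neutral)
  then have "\<sigma> a = Hi" "?f (\<sigma>(a := Lo)) \<noteq> 0"
    by (cases "\<sigma> a"; simp add: site_act_def UNIV_site)+
  then have "k \<le> card {b. b < n \<and> (\<sigma>(a := Lo)) b = Hi}" by (intro Suc.IH)
  also have "{b. b < n \<and> (\<sigma>(a := Lo)) b = Hi} = {b. b < n \<and> \<sigma> b = Hi} - {a}" by auto
  also have "card \<dots> < card {b. b < n \<and> \<sigma> b = Hi}"
    using a \<open>\<sigma> a = Hi\<close> by (intro card_Diff1_less) auto
  finally show ?case by simp
qed simp

lemma tensor_act_F_Gm: "tensor_act n (F, i) lowest_tensor = 0" "tensor_act n (Gm, i) lowest_tensor = 0"
  by (simp_all add: tensor_act_def site_act_lowest fun_eq_iff)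

lemma tensor_act_H: "tensor_act n (H, i) lowest_tensor = tensor_scale (- (\<Sum>a<n. of_nat a ^ i)) lowest_tensor"
  by (simp add: tensor_act_def site_act_lowest fun_eq_iff tensor_scale_def sum_negf sum_distrib_right)

lemma tensor_E0_nilpotent: "(tensor_act n (E, 0) ^^ Suc n) lowest_tensor = 0"
proof
  fix \<sigma>
  have "card {a. a < n \<and> \<sigma> a = Hi} \<le> n"
    using card_mono[of "{..<n}" "{a. a < n \<and> \<sigma> a = Hi}"] by auto
  then show "(tensor_act n (E, 0) ^^ Suc n) lowest_tensor \<sigma> = 0 \<sigma>"
    using tensor_E0_power_support[where n = n and k = "Suc n" and \<sigma> = \<sigma>] by (auto simp del: funpow.simps)
qed

definition tensor_words :: "nat \<Rightarrow> tensor set" where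
  "tensor_words n = tensor.span {foldr (tensor_act n) u lowest_tensor | u. True}"

lemma tensor_words_act: "f \<in> tensor_words n \<Longrightarrow> tensor_act n x f \<in> tensor_words n"
proof -
  interpret M: osp_current_module tensor_scale "tensor_act n" by (rule tensor_act_module)
  assume f: "f \<in> tensor_words n"
  show ?thesis unfolding tensor_words_def
  proof (rule tensor.linear_on_span[OF M.act_linear tensor.subspace_span _ f[unfolded tensor_words_def]])
    fix g assume "g \<in> {foldr (tensor_act n) u lowest_tensor | u. True}"
    then obtain u where "tensor_act n x g = foldr (tensor_act n) (x # u) lowest_tensor" by auto
    then show "tensor_act n x g \<in> tensor.span {foldr (tensor_act n) u lowest_tensor | u. True}"
      by (intro tensor.span_base) blast
  qed
qed

text \<open>Since the evaluation points are distinct, Lagrange interpolation in \<open>t\<close> isolates the action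
  on a single tensor factor.\<close>

lemma tensor_words_site_act:
  assumes "f \<in> tensor_words n" "a < n"
  shows "site_act y a f \<in> tensor_words n"
proof -
  define L :: "complex poly" where "L = (\<Prod>b\<in>{..<n} - {a}. [:- of_nat b, 1:])"
  have "poly L (of_nat b) = 0" if "b < n" "b \<noteq> a" for b
    using that by (auto simp: L_def poly_prod)
  moreover have La: "poly L (of_nat a) \<noteq> 0"
    by (auto simp: L_def poly_prod)
  ultimately have "(\<Sum>b<n. poly L (of_nat b) * site_act y b f \<sigma>) = poly L (of_nat a) * site_act y a f \<sigma>" for \<sigma>
    using assms(2) by (subst sum.remove[of _ a]) auto
  moreover have "(\<Sum>i\<le>degree L. tensor_scale (coeff L i) (tensor_act n (y, i) f)) \<sigma>
      = (\<Sum>b<n. poly L (of_nat b) * site_act y b f \<sigma>)" for \<sigma>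
    unfolding poly_altdef sum_distrib_right
    by (subst sum.swap) (simp add: sum_apply_fun tensor_scale_def tensor_act_def sum_distrib_left mult.assoc)
  ultimately have "tensor_scale (poly L (of_nat a)) (site_act y a f)
    = (\<Sum>i\<le>degree L. tensor_scale (coeff L i) (tensor_act n (y, i) f))"
    by (simp add: fun_eq_iff tensor_scale_def)
  also have "\<dots> \<in> tensor_words n"
    using tensor_words_act[OF assms(1)] unfolding tensor_words_def
    by (intro tensor.span_sum tensor.span_scale)
  finally have "tensor_scale (poly L (of_nat a)) (site_act y a f) \<in> tensor_words n" .
  then show ?thesis
    using tensor.subspace_scale_cancel[OF _ La] by (auto simp: tensor_words_def)
qed

lemma site_act_Gp_pure_tensor:
  assumes "\<sigma> a \<noteq> Hi"
  shows "site_act Gp a (pure_tensor \<sigma>)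
    = tensor_scale (koszul Gp a \<sigma>) (pure_tensor (\<sigma>(a := (if \<sigma> a = Lo then Mid else Hi))))"
proof
  fix \<tau>
  have *: "\<tau>(a := q) = \<sigma> \<longleftrightarrow> q = \<sigma> a \<and> \<tau> = \<sigma>(a := \<tau> a)" for q by (auto simp: fun_eq_iff)
  have k: "koszul Gp a \<tau> = koszul Gp a \<sigma>" if "\<tau> = \<sigma>(a := \<tau> a)"
    using koszul_update_ge[of a a Gp \<sigma> "\<tau> a"] that by simp
  show "site_act Gp a (pure_tensor \<sigma>) \<tau>
    = tensor_scale (koszul Gp a \<sigma>) (pure_tensor (\<sigma>(a := (if \<sigma> a = Lo then Mid else Hi)))) \<tau>"
    using assms k
    by (cases "\<sigma> a"; cases "\<tau> a"; auto simp: site_act_def UNIV_site pure_tensor_def * tensor_scale_def)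
qed

text \<open>The sites are filled one after another, each being raised from \<open>Lo\<close> through
  \<open>Mid\<close> to \<open>Hi\<close> by \<open>Gp\<close> acting on that site alone.\<close>

lemma pure_tensor_in_words: "k \<le> n \<Longrightarrow> (\<And>a. a \<ge> k \<Longrightarrow> \<sigma> a = Lo) \<Longrightarrow> pure_tensor \<sigma> \<in> tensor_words n"
proof (induction k arbitrary: \<sigma>)
  case 0
  then have "\<sigma> = (\<lambda>_. Lo)" by auto
  moreover have "foldr (tensor_act n) [] lowest_tensor \<in> tensor_words n"
    unfolding tensor_words_def by (intro tensor.span_base) blast
  ultimately show ?case by simp
next
  case (Suc k)
  let ?\<sigma> = "\<lambda>s. \<sigma>(k := s)"
  have step: "pure_tensor (?\<sigma> (if s = Lo then Mid else Hi)) \<in> tensor_words n"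
    if "pure_tensor (?\<sigma> s) \<in> tensor_words n" "s \<noteq> Hi" for s
  proof -
    have "site_act Gp k (pure_tensor (?\<sigma> s)) \<in> tensor_words n"
      using that Suc.prems by (intro tensor_words_site_act) auto
    then have "tensor_scale (koszul Gp k (?\<sigma> s)) (pure_tensor (?\<sigma> (if s = Lo then Mid else Hi))) \<in> tensor_words n"
      using site_act_Gp_pure_tensor[of "?\<sigma> s" k] that(2) by simp
    moreover have "koszul Gp k (?\<sigma> s) \<noteq> 0" by (auto simp: koszul_def parity_def)
    ultimately show ?thesis
      using tensor.subspace_scale_cancel by (auto simp: tensor_words_def)
  qed
  have Lo: "pure_tensor (?\<sigma> Lo) \<in> tensor_words n"
    using Suc.prems by (intro Suc.IH) (auto simp: Suc_le_eq)
  have Mid: "pure_tensor (?\<sigma> Mid) \<in> tensor_words n" using step[OF Lo] by simp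
  have Hi: "pure_tensor (?\<sigma> Hi) \<in> tensor_words n" using step[OF Mid] by simp
  have "pure_tensor (?\<sigma> (\<sigma> k)) \<in> tensor_words n"
    using Lo Mid Hi by (cases "\<sigma> k") auto
  then show ?case by simp
qed

lemma card_configurations: "finite {\<sigma> :: nat \<Rightarrow> site. \<forall>a\<ge>n. \<sigma> a = Lo} \<and> card {\<sigma> :: nat \<Rightarrow> site. \<forall>a\<ge>n. \<sigma> a = Lo} = 3 ^ n"
proof (induction n)
  case 0
  have "{\<sigma> :: nat \<Rightarrow> site. \<forall>a\<ge>0. \<sigma> a = Lo} = {\<lambda>_. Lo}" by auto
  then show ?case by simp
next
  case (Suc n)
  let ?C = "\<lambda>n. {\<sigma> :: nat \<Rightarrow> site. \<forall>a\<ge>n. \<sigma> a = Lo}"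
  have "?C (Suc n) = (\<lambda>(\<sigma>, s). \<sigma>(n := s)) ` (?C n \<times> UNIV)"
  proof safe
    fix \<sigma> :: "nat \<Rightarrow> site" assume "\<forall>a\<ge>Suc n. \<sigma> a = Lo"
    then show "\<sigma> \<in> (\<lambda>(\<sigma>, s). \<sigma>(n := s)) ` (?C n \<times> UNIV)"
      by (intro image_eqI[of _ _ "(\<sigma>(n := Lo), \<sigma> n)"]) simp_all
  qed auto
  moreover have "inj_on (\<lambda>(\<sigma>, s). \<sigma>(n := s)) (?C n \<times> UNIV)"
  proof (rule inj_onI, clarsimp)
    fix \<sigma> \<tau> :: "nat \<Rightarrow> site" and s t assume *: "\<forall>a\<ge>n. \<sigma> a = Lo" "\<forall>a\<ge>n. \<tau> a = Lo" "\<sigma>(n := s) = \<tau>(n := t)"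
    then have "\<sigma> a = \<tau> a" for a by (cases "a = n") (auto simp: fun_eq_iff split: if_splits)
    then show "\<sigma> = \<tau> \<and> s = t" using fun_cong[OF *(3), of n] by auto
  qed
  ultimately show ?case
    using Suc by (simp add: card_image card_cartesian_product UNIV_site)
qed

lemma tensor_words_dimension:
  assumes "finite X" "tensor_words n \<subseteq> tensor.span X"
  shows "3 ^ n \<le> card X"
proof -
  let ?C = "{\<sigma> :: nat \<Rightarrow> site. \<forall>a\<ge>n. \<sigma> a = Lo}"
  have inj: "inj pure_tensor"
    by (rule injI) (metis pure_tensor_def zero_neq_one)
  have "tensor.independent (pure_tensor ` ?C)"
    unfolding tensor.dependent_def
  proof safe
    fix \<sigma>
    assume "pure_tensor \<sigma> \<in> tensor.span (pure_tensor ` ?C - {pure_tensor \<sigma>})"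
    also have "\<dots> \<subseteq> {f. f \<sigma> = 0}"
      by (rule tensor.span_minimal) (auto simp: tensor.subspace_def tensor_scale_def pure_tensor_def)
    finally show False by (simp add: pure_tensor_def)
  qed
  moreover have "pure_tensor ` ?C \<subseteq> tensor.span X"
    using pure_tensor_in_words[of n n] assms(2) by auto
  ultimately have "card (pure_tensor ` ?C) \<le> card X"
    using tensor.independent_span_bound[OF assms(1)] by blast
  then show ?thesis
    using card_configurations[of n] by (simp add: card_image inj_on_subset[OF inj])
qed


section \<open>Gradings and the character of the Weyl module\<close>

interpretation W: osp_current_module weyl_scale weyl_act by (rule weyl_sum_module)

fun osp_weight :: "osp \<Rightarrow> int" where
  "osp_weight E = 2"
| "osp_weight H = 0"
| "osp_weight F = -2"
| "osp_weight Gp = 1"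
| "osp_weight Gm = -1"

fun grade :: "weyl_word \<Rightarrow> nat \<times> int \<times> nat" where
  "grade (n, u) = (n, (\<Sum>x\<leftarrow>u. osp_weight (fst x)) - int n, \<Sum>x\<leftarrow>u. snd x)"

lift_definition word_part :: "nat \<times> int \<times> nat \<Rightarrow> (weyl_word \<Rightarrow>\<^sub>0 complex) \<Rightarrow> (weyl_word \<Rightarrow>\<^sub>0 complex)" is
  "\<lambda>c p k. if grade k = c then p k else 0"
  by (erule rev_finite_subset) auto

lemma word_part_linear: "Vector_Spaces.linear word_scale word_scale (word_part c)"
  by unfold_locales (auto intro!: poly_mapping_eqI simp: word_part.rep_eq lookup_add)

lemma word_part_single:
  "word_part c (Poly_Mapping.single k d) = (if grade k = c then Poly_Mapping.single k d else 0)"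
  by (rule poly_mapping_eqI) (auto simp: word_part.rep_eq lookup_single when_def)

lemma word_part_part: "word_part c (word_part d p) = (if c = d then word_part c p else 0)"
  by (rule poly_mapping_eqI) (auto simp: word_part.rep_eq)

lemma osp_bracket_weight: "osp_bracket y z c \<noteq> 0 \<Longrightarrow> osp_weight c = osp_weight y + osp_weight z"
  by (cases y; cases z; cases c; simp)

text \<open>All defining relations are homogeneous; this is what lets the projections descend to the
  quotient.\<close>

lemma word_part_relator:
  assumes "p \<in> weyl_relators"
  shows "word_part c p = p \<or> word_part c p = 0"
  using assms
proof cases
  interpret l: Vector_Spaces.linear word_scale word_scale "word_part c" by (rule word_part_linear)
  case (bracket n u y i z j v)
  let ?b = "grade (n, u @ [(y, i), (z, j)] @ v) = c"
  have "word_part c (\<Sum>x\<in>UNIV. Poly_Mapping.single (n, u @ [(x, i + j)] @ v) (osp_bracket y z x))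
    = (\<Sum>x\<in>UNIV. if ?b then Poly_Mapping.single (n, u @ [(x, i + j)] @ v) (osp_bracket y z x) else 0)"
    unfolding l.sum
  proof (rule sum.cong[OF refl])
    fix x
    show "word_part c (Poly_Mapping.single (n, u @ [(x, i + j)] @ v) (osp_bracket y z x))
      = (if ?b then Poly_Mapping.single (n, u @ [(x, i + j)] @ v) (osp_bracket y z x) else 0)"
    \<comment> \<open>Basis vectors of the wrong weight occur with coefficient 0, so their terms
      vanish on both sides.\<close>
    proof (cases "osp_bracket y z x = 0")
      case False
      then have "grade (n, u @ [(x, i + j)] @ v) = grade (n, u @ [(y, i), (z, j)] @ v)"
        by (simp add: osp_bracket_weight)
      then show ?thesis by (simp add: word_part_single del: grade.simps)
    qed simp
  qed
  moreover have "grade (n, u @ [(z, j), (y, i)] @ v) = grade (n, u @ [(y, i), (z, j)] @ v)"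
    by simp
  ultimately show ?thesis
    unfolding bracket by (simp add: l.diff word_part_single del: grade.simps)
next
  interpret l: Vector_Spaces.linear word_scale word_scale "word_part c" by (rule word_part_linear)
  case (weight n u)
  have "grade (n, u @ [(H, 0)]) = grade (n, u)" by simp
  then show ?thesis unfolding weight by (simp add: l.diff word_part_single del: grade.simps)
qed (auto simp: word_part_single simp del: grade.simps)

lift_definition weyl_part :: "nat \<times> int \<times> nat \<Rightarrow> weyl_sum \<Rightarrow> weyl_sum" is word_part
proof -
  fix c p q
  interpret l: Vector_Spaces.linear word_scale word_scale "word_part c" by (rule word_part_linear)
  assume "weyl_eq p q"
  then have "word_part c (p - q) \<in> word.span weyl_relators"
    unfolding weyl_eq_def
  proof (rule word.linear_on_span[OF word_part_linear word.subspace_span, rotated])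
    show "word_part c r \<in> word.span weyl_relators" if "r \<in> weyl_relators" for r
      using word_part_relator[OF that, of c] that by (auto intro: word.span_base word.span_zero)
  qed
  then show "weyl_eq (word_part c p) (word_part c q)"
    by (simp add: weyl_eq_def l.diff)
qed

lemma weyl_part_linear: "Vector_Spaces.linear weyl_scale weyl_scale (weyl_part c)"
proof unfold_locales
  have l: "word_part c (p + q) = word_part c p + word_part c q"
    "word_part c (word_scale d p) = word_scale d (word_part c p)" for c d p q
    by (auto intro!: poly_mapping_eqI simp: word_part.rep_eq lookup_add)
  show "weyl_part c (v + w) = weyl_part c v + weyl_part c w" for v w
    by transfer (simp only: l weyl_eq_refl)
  show "weyl_part c (weyl_scale d v) = weyl_scale d (weyl_part c v)" for d v
    by transfer (simp only: l weyl_eq_refl)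
qed

interpretation weyl_part: Vector_Spaces.linear weyl_scale weyl_scale "weyl_part c" for c
  by (rule weyl_part_linear)

lemma weyl_part_word:
  "weyl_part c (foldr weyl_act u (weyl_gen n)) = (if grade (n, u) = c then foldr weyl_act u (weyl_gen n) else 0)"
proof -
  have "weyl_part c (abs_weyl_sum (Poly_Mapping.single (n, u) 1))
    = abs_weyl_sum (if grade (n, u) = c then Poly_Mapping.single (n, u) 1 else 0)"
    by (simp only: weyl_part.abs_eq word_part_single)
  then show ?thesis
    by (simp add: weyl_abs_single zero_weyl_sum.abs_eq[symmetric] del: grade.simps split: if_splits)
qed

lemma weyl_part_part: "weyl_part c (weyl_part d v) = (if c = d then weyl_part c v else 0)"
  by transfer (simp add: word_part_part weyl_eq_refl)

lemma weyl_part_act: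
  "weyl_part (n, a + osp_weight y, s + i) (weyl_act (y, i) v) = weyl_act (y, i) (weyl_part (n, a, s) v)"
proof (induction v rule: weyl_induct)
  case (monomial m u d)
  have "grade (m, (y, i) # u) = (n, a + osp_weight y, s + i) \<longleftrightarrow> grade (m, u) = (n, a, s)" by auto
  then show ?case
    using weyl_part_word[of "(n, a + osp_weight y, s + i)" "(y, i) # u" m]
    by (simp add: W.act.scale weyl_part.scale weyl_part_word del: grade.simps)
qed (simp add: W.act.add weyl_part.add)

lemma weyl_act_H0_word:
  "weyl_act (H, 0) (foldr weyl_act u (weyl_gen n))
    = weyl_scale (of_int (fst (snd (grade (n, u))))) (foldr weyl_act u (weyl_gen n))"
proof (induction u)
  case Nil
  show ?case using W.w_relations(4)[OF weyl_gen_relations] by simp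
next
  case (Cons x u)
  obtain y i where x: "x = (y, i)" by fastforce
  let ?v = "foldr weyl_act u (weyl_gen n)"
  have "weyl_act (H, 0) (weyl_act (y, i) v)
    = weyl_act (y, i) (weyl_act (H, 0) v) + weyl_scale (of_int (osp_weight y)) (weyl_act (y, i) v)" for v
    using W.act_bracket[of H 0 y i v] by (cases y) (simp_all add: UNIV_osp osp_sign_def algebra_simps)
  then have "weyl_act (H, 0) (weyl_act (y, i) ?v)
    = weyl_scale (of_int (fst (snd (grade (n, u)))) + of_int (osp_weight y)) (weyl_act (y, i) ?v)"
    by (simp only: Cons.IH W.act.scale weyl.scale_left_distrib)
  then show ?case by (simp add: x algebra_simps)
qed

section \<open>Homogeneous components\<close>

definition weyl_homogeneous :: "nat \<times> int \<times> nat \<Rightarrow> weyl_sum set" where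
  "weyl_homogeneous c = {v. weyl_part c v = v}"

lemma subspace_weyl_homogeneous: "weyl.subspace (weyl_homogeneous c)"
  by (auto simp: weyl.subspace_def weyl_homogeneous_def weyl_part.add weyl_part.scale)

lemma weyl_homogeneous_act:
  "v \<in> weyl_homogeneous (n, a, s) \<Longrightarrow> weyl_act (y, i) v \<in> weyl_homogeneous (n, a + osp_weight y, s + i)"
  by (simp add: weyl_homogeneous_def weyl_part_act)

lemma weyl_gen_homogeneous: "weyl_gen n \<in> weyl_homogeneous (n, - int n, 0)"
  using weyl_part_word[of "(n, - int n, 0)" "[]" n] by (simp add: weyl_homogeneous_def)

lemma weyl_homogeneous_complete:
  assumes "v \<in> weyl_homogeneous (n, a, s)"
  shows "W.complete_sym k v \<in> weyl_homogeneous (n, a, s + k)"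
proof (induction k rule: less_induct)
  case (less k)
  show ?case
  proof (cases k)
    case (Suc l)
    have p: "weyl_scale (1 / 2) (weyl_act (H, Suc i) (W.complete_sym (l - i) v)) \<in> weyl_homogeneous (n, a, s + k)"
      if "i \<le> l" for i
      using weyl_homogeneous_act[OF less[of "l - i"], of H "Suc i"] that
        weyl.subspace_scale[OF subspace_weyl_homogeneous] by (simp add: Suc)
    show ?thesis
      unfolding Suc W.half_h.newton.simps(2)
      by (rule weyl.subspace_scale[OF subspace_weyl_homogeneous], rule weyl.subspace_sum[OF subspace_weyl_homogeneous])
        (use p Suc in simp)
  qed (use assms in simp)
qed

fun index_grade :: "nat \<Rightarrow> nat set \<times> nat \<times> nat list \<Rightarrow> nat \<times> int \<times> nat" where
  "index_grade n (S, r, \<mu>) = (n, int (card S) + 2 * int r - int n, \<Sum>S + sum_list \<mu>)"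

lemma basis_vector_homogeneous:
  assumes "x \<in> weyl_index n"
  shows "W.basis_vector (weyl_gen n) x \<in> weyl_homogeneous (index_grade n x)"
proof -
  obtain S r \<mu> where x: "x = (S, r, \<mu>)" and S: "S \<subseteq> {..<n}"
    using assms by (auto simp: weyl_index_def)
  have "finite S" using S finite_subset by blast
  have G: "W.gs I (weyl_gen n) \<in> weyl_homogeneous (n, int (length I) - int n, sum_list I)" for I
  proof (induction I)
    case (Cons i I)
    then show ?case using weyl_homogeneous_act[OF Cons, of Gp i] by (simp add: algebra_simps)
  qed (simp add: weyl_gen_homogeneous)
  have E: "W.e0s r v \<in> weyl_homogeneous (n, 2 * int r + a, s)" if "v \<in> weyl_homogeneous (n, a, s)" for v a s
  proof (induction r)
    case (Suc r)
    then show ?case using weyl_homogeneous_act[OF Suc, of E 0] by (simp add: algebra_simps)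
  qed (use that in simp)
  have C: "foldr W.complete_sym \<mu> v \<in> weyl_homogeneous (n, a, s + sum_list \<mu>)"
    if "v \<in> weyl_homogeneous (n, a, s)" for v a s
  proof (induction \<mu>)
    case (Cons k \<mu>)
    then show ?case using weyl_homogeneous_complete[OF Cons, of k] by (simp add: algebra_simps)
  qed (use that in simp)
  have "length (sorted_list_of_set S) = card S" "sum_list (sorted_list_of_set S) = \<Sum>S"
    using \<open>finite S\<close> sum_list_distinct_conv_sum_set[of "sorted_list_of_set S" "\<lambda>i. i"] by simp_all
  then show ?thesis
    using C[OF E[OF G[of "sorted_list_of_set S"]]] by (simp add: x algebra_simps)
qed

lemma box_partitions_finite_card: "finite (box_partitions r c) \<and> card (box_partitions r c) = (r + c) choose r"
proof (induction r c rule: box_partitions.induct)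
  case (3 r c)
  have "\<forall>\<mu>\<in>box_partitions r' c'. set \<mu> \<subseteq> {..c'}" for r' c'
    by (induction r' c' rule: box_partitions.induct) (auto simp: subset_iff intro: le_SucI)
  then have "box_partitions (Suc r) c \<inter> (#) (Suc c) ` box_partitions r (Suc c) = {}" by fastforce
  then show ?case
    using 3 by (simp add: card_Un_disjoint card_image)
qed simp_all

text \<open>For fixed \<open>S\<close> and m = n - |S|, the boxes of semiperimeter m hold 2^m
  partitions in total, a row sum of binomial coefficients. Summing over \<open>S\<close> expands (1
  + 2)^n.\<close>

lemma finite_weyl_index: "finite (weyl_index n)"
  and card_weyl_index: "card (weyl_index n) = 3 ^ n"
proof -
  let ?T = "\<lambda>S. SIGMA r:{..n - card S}. box_partitions r (n - card S - r)"
  have eq: "weyl_index n = (SIGMA S:Pow {..<n}. ?T S)" by (auto simp: weyl_index_def)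
  show "finite (weyl_index n)"
    unfolding eq by (intro finite_SigmaI) (auto simp: box_partitions_finite_card)
  have T: "card (SIGMA r:{..m}. box_partitions r (m - r)) = 2 ^ m" for m
    by (subst card_SigmaI) (auto simp: box_partitions_finite_card choose_row_sum[symmetric] intro!: sum.cong)
  have fin: "finite (?T S)" for S by (intro finite_SigmaI) (auto simp: box_partitions_finite_card)
  have "card (weyl_index n) = (\<Sum>S\<in>Pow {..<n}. card (?T S))"
    unfolding eq by (rule card_SigmaI) (simp, use fin in blast)
  also have "\<dots> = (\<Sum>S\<in>Pow {..<n}. 2 ^ (n - card S))"
    by (simp only: T)
  also have "\<dots> = (\<Sum>S\<in>Pow {..<n}. (\<Prod>i\<in>S. 1) * (\<Prod>i\<in>{..<n} - S. 2))"
    by (intro sum.cong refl) (auto simp: card_Diff_subset finite_subset)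
  also have "\<dots> = (\<Prod>i<n. 1 + 2)" by (rule prod_add[symmetric]) simp
  finally show "card (weyl_index n) = 3 ^ n" by (simp add: numeral_3_eq_3)
qed

text \<open>The evaluation does not factor through \<open>W\<^sub>-\<^sub>n\<close>: as \<open>h\<^sub>i\<close> acts on the generator of the tensor
  product by a scalar, a relator is only sent to words of smaller t-degree.\<close>

definition tensor_monomial :: "nat \<Rightarrow> weyl_word \<Rightarrow> tensor" where
  "tensor_monomial n k = (if fst k = n then foldr (tensor_act n) (snd k) lowest_tensor else 0)"

definition tensor_eval :: "nat \<Rightarrow> (weyl_word \<Rightarrow>\<^sub>0 complex) \<Rightarrow> tensor" where
  "tensor_eval n p = (\<Sum>k\<in>Poly_Mapping.keys p. tensor_scale (Poly_Mapping.lookup p k) (tensor_monomial n k))"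

lemma tensor_eval_sum:
  assumes "finite K" "Poly_Mapping.keys p \<subseteq> K"
  shows "tensor_eval n p = (\<Sum>k\<in>K. tensor_scale (Poly_Mapping.lookup p k) (tensor_monomial n k))"
  unfolding tensor_eval_def by (rule sum.mono_neutral_left) (use assms in \<open>auto simp: in_keys_iff\<close>)

lemma tensor_eval_linear: "Vector_Spaces.linear word_scale tensor_scale (tensor_eval n)"
proof unfold_locales
  fix p q :: "weyl_word \<Rightarrow>\<^sub>0 complex" and c
  let ?K = "Poly_Mapping.keys p \<union> Poly_Mapping.keys q"
  have "tensor_eval n (p + q) = (\<Sum>k\<in>?K. tensor_scale (Poly_Mapping.lookup (p + q) k) (tensor_monomial n k))"
    using keys_add[of p q] by (intro tensor_eval_sum) auto
  then show "tensor_eval n (p + q) = tensor_eval n p + tensor_eval n q"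
    by (simp add: tensor_eval_sum[of ?K] lookup_add tensor.scale_left_distrib sum.distrib)
  have "tensor_eval n (word_scale c p)
    = (\<Sum>k\<in>Poly_Mapping.keys p. tensor_scale (Poly_Mapping.lookup (word_scale c p) k) (tensor_monomial n k))"
    by (rule tensor_eval_sum) (auto simp: in_keys_iff)
  then show "tensor_eval n (word_scale c p) = tensor_scale c (tensor_eval n p)"
    by (simp add: tensor_eval_def tensor.scale_sum_right)
qed

interpretation tensor_eval: Vector_Spaces.linear word_scale tensor_scale "tensor_eval n" for n
  by (rule tensor_eval_linear)

lemma tensor_eval_single:
  "tensor_eval n (Poly_Mapping.single (m, u) c)
    = (if m = n then tensor_scale c (foldr (tensor_act n) u lowest_tensor) else 0)"
  by (simp add: tensor_eval_sum[of "{(m, u)}"] tensor_monomial_def)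

definition tensor_below :: "nat \<Rightarrow> nat \<Rightarrow> tensor set" where
  "tensor_below n s = tensor.span {foldr (tensor_act n) u lowest_tensor | u. (\<Sum>x\<leftarrow>u. snd x) < s}"

text \<open>All relators evaluate to 0 except \<open>u\<close> h_i w with i > 0, which becomes a
  scalar multiple of \<open>u\<close> applied to the lowest tensor, a word of smaller
  t-degree.\<close>

lemma tensor_eval_relator:
  assumes "p \<in> weyl_relators"
  shows "tensor_eval n (word_part (m, a, s) p) \<in> tensor_below n s"
proof -
  interpret T: osp_current_module tensor_scale "tensor_act n" by (rule tensor_act_module)
  let ?h = "\<lambda>u. foldr (tensor_act n) u"
  interpret h: Vector_Spaces.linear tensor_scale tensor_scale "?h u" for u
  proof (unfold_locales)
    show "?h u (f + g) = ?h u f + ?h u g" for f g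
      by (induction u) (simp_all only: foldr.simps o_apply id_apply T.act.add)
    show "?h u (tensor_scale c f) = tensor_scale c (?h u f)" for f c
      by (induction u) (simp_all only: foldr.simps o_apply id_apply T.act.scale)
  qed
  have 0: ?thesis if "tensor_eval n p = 0"
    using word_part_relator[OF assms, of "(m, a, s)"] that
    by (auto simp: tensor_below_def tensor.span_zero)
  show ?thesis
    using assms
  proof cases
    case (bracket n' u y i z j v)
    let ?m = "?h v lowest_tensor"
    have "tensor_act n (y, i) (tensor_act n (z, j) ?m)
        - tensor_scale (osp_sign y z) (tensor_act n (z, j) (tensor_act n (y, i) ?m))
        - (\<Sum>c\<in>UNIV. tensor_scale (osp_bracket y z c) (tensor_act n (c, i + j) ?m)) = 0"
      by (simp add: T.act_bracket)
    from arg_cong[OF this, of "?h u"] have "tensor_eval n p = 0"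
      unfolding bracket
      by (simp add: tensor_eval.diff tensor_eval.sum tensor_eval_single h.diff h.sum h.scale)
    then show ?thesis by (rule 0)
  next
    case (positive y i n' u)
    show ?thesis
    proof (cases "y = H")
      case True
      have "tensor_scale 1 (?h (u @ [(H, i)]) lowest_tensor)
        = tensor_scale (- (\<Sum>a<n. of_nat a ^ i)) (?h u lowest_tensor)"
        by (simp add: tensor_act_H h.scale h.neg)
      also have "\<dots> \<in> tensor_below n s" if "grade (n', u @ [(y, i)]) = (m, a, s)"
        unfolding tensor_below_def
        by (intro tensor.span_scale tensor.span_base CollectI exI[of _ u]) (use that positive(3) in auto)
      finally show ?thesis
        unfolding positive(1) True word_part_single
        by (auto simp: tensor_eval_single tensor_below_def tensor.span_zero True simp del: foldr_append grade.simps)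
    next
      case False
      then have "tensor_eval n p = 0"
        using positive by (auto simp: tensor_eval_single tensor_act_F_Gm)
      then show ?thesis by (rule 0)
    qed
  next
    case (lowering y n' u)
    then show ?thesis by (intro 0) (auto simp: tensor_eval_single tensor_act_F_Gm)
  next
    case (weight n' u)
    then show ?thesis by (intro 0) (simp add: tensor_eval.diff tensor_eval_single tensor_act_H h.scale h.neg)
  next
    case (integrable n' u)
    have "?h (replicate k (E, 0)) f = (tensor_act n (E, 0) ^^ k) f" for k f
      by (induction k) simp_all
    then show ?thesis
      unfolding integrable using tensor_E0_nilpotent[of n]
      by (intro 0[unfolded integrable]) (simp add: tensor_eval_single del: replicate_Suc funpow.simps)
  qed
qed

section \<open>The dimension of the Weyl module\<close>

lemma tensor_eval_span_relators:
  assumes "p \<in> word.span weyl_relators"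
  shows "tensor_eval n (word_part (m, a, s) p) \<in> tensor_below n s"
proof -
  interpret l: Vector_Spaces.linear word_scale word_scale "word_part c" for c by (rule word_part_linear)
  have "word.subspace {p. tensor_eval n (word_part (m, a, s) p) \<in> tensor_below n s}"
    by (auto simp: word.subspace_def l.add l.scale tensor_eval.add tensor_eval.scale tensor_below_def
        tensor.span_zero tensor.span_add tensor.span_scale)
  from word.span_induct[OF assms this] show ?thesis using tensor_eval_relator by auto
qed

text \<open>The passage to the associated graded module, in explicit form. The spanning vectors are
  lifted to homogeneous formal expressions and evaluated. By induction on the t-degree their images
  span all tensor words: a word and its homogeneous expansion differ by relators of the same degree,
  which evaluate to lower degree.\<close>

lemma card_spanning_index:
  assumes X: "X \<subseteq> weyl_index n"
    and span: "\<And>u. foldr weyl_act u (weyl_gen n) \<in> weyl.span (W.basis_vector (weyl_gen n) ` X)"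
  shows "3 ^ n \<le> card X"
proof -
  interpret l: Vector_Spaces.linear word_scale word_scale "word_part c" for c by (rule word_part_linear)
  interpret abs: Vector_Spaces.linear word_scale weyl_scale abs_weyl_sum by (rule weyl_abs_linear)
  let ?b = "W.basis_vector (weyl_gen n)"
  have "\<exists>p. abs_weyl_sum p = ?b x \<and> word_part (index_grade n x) p = p" if "x \<in> X" for x
  proof -
    obtain q where q: "?b x = abs_weyl_sum q" by (metis Quotient3_abs_rep Quotient3_weyl_sum)
    have "weyl_part (index_grade n x) (?b x) = ?b x"
      using basis_vector_homogeneous[of x n] X that unfolding weyl_homogeneous_def by blast
    then have "abs_weyl_sum (word_part (index_grade n x) q) = ?b x"
      unfolding q by (simp only: weyl_part.abs_eq)
    then show ?thesis by (intro exI[of _ "word_part (index_grade n x) q"]) (simp add: word_part_part)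
  qed
  then obtain P where P: "\<And>x. x \<in> X \<Longrightarrow> abs_weyl_sum (P x) = ?b x"
    "\<And>x. x \<in> X \<Longrightarrow> word_part (index_grade n x) (P x) = P x" by metis
  let ?T = "tensor.span ((\<lambda>x. tensor_eval n (P x)) ` X)"
  have "foldr (tensor_act n) u lowest_tensor \<in> ?T" for u
  proof (induction "\<Sum>x\<leftarrow>u. snd x" arbitrary: u rule: less_induct)
    case less
    define c where "c = grade (n, u)"
    \<comment> \<open>Vectors whose component of grade \<open>c\<close> has a homogeneous lift that
      evaluates into \<open>?T\<close>. This subspace contains the chosen basis vectors, hence the
      word \<open>u\<close> applied to the generator.\<close>
    let ?Q = "{v. \<exists>p. abs_weyl_sum p = weyl_part c v \<and> word_part c p = p \<and> tensor_eval n p \<in> ?T}"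
    have "weyl.subspace ?Q"
      unfolding weyl.subspace_def
    proof (safe)
      show "\<exists>p. abs_weyl_sum p = weyl_part c 0 \<and> word_part c p = p \<and> tensor_eval n p \<in> ?T"
        by (intro exI[of _ 0]) (simp add: tensor.span_zero abs.zero weyl_part.zero l.zero tensor_eval.zero)
    next
      fix v w p q
      assume "abs_weyl_sum p = weyl_part c v" "word_part c p = p" "tensor_eval n p \<in> ?T"
       "abs_weyl_sum q = weyl_part c w" "word_part c q = q" "tensor_eval n q \<in> ?T"
      then show "\<exists>p. abs_weyl_sum p = weyl_part c (v + w) \<and> word_part c p = p \<and> tensor_eval n p \<in> ?T"
        by (intro exI[of _ "p + q"]) (simp add: abs.add weyl_part.add l.add tensor_eval.add tensor.span_add)
    next
      fix d v p
      assume "abs_weyl_sum p = weyl_part c v" "word_part c p = p" "tensor_eval n p \<in> ?T"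
      then show "\<exists>p. abs_weyl_sum p = weyl_part c (weyl_scale d v) \<and> word_part c p = p \<and> tensor_eval n p \<in> ?T"
        by (intro exI[of _ "word_scale d p"]) (simp add: abs.scale weyl_part.scale l.scale tensor_eval.scale tensor.span_scale)
    qed
    moreover have "?b ` X \<subseteq> ?Q"
    proof safe
      fix x assume x: "x \<in> X"
      have h: "weyl_part (index_grade n x) (?b x) = ?b x"
        using basis_vector_homogeneous[of x n] X x unfolding weyl_homogeneous_def by blast
      have b: "weyl_part c (?b x) = weyl_part c (weyl_part (index_grade n x) (?b x))"
        by (simp only: h)
      show "\<exists>p. abs_weyl_sum p = weyl_part c (?b x) \<and> word_part c p = p \<and> tensor_eval n p \<in> ?T"
      proof (cases "index_grade n x = c")
        case True
        have "tensor_eval n (P x) \<in> ?T" by (rule tensor.span_base) (use x in blast)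
        then show ?thesis using P[OF x] True h by (intro exI[of _ "P x"]) simp
      next
        case False
        then have "weyl_part c (?b x) = 0"
          using weyl_part_part[of c "index_grade n x" "?b x"] b by simp
        then show ?thesis
          by (intro exI[of _ 0]) (simp add: tensor.span_zero abs.zero l.zero tensor_eval.zero)
      qed
    qed
    ultimately have "foldr weyl_act u (weyl_gen n) \<in> ?Q"
      using span[of u] weyl.span_minimal by blast
    then obtain p where p: "abs_weyl_sum p = foldr weyl_act u (weyl_gen n)" "word_part c p = p" "tensor_eval n p \<in> ?T"
      by (auto simp: weyl_part_word c_def simp del: grade.simps)
    let ?w = "Poly_Mapping.single (n, u) 1 :: weyl_word \<Rightarrow>\<^sub>0 complex"
    have "abs_weyl_sum (?w - p) = abs_weyl_sum 0" by (simp add: abs.diff abs.zero weyl_abs_single p)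
    then have "weyl_eq (?w - p) 0" by (simp only: weyl_sum.abs_eq_iff)
    then have "?w - p \<in> word.span weyl_relators" by (simp only: weyl_eq_def diff_zero)
    then have "tensor_eval n (word_part c (?w - p)) \<in> tensor_below n (\<Sum>x\<leftarrow>u. snd x)"
      unfolding c_def grade.simps by (rule tensor_eval_span_relators)
    also have "\<dots> \<subseteq> ?T"
      unfolding tensor_below_def by (rule tensor.span_minimal) (use less in auto)
    also have "word_part c (?w - p) = ?w - p" by (simp add: l.diff p(2) word_part_single c_def[symmetric] del: grade.simps)
    finally have "tensor_eval n (?w - p) + tensor_eval n p \<in> ?T" using p(3) by (intro tensor.span_add)
    then show ?case by (simp add: tensor_eval.diff tensor_eval_single)
  qed
  then have "tensor_words n \<subseteq> ?T"
    unfolding tensor_words_def by (intro tensor.span_minimal) auto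
  moreover have "finite X" using X finite_weyl_index finite_subset by blast
  ultimately have "3 ^ n \<le> card ((\<lambda>x. tensor_eval n (P x)) ` X)"
    by (intro tensor_words_dimension) auto
  also have "\<dots> \<le> card X" using \<open>finite X\<close> by (rule card_image_le)
  finally show ?thesis .
qed

text \<open>The two bounds meet: a maximal independent subfamily still spans, so it needs
  \<open>3 ^ n\<close> indices, and there are no more than that.\<close>

lemma basis_vectors_independent:
  "inj_on (W.basis_vector (weyl_gen n)) (weyl_index n)"
  "weyl.independent (W.basis_vector (weyl_gen n) ` weyl_index n)"
proof -
  let ?b = "W.basis_vector (weyl_gen n)"
  obtain B where B: "B \<subseteq> ?b ` weyl_index n" "weyl.independent B" "?b ` weyl_index n \<subseteq> weyl.span B"
    using weyl.maximal_independent_subset by blast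
  then obtain X where X: "X \<subseteq> weyl_index n" "inj_on ?b X" "B = ?b ` X"
    by (auto simp: subset_image_inj)
  have "foldr weyl_act u (weyl_gen n) \<in> weyl.span (?b ` X)" for u
    using W.word_in_span_basis[OF weyl_gen_relations] weyl.span_minimal[OF B(3) weyl.subspace_span] X(3) by blast
  then have "3 ^ n \<le> card X" using X(1) by (intro card_spanning_index)
  then have "X = weyl_index n"
    using card_weyl_index finite_weyl_index X(1) by (intro card_seteq) auto
  then show "inj_on ?b (weyl_index n)" "weyl.independent (?b ` weyl_index n)"
    using X B by auto
qed

section \<open>The character\<close>

lemma weyl_part_decomposition: "\<exists>K. finite K \<and> (\<forall>K'. finite K' \<longrightarrow> K \<subseteq> K' \<longrightarrow> (\<Sum>c\<in>K'. weyl_part c v) = v)"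
proof (induction v rule: weyl_induct)
  case (monomial n u d)
  have "(\<Sum>c\<in>K'. weyl_part c (weyl_scale d (foldr weyl_act u (weyl_gen n)))) = weyl_scale d (foldr weyl_act u (weyl_gen n))"
    if "finite K'" "{grade (n, u)} \<subseteq> K'" for K'
    using that by (simp add: weyl_part.scale weyl_part_word if_distrib sum.delta' cong: if_cong del: grade.simps)
  then show ?case by (intro exI[of _ "{grade (n, u)}"]) blast
next
  case (add v w)
  then obtain K L where "finite K" "finite L"
    "\<forall>K'. finite K' \<longrightarrow> K \<subseteq> K' \<longrightarrow> (\<Sum>c\<in>K'. weyl_part c v) = v"
    "\<forall>K'. finite K' \<longrightarrow> L \<subseteq> K' \<longrightarrow> (\<Sum>c\<in>K'. weyl_part c w) = w" by blast
  \<comment> \<open>Quantifying over all finite supersets allows the two sets of grades to be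
    merged.\<close>
  then show ?case
    by (intro exI[of _ "K \<union> L"]) (simp add: weyl_part.add sum.distrib)
qed

text \<open>The eigenspace that defines the character is the image of \<open>weyl_part\<close> at
  grade \<open>(n, a, s)\<close>, and every basis vector has a single grade.\<close>

lemma weyl_ch_eq_card:
  "weyl_ch n a s = int (card {x \<in> weyl_index n. index_grade n x = (n, a, s)})"
proof -
  let ?b = "W.basis_vector (weyl_gen n)"
  let ?X = "{x \<in> weyl_index n. index_grade n x = (n, a, s)}"
  let ?V = "{v \<in> weyl_degree n s. weyl_act (H, 0) v = weyl_scale (of_int a) v}"
  let ?c = "(n, a, s)"
  have H0: "weyl_act (H, 0) (weyl_part (m, a', s') v) = weyl_scale (of_int a') (weyl_part (m, a', s') v)" for m a' s' v
  proof (induction v rule: weyl_induct)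
    case (monomial m' u d)
    show ?case
      using weyl_act_H0_word[of u m']
      by (cases "grade (m', u) = (m, a', s')")
        (simp_all add: weyl_part.scale weyl_part_word W.act.scale mult.commute del: grade.simps)
  qed (simp add: weyl_part.add W.act.add weyl.scale_right_distrib)
  have part_V: "weyl_part ?c v \<in> ?V" for v
  proof -
    have "weyl_part ?c v \<in> weyl_degree n s"
    proof (induction v rule: weyl_induct)
      case (monomial m u d)
      show ?case
        unfolding weyl_part.scale weyl_part_word weyl_degree_def
        by (rule weyl.span_scale, cases "grade (m, u) = ?c") (auto simp: weyl.span_zero intro: weyl.span_base)
    qed (auto simp: weyl_part.add weyl_degree_def weyl.span_add)
    then show ?thesis using H0 by simp
  qed
  have V_part: "weyl_part ?c v = v" if v: "v \<in> ?V" for v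
  proof -
    \<comment> \<open>A component of another weight would have two different h_0-eigenvalues;
      components of another generator or degree vanish on \<open>weyl_degree n s\<close>.\<close>
    have zero: "weyl_part (m, a', s') v = 0" if "(m, a', s') \<noteq> ?c" for m a' s'
    proof (cases "m = n \<and> s' = s")
      case True
      have "weyl_scale (of_int a') (weyl_part (m, a', s') v) = weyl_part (m, a', s') (weyl_act (H, 0) v)"
        using weyl_part_act[of m a' H s' 0 v] by (simp add: H0)
      also have "\<dots> = weyl_scale (of_int a) (weyl_part (m, a', s') v)"
        using v by (simp add: weyl_part.scale)
      finally show ?thesis using that True by simp
    next
      case False
      have "v \<in> weyl.span {foldr weyl_act u (weyl_gen n) | u. (\<Sum>x\<leftarrow>u. snd x) = s}"
        using v by (simp add: weyl_degree_def)
      then have "weyl_part (m, a', s') v \<in> {0}"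
        by (rule weyl.linear_on_span[OF weyl_part_linear weyl.subspace_single_0, rotated])
          (use False in \<open>auto simp: weyl_part_word\<close>)
      then show ?thesis by simp
    qed
    obtain K where K: "finite K" "\<And>K'. finite K' \<Longrightarrow> K \<subseteq> K' \<Longrightarrow> (\<Sum>c\<in>K'. weyl_part c v) = v"
      using weyl_part_decomposition by blast
    have "v = (\<Sum>c\<in>insert ?c K. weyl_part c v)"
      using K(1) by (intro K(2)[symmetric]) auto
    also have "\<dots> = (\<Sum>c\<in>{?c}. weyl_part c v)"
      using K(1) zero by (intro sum.mono_neutral_right) auto
    finally show ?thesis by simp
  qed
  have part_b: "weyl_part ?c (?b x) = (if index_grade n x = ?c then ?b x else 0)" if "x \<in> weyl_index n" for x
    using basis_vector_homogeneous[OF that] weyl_part_part[of ?c "index_grade n x" "?b x"]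
    by (auto simp: weyl_homogeneous_def)
  have "weyl.dim ?V = card (?b ` ?X)"
  proof (rule weyl.dim_unique)
    show "?b ` ?X \<subseteq> ?V"
    proof
      fix v assume "v \<in> ?b ` ?X"
      then have "weyl_part ?c v = v" using part_b by auto
      then show "v \<in> ?V" using part_V[of v] by simp
    qed
    show "?V \<subseteq> weyl.span (?b ` ?X)"
    proof
      fix v assume v: "v \<in> ?V"
      have "weyl_degree n s \<subseteq> weyl.span (?b ` weyl_index n)"
        unfolding weyl_degree_def
        by (rule weyl.span_minimal) (use W.word_in_span_basis[OF weyl_gen_relations] in auto)
      then have v': "v \<in> weyl.span (?b ` weyl_index n)" using v by blast
      have "weyl_part ?c v \<in> weyl.span (?b ` ?X)"
      proof (rule weyl.linear_on_span[OF weyl_part_linear weyl.subspace_span _ v'])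
        fix y assume "y \<in> ?b ` weyl_index n"
        then obtain x where x: "y = ?b x" "x \<in> weyl_index n" by blast
        show "weyl_part ?c y \<in> weyl.span (?b ` ?X)"
          unfolding x(1) part_b[OF x(2)] using x(2)
          by (cases "index_grade n x = ?c") (simp_all add: weyl.span_zero weyl.span_base)
      qed
      then show "v \<in> weyl.span (?b ` ?X)" using V_part[OF v] by simp
    qed
    show "weyl.independent (?b ` ?X)"
      by (rule weyl.independent_mono[OF basis_vectors_independent(2)]) auto
  qed simp
  also have "\<dots> = card ?X"
    by (rule card_image, rule inj_on_subset[OF basis_vectors_independent(1)]) auto
  finally show ?thesis by (simp add: weyl_ch_def)
qed


section \<open>Strict partitions and the limit\<close>

unbundle no vec_syntax
unbundle fps_syntax

section \<open>Finite sets of natural numbers and their generating functions\<close>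

lemma card_square_le_sum:
  fixes P :: "nat set"
  assumes "finite P"
  shows "card P * card P \<le> 2 * \<Sum>P + card P"
  using assms
proof (induction P rule: finite_linorder_max_induct)
  case (insert b A)
  then have "card A \<le> b" "b \<notin> A"
    using card_mono[of "{..<b}" A] by auto
  then show ?case using insert by simp
qed simp

definition sets_of_sum :: "nat \<Rightarrow> nat set set" where
  "sets_of_sum b = {P. finite P \<and> \<Sum>P = b}"

lemma finite_sets_of_sum [simp]: "finite (sets_of_sum b)"
proof (rule finite_subset)
  show "sets_of_sum b \<subseteq> Pow {..b}" by (auto simp: sets_of_sum_def intro: member_le_sum)
qed simp

text \<open>In closed form q^(m(m-1)/2) / ((1 - q) ... (1 - q^m)). The element 0 is allowed, as the
  products start at \<open>i = 0\<close>.\<close>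

definition strict_partitions :: "nat \<Rightarrow> int fps" where
  "strict_partitions m = Abs_fps (\<lambda>b. int (card {P \<in> sets_of_sum b. card P = m}))"

lemma strict_partitions_nth:
  "strict_partitions m $ b = int (card {P. finite P \<and> card P = m \<and> \<Sum>P = b})"
  by (simp add: strict_partitions_def sets_of_sum_def conj_ac)

lemma strict_partitions_0: "strict_partitions 0 = 1"
proof (rule fps_ext)
  fix b
  have "{P :: nat set. finite P \<and> card P = 0 \<and> \<Sum>P = b} = (if b = 0 then {{}} else {})" by auto
  then show "strict_partitions 0 $ b = 1 $ b" by (simp add: strict_partitions_nth)
qed

text \<open>The two summands count the sets without 0 and with 0; in both cases the positive elements are
  lowered by 1.\<close>

lemma strict_partitions_Suc:
  "strict_partitions (Suc m) = fps_X ^ Suc m * strict_partitions (Suc m) + fps_X ^ m * strict_partitions m"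
proof (rule fps_ext)
  fix b
  let ?A = "\<lambda>m b. {P :: nat set. finite P \<and> card P = m \<and> \<Sum>P = b}"
  let ?U = "if b < Suc m then {} else (`) Suc ` ?A (Suc m) (b - Suc m)"
  let ?V = "if b < m then {} else (\<lambda>P. insert 0 (Suc ` P)) ` ?A m (b - m)"
  have sum_Suc: "\<Sum>(Suc ` P) = \<Sum>P + card P" for P
    by (simp add: sum.reindex sum_Suc)
  have "?A (Suc m) b = ?U \<union> ?V"
  proof (intro equalityI subsetI)
    fix P assume "P \<in> ?A (Suc m) b"
    then have P: "finite P" "card P = Suc m" "b = \<Sum>P" by auto
    define Q where "Q = (\<lambda>x. x - 1) ` (P - {0})"
    have Q: "Suc ` Q = P - {0}" by (force simp: Q_def image_image)
    have fin: "finite Q" using P by (simp add: Q_def)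
    have cQ: "card Q = card (P - {0})" using card_image[of Suc Q] Q by simp
    have sQ: "\<Sum>P = \<Sum>Q + card Q"
      using sum_Suc[of Q] sum_diff1_nat[of "\<lambda>x. x" P 0] unfolding Q by (simp split: if_splits)
    show "P \<in> ?U \<union> ?V"
    proof (cases "0 \<in> P")
      case True
      then have "P = insert 0 (Suc ` Q)" "card Q = m" using Q cQ P by auto
      then show ?thesis using sQ P fin by auto
    next
      case False
      then have "P = Suc ` Q" "card Q = Suc m" using Q cQ P by auto
      then show ?thesis using sQ P fin by auto
    qed
  next
    fix P assume "P \<in> ?U \<union> ?V"
    then consider Q where "Suc m \<le> b" "P = Suc ` Q" "finite Q" "card Q = Suc m" "\<Sum>Q = b - Suc m"
      | Q where "m \<le> b" "P = insert 0 (Suc ` Q)" "finite Q" "card Q = m" "\<Sum>Q = b - m"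
      by (auto simp: not_less split: if_splits)
    then show "P \<in> ?A (Suc m) b"
      by cases (simp_all add: sum_Suc card_image card_insert_if image_iff)
  qed
  moreover have "?U \<inter> ?V = {}" by auto
  moreover have "finite (?A k c)" for k c
    by (rule finite_subset[OF _ finite_sets_of_sum[of c]]) (auto simp: sets_of_sum_def)
  moreover have "inj_on (\<lambda>P. insert 0 (Suc ` P)) X" for X :: "nat set set"
    by (rule inj_onI) (metis (no_types, lifting) Diff_insert_absorb image_iff inj_Suc inj_image_eq_iff nat.distinct(1))
  moreover have "inj_on ((`) Suc) X" for X by (rule inj_onI) (simp add: inj_image_eq_iff)
  ultimately have "card (?A (Suc m) b) = (if b < Suc m then 0 else card (?A (Suc m) (b - Suc m)))
    + (if b < m then 0 else card (?A m (b - m)))"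
    by (simp add: card_Un_disjoint card_image)
  then show "strict_partitions (Suc m) $ b
    = (fps_X ^ Suc m * strict_partitions (Suc m) + fps_X ^ m * strict_partitions m) $ b"
    by (simp add: fps_X_power_mult_nth strict_partitions_nth del: power_Suc)
qed

section \<open>Partitions in a box and the q-Pascal recursion\<close>

lemma sum_box_partitions_le: "\<mu> \<in> box_partitions r c \<Longrightarrow> sum_list \<mu> \<le> r * c"
proof (induction r c arbitrary: \<mu> rule: box_partitions.induct)
  case (3 r c)
  from 3(3) consider "\<mu> \<in> box_partitions (Suc r) c" | \<nu> where "\<mu> = Suc c # \<nu>" "\<nu> \<in> box_partitions r (Suc c)"
    by auto
  then show ?case
  proof cases
    case 1
    then show ?thesis using 3(1)[of \<mu>] by simp
  next
    case 2
    then show ?thesis using 3(2)[of \<nu>] by simp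
  qed
qed simp_all

text \<open>The Gaussian binomial coefficient of r + c over r, weighted by the complement of the
  partition in its box because the size of the partition enters the limit with a negative
  sign.\<close>

definition complementary_box :: "nat \<Rightarrow> nat \<Rightarrow> int fps" where
  "complementary_box r c = (\<Sum>\<mu>\<in>box_partitions r c. fps_X ^ (r * c - sum_list \<mu>))"

lemma complementary_box_Suc:
  "complementary_box (Suc r) (Suc c)
    = fps_X ^ Suc r * complementary_box (Suc r) c + complementary_box r (Suc c)"
proof -
  have "\<forall>\<mu>\<in>box_partitions r' c'. \<forall>i\<in>set \<mu>. i \<le> c'" for r' c'
    by (induction r' c' rule: box_partitions.induct) (auto intro: le_SucI)
  then have disj: "box_partitions (Suc r) c \<inter> (#) (Suc c) ` box_partitions r (Suc c) = {}" by fastforce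
  have "(\<Sum>\<mu>\<in>box_partitions (Suc r) c. fps_X ^ (Suc r * Suc c - sum_list \<mu>))
    = (fps_X ^ Suc r * complementary_box (Suc r) c :: int fps)"
    unfolding complementary_box_def sum_distrib_left
  proof (rule sum.cong[OF refl])
    fix \<mu> assume "\<mu> \<in> box_partitions (Suc r) c"
    then have "Suc r * Suc c - sum_list \<mu> = Suc r + (Suc r * c - sum_list \<mu>)"
      using sum_box_partitions_le[of \<mu> "Suc r" c] by simp
    then show "fps_X ^ (Suc r * Suc c - sum_list \<mu>) = (fps_X ^ Suc r * fps_X ^ (Suc r * c - sum_list \<mu>) :: int fps)"
      by (simp only: power_add)
  qed
  moreover have "(\<Sum>\<mu>\<in>(#) (Suc c) ` box_partitions r (Suc c). fps_X ^ (Suc r * Suc c - sum_list \<mu>))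
    = complementary_box r (Suc c)"
    unfolding complementary_box_def by (subst sum.reindex) simp_all
  ultimately show ?thesis
    by (simp add: complementary_box_def[of "Suc r" "Suc c"] sum.union_disjoint disj box_partitions_finite_card del: mult_Suc mult_Suc_right)
qed

text \<open>In closed form both sides are q^((r+c)(r+c-1)/2) / ((q)_r (q)_c). The induction
  multiplies by 1 - q^(R+C), applies the recursions of \<open>strict_partitions\<close> and
  \<open>complementary_box\<close>, and cancels that factor.\<close>

lemma strict_partitions_mult:
  "fps_X ^ (r * c) * strict_partitions r * strict_partitions c = strict_partitions (r + c) * complementary_box r c"
proof (induction r c rule: box_partitions.induct)
  case (3 r c)
  let ?K = strict_partitions and ?X = "fps_X :: int fps"
  define R C where "R = Suc r" and "C = Suc c"
  have rec: "?X ^ m * ?K m = (1 - ?X ^ Suc m) * ?K (Suc m)" for m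
    using strict_partitions_Suc[of m] by (simp add: algebra_simps)
  have "(1 - ?X ^ (R + C)) * (?K (R + C) * complementary_box R C)
    = ?X ^ (r + C) * ?K (r + C) * (?X ^ R * complementary_box R c + complementary_box r C)"
    using rec[of "r + C"] complementary_box_Suc[of r c] by (simp add: R_def C_def mult_ac)
  also have "\<dots> = ?X ^ (r + C) * (?X ^ R * (?K (R + c) * complementary_box R c) + ?K (r + C) * complementary_box r C)"
    by (simp add: algebra_simps R_def C_def)
  also have "\<dots> = ?X ^ (r + C) * (?X ^ R * (?X ^ (R * c) * ?K R * ?K c) + ?X ^ (r * C) * ?K r * ?K C)"
    using 3 by (simp only: R_def C_def)
  also have "\<dots> = ?X ^ (R * C) * (?X ^ R * ?K R * (?X ^ c * ?K c) + ?K C * (?X ^ r * ?K r))"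
    by (simp add: algebra_simps R_def C_def power_add)
  also have "\<dots> = ?X ^ (R * C) * (?X ^ R * ?K R * ((1 - ?X ^ C) * ?K C) + ?K C * ((1 - ?X ^ R) * ?K R))"
    unfolding rec R_def C_def ..
  also have "\<dots> = (1 - ?X ^ (R + C)) * (?X ^ (R * C) * ?K R * ?K C)"
    by (simp add: algebra_simps power_add)
  finally have "?K (R + C) * complementary_box R C = ?X ^ (R * C) * ?K R * ?K C"
  proof (rule mult_left_cancel[THEN iffD1, rotated])
    have "(1 - ?X ^ (R + C)) $ 0 = 1" by (simp add: R_def)
    then show "1 - ?X ^ (R + C) \<noteq> 0" by (metis fps_zero_nth zero_neq_one)
  qed
  then show ?case by (simp only: R_def C_def)
qed (simp_all add: strict_partitions_0 complementary_box_def)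

text \<open>The coefficient of q^(b + r c) in the preceding identity; the shift by
  \<open>r * c\<close> turns the complement's size back into \<open>sum_list \<mu>\<close>.\<close>

lemma strict_partitions_mult_nth:
  "(strict_partitions r * strict_partitions c) $ b
    = int (card {(J, \<mu>). finite J \<and> card J = r + c \<and> \<mu> \<in> box_partitions r c \<and> \<Sum>J = b + sum_list \<mu>})"
proof -
  let ?A = "\<lambda>b. {J :: nat set. finite J \<and> card J = r + c \<and> \<Sum>J = b}"
  have fin: "finite (?A b)" for b
    by (rule finite_subset[OF _ finite_sets_of_sum[of b]]) (auto simp: sets_of_sum_def)
  have "(strict_partitions r * strict_partitions c) $ b
    = (fps_X ^ (r * c) * strict_partitions r * strict_partitions c) $ (b + r * c)"
    by (simp add: mult.assoc fps_X_power_mult_nth)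
  also have "\<dots> = (\<Sum>\<mu>\<in>box_partitions r c. (strict_partitions (r + c) * fps_X ^ (r * c - sum_list \<mu>)) $ (b + r * c))"
    unfolding strict_partitions_mult complementary_box_def sum_distrib_left fps_sum_nth ..
  also have "\<dots> = (\<Sum>\<mu>\<in>box_partitions r c. int (card (?A (b + sum_list \<mu>))))"
  proof (rule sum.cong[OF refl])
    fix \<mu> assume "\<mu> \<in> box_partitions r c"
    then have "sum_list \<mu> \<le> r * c" by (rule sum_box_partitions_le)
    then show "(strict_partitions (r + c) * fps_X ^ (r * c - sum_list \<mu>)) $ (b + r * c) = int (card (?A (b + sum_list \<mu>)))"
      by (simp add: fps_X_power_mult_right_nth strict_partitions_nth)
  qed
  also have "\<dots> = int (card (SIGMA \<mu>:box_partitions r c. ?A (b + sum_list \<mu>)))"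
    by (subst card_SigmaI) (auto simp: fin box_partitions_finite_card)
  also have "card (SIGMA \<mu>:box_partitions r c. ?A (b + sum_list \<mu>))
    = card {(J, \<mu>). finite J \<and> card J = r + c \<and> \<mu> \<in> box_partitions r c \<and> \<Sum>J = b + sum_list \<mu>}"
    by (rule bij_betw_same_card[of "\<lambda>(\<mu>, J). (J, \<mu>)"])
      (auto simp: bij_betw_def inj_on_def image_iff)
  finally show ?thesis .
qed

section \<open>The index set of the limit\<close>

definition limit_index :: "int \<Rightarrow> int \<Rightarrow> (nat set \<times> nat \<times> nat list) set" where
  "limit_index a b = {(J, r, \<mu>). finite J \<and> r \<le> card J \<and> \<mu> \<in> box_partitions r (card J - r)
    \<and> 2 * int r - int (card J) = a \<and> int (\<Sum>J) = b + int (sum_list \<mu>)}"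

text \<open>Complementation of \<open>S\<close> in \<open>{..<n}\<close> accounts for the substitution \<open>q \<rightarrow> q^(-1)\<close> and the factor
  \<open>q^(n(n-1)/2)\<close>.\<close>

lemma weyl_ch_normalized_eq_card:
  "weyl_ch_normalized n a b = int (card {(J, r, \<mu>) \<in> limit_index a b. J \<subseteq> {..<n}})"
proof -
  let ?X = "{x \<in> weyl_index n. case index_grade n x of (m, a', s) \<Rightarrow> a' = a \<and> int s = int (n * (n - 1) div 2) - b}"
  let ?Y = "{(J, r, \<mu>) \<in> limit_index a b. J \<subseteq> {..<n}}"
  have total: "\<Sum>{..<n} = n * (n - 1) div 2"
    using Sum_Ico_nat[of 0 n] by (simp add: lessThan_atLeast0)
  have "bij_betw (\<lambda>(S, r, \<mu>). ({..<n} - S, r, \<mu>)) ?X ?Y"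
  proof (rule bij_betw_byWitness[where f' = "\<lambda>(S, r, \<mu>). ({..<n} - S, r, \<mu>)"])
    \<comment> \<open>With J the complement of S, the weight |S| + 2r - n becomes 2r - |J|, and
      n(n-1)/2 minus the t-degree becomes the sum of J minus that of \<mu>.\<close>
    have compl: "card ({..<n} - S) = n - card S" "card S \<le> n" "\<Sum>{..<n} = \<Sum>S + \<Sum>({..<n} - S)" if "S \<subseteq> {..<n}" for S
      using that card_Diff_subset[of S "{..<n}"] card_mono[of "{..<n}" S] finite_subset[of S "{..<n}"]
        sum.subset_diff[of S "{..<n}" "\<lambda>x. x"] by auto
    show "(\<lambda>(S, r, \<mu>). ({..<n} - S, r, \<mu>)) ` ?X \<subseteq> ?Y"
    proof (rule image_subsetI)
      fix x assume x: "x \<in> ?X"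
      obtain S r \<mu> where x_eq: "x = (S, r, \<mu>)" by (cases x)
      then have S: "S \<subseteq> {..<n}" using x by (simp add: weyl_index_def)
      show "(case x of (S, r, \<mu>) \<Rightarrow> ({..<n} - S, r, \<mu>)) \<in> ?Y"
        using x compl[OF S] total by (auto simp: x_eq weyl_index_def limit_index_def simp del: of_nat_sum)
    qed
    show "(\<lambda>(S, r, \<mu>). ({..<n} - S, r, \<mu>)) ` ?Y \<subseteq> ?X"
    proof (rule image_subsetI)
      fix x assume x: "x \<in> ?Y"
      obtain J r \<mu> where x_eq: "x = (J, r, \<mu>)" by (cases x)
      then have J: "J \<subseteq> {..<n}" using x by simp
      then have "card J + card ({..<n} - J) = n" using compl[OF J] by simp
      then show "(case x of (S, r, \<mu>) \<Rightarrow> ({..<n} - S, r, \<mu>)) \<in> ?X"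
        using x compl[OF J] total by (auto simp: x_eq weyl_index_def limit_index_def simp del: of_nat_sum)
    qed
  qed (auto simp: weyl_index_def)
  then have card: "card ?X = card ?Y" by (rule bij_betw_same_card)
  show ?thesis
  proof (cases "int (n * (n - 1) div 2) - b < 0")
    case True
    then have "\<not> (case c of (m :: nat, a', s) \<Rightarrow> a' = a \<and> int s = int (n * (n - 1) div 2) - b)" for c
      by (cases c) auto
    then have "?X = {}" by blast
    then show ?thesis using True card by (simp add: weyl_ch_normalized_def)
  next
    case False
    define N where "N = int (n * (n - 1) div 2) - b"
    have "(case index_grade n x of (m, a', s) \<Rightarrow> a' = a \<and> int s = N) \<longleftrightarrow> index_grade n x = (n, a, nat N)" for x
    proof -
      obtain m a' s where g: "index_grade n x = (m, a', s)" by (cases "index_grade n x")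
      moreover have "m = n" using g by (cases x) simp
      moreover have "int s = N \<longleftrightarrow> s = nat N" using False by (auto simp: N_def)
      ultimately show ?thesis by simp
    qed
    then have "?X = {x \<in> weyl_index n. index_grade n x = (n, a, nat N)}"
      by (simp only: N_def)
    then show ?thesis using False card by (simp add: weyl_ch_normalized_def weyl_ch_eq_card Let_def N_def)
  qed
qed

text \<open>Put l = |J| - r. The sum of J is at least (r + l)(r + l - 1)/2 and at most b + r l. The
  mixed terms cancel, leaving r^2 + l^2 <= 2 b + r + l, which forces b >= 0 and bounds r, l and then
  J.\<close>

lemma limit_index_bounds:
  assumes "(J, r, \<mu>) \<in> limit_index a b"
  shows "0 \<le> b" "r \<le> nat b + 1" "card J - r \<le> nat b + 1" "J \<subseteq> {..nat b + (nat b + 1) * (nat b + 1)}"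
proof -
  define l where "l = card J - r"
  have J: "finite J" "card J = r + l" "\<mu> \<in> box_partitions r l" "int (\<Sum>J) = b + int (sum_list \<mu>)"
    using assms by (auto simp: limit_index_def l_def)
  have "sum_list \<mu> \<le> r * l" using J by (intro sum_box_partitions_le)
  then have le: "int (\<Sum>J) \<le> b + int r * int l" using J(4) by (metis add_left_mono of_nat_le_iff of_nat_mult)
  have "int ((r + l) * (r + l)) \<le> int (2 * \<Sum>J + (r + l))"
    using card_square_le_sum[OF J(1)] J(2) by (metis of_nat_le_iff)
  then have sq: "int r * int r + int l * int l \<le> 2 * b + int r + int l"
    using le by (simp add: algebra_simps)
  have nn: "x * x \<ge> x" for x :: int by (cases "x \<ge> 1") (auto simp: mult_le_cancel_right1 intro: order_trans[OF _ zero_le_square])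
  show b: "0 \<le> b" using sq nn[of "int r"] nn[of "int l"] by linarith
  have bound: "x \<le> nat b + 1" if "int x * int x \<le> 2 * b + int x" for x
  proof (rule ccontr)
    assume "\<not> ?thesis"
    then have "int x \<ge> b + 2" using b by linarith
    then have "(b + 2) * (b + 1) \<le> int x * (int x - 1)" using b by (intro mult_mono) auto
    moreover have "(b + 2) * (b + 1) = b * b + 3 * b + 2" by (simp add: algebra_simps)
    then have "(b + 2) * (b + 1) > 2 * b" using b zero_le_square[of b] by linarith
    ultimately show False using that by (simp add: algebra_simps)
  qed
  have "int r * int r \<le> 2 * b + int r" "int l * int l \<le> 2 * b + int l"
    using sq nn[of "int r"] nn[of "int l"] by linarith+
  then show r: "r \<le> nat b + 1" and l: "card J - r \<le> nat b + 1"
    using bound l_def by auto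
  have "r * l \<le> (nat b + 1) * (nat b + 1)" using r l by (intro mult_mono) (auto simp: l_def)
  then have "\<Sum>J \<le> nat b + (nat b + 1) * (nat b + 1)" using le b
    by (metis (no_types, lifting) add_left_mono int_nat_eq of_nat_add of_nat_le_iff of_nat_mult order_trans)
  moreover have "j \<le> \<Sum>J" if "j \<in> J" for j using member_le_sum[of j J "\<lambda>x. x"] that J(1) by simp
  ultimately show "J \<subseteq> {..nat b + (nat b + 1) * (nat b + 1)}" by force
qed

lemma eventually_weyl_ch_normalized:
  "eventually (\<lambda>n. weyl_ch_normalized n a b = int (card (limit_index a b))) sequentially"
proof (rule eventually_sequentiallyI)
  fix n assume n: "n \<ge> nat b + (nat b + 1) * (nat b + 1) + 1"
  have "{(J, r, \<mu>) \<in> limit_index a b. J \<subseteq> {..<n}} = limit_index a b"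
  proof safe
    fix J r \<mu> j assume "(J, r, \<mu>) \<in> limit_index a b" "j \<in> J"
    then show "j < n" using limit_index_bounds(4)[of J r \<mu> a b] n by auto
  qed
  then show "weyl_ch_normalized n a b = int (card (limit_index a b))"
    by (simp add: weyl_ch_normalized_eq_card)
qed

section \<open>Pairs of finite sets\<close>

definition fermion_pairs :: "int \<Rightarrow> nat \<Rightarrow> (nat set \<times> nat set) set" where
  "fermion_pairs a b = {(P, Q). finite P \<and> finite Q \<and> int (card P) - int (card Q) = a \<and> \<Sum>P + \<Sum>Q = b}"

text \<open>Both sets are fibred over the pairs \<open>(r, c)\<close> with difference
  \<open>a\<close>, via \<open>c = card J - r\<close> on one side and
  \<open>(card P, card Q)\<close> on the other. The fibres have equal size by
  \<open>strict_partitions_mult_nth\<close>.\<close>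

lemma card_limit_index: "card (limit_index a (int b)) = card (fermion_pairs a b)"
proof -
  \<comment> \<open>The bound \<open>b + 1\<close> makes the base finite and loses nothing, by
    \<open>limit_index_bounds\<close> on one side and \<open>card_square_le_sum\<close> on the
    other.\<close>
  let ?D = "{(r, c). r \<le> b + 1 \<and> c \<le> b + 1 \<and> int r - int c = a}"
  let ?T = "\<lambda>(r, c). {(J, \<mu>). finite J \<and> card J = r + c \<and> \<mu> \<in> box_partitions r c \<and> \<Sum>J = b + sum_list \<mu>}"
  let ?U = "\<lambda>(r, c). {(P, Q). finite P \<and> card P = r \<and> finite Q \<and> card Q = c \<and> \<Sum>P + \<Sum>Q = (b :: nat)}"
  have finD: "finite ?D" by (rule finite_subset[of _ "{..b+1} \<times> {..b+1}"]) auto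
  have finT: "finite (?T d)" for d
  proof -
    obtain r c where d: "d = (r, c)" by fastforce
    have "?T d \<subseteq> (\<Union>i\<le>b + r * c. sets_of_sum i) \<times> box_partitions r c"
      unfolding d by (auto simp: sets_of_sum_def dest: sum_box_partitions_le)
    moreover have "finite ((\<Union>i\<le>b + r * c. sets_of_sum i) \<times> box_partitions r c)"
      by (auto simp: box_partitions_finite_card)
    ultimately show ?thesis by (rule finite_subset)
  qed
  have finU: "finite (?U d)" for d
  proof (rule finite_subset)
    show "?U d \<subseteq> (\<Union>i\<le>b. sets_of_sum i) \<times> (\<Union>i\<le>b. sets_of_sum i)" by (auto simp: sets_of_sum_def split: prod.splits)
  qed auto
  have TU: "card (?T d) = card (?U d)" for d
  proof -
    obtain r c where d: "d = (r, c)" by fastforce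
    let ?A = "\<lambda>m i. {P :: nat set. finite P \<and> card P = m \<and> \<Sum>P = i}"
    have fin: "finite (?A m i)" for m i
      by (rule finite_subset[OF _ finite_sets_of_sum[of i]]) (auto simp: sets_of_sum_def)
    have "int (card (?T d)) = (strict_partitions r * strict_partitions c) $ b"
      by (simp add: strict_partitions_mult_nth d)
    also have "\<dots> = int (\<Sum>i\<le>b. card (?A r i) * card (?A c (b - i)))"
      by (simp add: fps_mult_nth strict_partitions_nth atLeast0AtMost)
    also have "(\<Sum>i\<le>b. card (?A r i) * card (?A c (b - i))) = card (SIGMA i:{..b}. ?A r i \<times> ?A c (b - i))"
      by (subst card_SigmaI) (auto simp: fin card_cartesian_product)
    also have "\<dots> = card (?U d)"
      by (rule bij_betw_same_card[of snd]) (auto simp: bij_betw_def inj_on_def image_iff d)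
    finally show ?thesis by simp
  qed
  have "card (limit_index a (int b)) = card (SIGMA d:?D. ?T d)"
  proof (rule bij_betw_same_card)
    show "bij_betw (\<lambda>(J, r, \<mu>). ((r, card J - r), (J, \<mu>))) (limit_index a (int b)) (SIGMA d:?D. ?T d)"
    proof (rule bij_betw_byWitness[where f' = "\<lambda>((r, c), (J, \<mu>)). (J, r, \<mu>)"])
      show "(\<lambda>(J, r, \<mu>). ((r, card J - r), (J, \<mu>))) ` limit_index a (int b) \<subseteq> (SIGMA d:?D. ?T d)"
      proof (rule image_subsetI)
        fix x assume "x \<in> limit_index a (int b)"
        then obtain J r \<mu> where x_eq: "x = (J, r, \<mu>)" and x: "(J, r, \<mu>) \<in> limit_index a (int b)"
          by (cases x) auto
        show "(case x of (J, r, \<mu>) \<Rightarrow> ((r, card J - r), (J, \<mu>))) \<in> (SIGMA d:?D. ?T d)"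
          unfolding x_eq using limit_index_bounds[OF x] x by (auto simp: limit_index_def simp del: of_nat_sum)
      qed
    qed (auto simp: limit_index_def simp del: of_nat_sum)
  qed
  also have "\<dots> = (\<Sum>d\<in>?D. card (?T d))" by (rule card_SigmaI) (use finD finT in blast)+
  also have "\<dots> = (\<Sum>d\<in>?D. card (?U d))" by (simp only: TU)
  also have "\<dots> = card (SIGMA d:?D. ?U d)" by (rule card_SigmaI[symmetric]) (use finD finU in blast)+
  also have "\<dots> = card (fermion_pairs a b)"
  proof (rule bij_betw_same_card)
    have le: "card P \<le> b + 1" if "finite P" "\<Sum>P \<le> b" for P
    proof (rule ccontr)
      assume "\<not> ?thesis"
      then have "(b + 2) * card P \<le> card P * card P" by (intro mult_right_mono) auto
      with card_square_le_sum[OF that(1)] that(2) have "(b + 1) * card P \<le> 2 * b" by simp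
      moreover have "(b + 1) * 2 \<le> (b + 1) * card P"
        using \<open>\<not> card P \<le> b + 1\<close> by (intro mult_left_mono) auto
      ultimately show False by simp
    qed
    show "bij_betw snd (SIGMA d:?D. ?U d) (fermion_pairs a b)"
    proof (rule bij_betw_byWitness[where f' = "\<lambda>(P, Q). ((card P, card Q), (P, Q))"])
      show "(\<lambda>(P, Q). ((card P, card Q), (P, Q))) ` fermion_pairs a b \<subseteq> (SIGMA d:?D. ?U d)"
      proof (rule image_subsetI)
        fix x assume x: "x \<in> fermion_pairs a b"
        obtain P Q where x_eq: "x = (P, Q)" by (cases x)
        have "card P \<le> b + 1" "card Q \<le> b + 1"
          by (intro le; use x in \<open>auto simp: fermion_pairs_def x_eq\<close>)+
        then show "(case x of (P, Q) \<Rightarrow> ((card P, card Q), (P, Q))) \<in> (SIGMA d:?D. ?U d)"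
          using x by (simp add: fermion_pairs_def x_eq)
      qed
    qed (auto simp: fermion_pairs_def)
  qed
  finally show ?thesis .
qed

section \<open>The infinite products\<close>

definition fermions :: "int \<Rightarrow> laurent_fps" where
  "fermions k = Abs_fps (\<lambda>b. \<Sum>P\<in>sets_of_sum b. Poly_Mapping.single (int (card P) * k) 1)"

lemma x_pow_power: "x_pow k ^ m = x_pow (int m * k)"
proof (induction m)
  case 0
  then show ?case by (simp add: x_pow_def)
next
  case (Suc m)
  have "x_pow k ^ Suc m = x_pow k * x_pow (int m * k)" by (simp add: Suc)
  also have "\<dots> = x_pow (int (Suc m) * k)"
    by (simp add: x_pow_def fps_const_mult[symmetric] mult_single algebra_simps)
  finally show ?case .
qed

text \<open>The partial products expand over the subsets of \<open>{..n}\<close>. A set of sum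
  \<open>b\<close> lies in \<open>{..b}\<close>, so the coefficient of q^b is constant from
  \<open>n = b\<close> on.\<close>

lemma prodinf_fermions: "prodinf (\<lambda>i. 1 + q_var ^ i * x_pow k) = fermions k"
proof -
  let ?f = "\<lambda>i. 1 + q_var ^ i * x_pow k"
  have partial: "(\<Prod>i\<le>n. ?f i) = (\<Sum>P\<in>Pow {..n}. q_var ^ \<Sum>P * x_pow (int (card P) * k))" for n
  proof -
    have "(\<Prod>i\<le>n. ?f i) = (\<Prod>i\<le>n. q_var ^ i * x_pow k + 1)" by (simp add: add.commute)
    also have "\<dots> = (\<Sum>P\<in>Pow {..n}. (\<Prod>i\<in>P. q_var ^ i * x_pow k) * (\<Prod>i\<in>{..n} - P. 1))"
      by (rule prod_add) simp
    also have "\<dots> = (\<Sum>P\<in>Pow {..n}. q_var ^ \<Sum>P * x_pow (int (card P) * k))"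
      by (simp add: prod.distrib power_sum x_pow_power)
    finally show ?thesis .
  qed
  have "(\<lambda>n. \<Prod>i\<le>n. ?f i) \<longlonglongrightarrow> fermions k"
  proof (rule tendsto_fpsI, rule eventually_sequentiallyI)
    fix b n :: nat assume "n \<ge> b"
    have "(\<Prod>i\<le>n. ?f i) $ b = (\<Sum>P\<in>Pow {..n}. if \<Sum>P = b then Poly_Mapping.single (int (card P) * k) 1 else 0)"
      unfolding partial fps_sum_nth
      by (intro sum.cong refl) (simp add: x_pow_def fps_X_power_mult_nth)
    also have "\<dots> = (\<Sum>P\<in>sets_of_sum b. Poly_Mapping.single (int (card P) * k) 1)"
    proof (rule sum.mono_neutral_cong_right)
      show "sets_of_sum b \<subseteq> Pow {..n}"
        using \<open>n \<ge> b\<close> by (auto simp: sets_of_sum_def intro: order_trans[OF member_le_sum])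
    qed (auto simp: sets_of_sum_def finite_subset)
    finally show "(\<Prod>i\<le>n. ?f i) $ b = fermions k $ b" by (simp add: fermions_def)
  qed
  \<comment> \<open>\<open>has_prod\<close> asks for a nonzero limit. The sets {} and {0} give the
    constant coefficient 1 + x^k in q.\<close>
  moreover have "fermions k \<noteq> 0"
  proof
    have *: "sets_of_sum 0 = {{}, {0}}"
    proof (intro equalityI subsetI)
      fix P assume "P \<in> sets_of_sum 0"
      then have "P \<subseteq> {0}" by (auto simp: sets_of_sum_def)
      then show "P \<in> {{}, {0}}" by auto
    qed (auto simp: sets_of_sum_def)
    assume "fermions k = 0"
    then have "fermions k $ 0 = 0" by simp
    then have "Poly_Mapping.lookup (Poly_Mapping.single 0 1 + Poly_Mapping.single k (1::int)) 0 = 0"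
      by (simp add: fermions_def *)
    then show False by (simp add: lookup_add lookup_single when_def split: if_splits)
  qed
  ultimately have "?f has_prod fermions k"
    by (simp add: has_prod_def raw_has_prod_def)
  then show ?thesis by (rule has_prod_unique[symmetric])
qed

lemma coeff_xq_fermions:
  "coeff_xq (fermions 1 * fermions (-1)) a (int b) = int (card (fermion_pairs a b))"
proof -
  let ?S = "SIGMA i:{..b}. sets_of_sum i \<times> sets_of_sum (b - i)"
  have finS: "finite ?S" by auto
  have "(fermions 1 * fermions (-1)) $ b = (\<Sum>i\<le>b. \<Sum>P\<in>sets_of_sum i. \<Sum>Q\<in>sets_of_sum (b - i).
      Poly_Mapping.single (int (card P) - int (card Q)) 1)"
    by (simp add: fermions_def fps_mult_nth atLeast0AtMost sum_product mult_single)
  then have "coeff_xq (fermions 1 * fermions (-1)) a (int b)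
    = (\<Sum>i\<le>b. \<Sum>P\<in>sets_of_sum i. \<Sum>Q\<in>sets_of_sum (b - i). if int (card P) - int (card Q) = a then 1 else 0)"
    by (simp add: coeff_xq_def lookup_sum lookup_single when_def eq_commute[of a])
  also have "\<dots> = (\<Sum>(i, P, Q)\<in>?S. if int (card P) - int (card Q) = a then 1 else 0)"
    by (simp add: sum.Sigma sum.cartesian_product)
  also have "\<dots> = (\<Sum>x\<in>{(i, P, Q) \<in> ?S. int (card P) - int (card Q) = a}. 1)"
    using finS by (intro sum.mono_neutral_cong_right) (auto split: if_splits)
  also have "\<dots> = int (card {(i, P, Q) \<in> ?S. int (card P) - int (card Q) = a})" by simp
  also have "card {(i, P, Q) \<in> ?S. int (card P) - int (card Q) = a} = card (fermion_pairs a b)"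
  proof (rule bij_betw_same_card)
    show "bij_betw snd {(i, P, Q) \<in> ?S. int (card P) - int (card Q) = a} (fermion_pairs a b)"
      by (rule bij_betw_byWitness[where f' = "\<lambda>(P, Q). (\<Sum>P, P, Q)"])
        (auto simp: fermion_pairs_def sets_of_sum_def)
  qed
  finally show ?thesis .
qed

theorem theorem1p17:
  fixes \<phi> :: "nat \<Rightarrow> weyl_sum \<Rightarrow> weyl_sum"
    and scl_L :: "complex \<Rightarrow> 'l::ab_group_add \<Rightarrow> 'l"
    and act_L :: "osp \<times> nat \<Rightarrow> 'l \<Rightarrow> 'l"
    and \<iota> :: "nat \<Rightarrow> weyl_sum \<Rightarrow> 'l"
  assumes "weyl_embeddings \<phi>"
    and "weyl_inductive_limit \<phi> scl_L act_L \<iota>"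
  shows "\<forall>a b. convergent (\<lambda>n. weyl_ch_normalized n a b) \<and>
    ch_L a b =
      coeff_xq (prodinf (\<lambda>i. 1 + q_var ^ i * x_pow 1) * prodinf (\<lambda>i. 1 + q_var ^ i * x_pow (-1))) a b"
proof (intro allI conjI)
  fix a b
  have lim: "(\<lambda>n. weyl_ch_normalized n a b) \<longlonglongrightarrow> int (card (limit_index a b))"
    by (rule tendsto_eventually[OF eventually_weyl_ch_normalized])
  then show "convergent (\<lambda>n. weyl_ch_normalized n a b)" by (rule convergentI)
  have "ch_L a b = int (card (limit_index a b))"
    unfolding ch_L_def using lim by (rule limI)
  also have "\<dots> = coeff_xq (fermions 1 * fermions (-1)) a b"
  proof (cases "b < 0")
    \<comment> \<open>Negative powers of q occur on neither side.\<close>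
    case True
    then have "limit_index a b = {}" using limit_index_bounds(1) by fastforce
    then show ?thesis using True by (simp add: coeff_xq_def)
  next
    case False
    then obtain b' where "b = int b'" by (metis nonneg_int_cases not_less)
    then show ?thesis by (simp add: card_limit_index coeff_xq_fermions)
  qed
  finally show "ch_L a b =
      coeff_xq (prodinf (\<lambda>i. 1 + q_var ^ i * x_pow 1) * prodinf (\<lambda>i. 1 + q_var ^ i * x_pow (-1))) a b"
    by (simp only: prodinf_fermions)
qed

end
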